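(* For any scaling function $\{a_n(t)\}_{n\in\mathbb{N},t>0}$ satisfying $\lim_{n\to+\infty}\frac{\log a_n(t)}{n}=0$ for every $t>0$, there exists an ergodic measure-preserving rank two system $(T,X,\mathcal{B},\mu_X)$ such that its lower measure-theoretic slow entropy satisfies $$\underline{\mathrm{ent}}_{a_n(t)}^{\mu_X}(T)=+\infty,$$ where $X$ is an interval of finite length in $[0,+\infty)$, $\mathcal{B}$ is its Borel $\sigma$-algebra, $\mu_X(A)=\frac{\mu(A\cap X)}{\mu(X)}$ for any $A\in\mathcal{B}$, and $\mu$ is the Lebesgue measure of $\mathbb{R}$.
   Context: Scaling function: a family $\{a_n(t)\}_{n\in\mathbb{N},t>0}$ of positive sequences increasing to infinity and monotone in $t$, i.e. $a_n(t)\le a_{n+1}(t)$, $\lim_{n\to\infty}a_n(t)=+\infty$ for every $t>0$, and $a_n(t_1)\le a_n(t_2)$ for $t_2>t_1>0$. Lower slow entropy. Let $T$ be an (invertible) measure-preserving transformation of a standard Borel probability space $(X,\mathcal{B},\mu)$ and $\mathcal{P}=\{P_1,\dots,P_m\}$ a finite measurable partition. The $n$-name of $x$ is $w(x)=(w_k(x))_{k=0}^{n-1}\in\{1,\dots,m\}^n$ with $T^k(x)\in P_{w_k(x)}$. For words $w,w'$ of length $n$, the Hamming metric is $d_n^H(w,w')=\frac1n\#\{0\le k\le n-1: w_k\ne w'_k\}$. Put $B_{\mathcal{P},n}(x,T,\epsilon)=\{y\in X: d_n^H(w(x),w(y))<\epsilon\}$ and let $S_{\mathcal{P}}(T,n,\epsilon)$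 be the minimal cardinality of a family of such $\epsilon$-Hamming balls whose union has $\mu$-measure greater than $1-\epsilon$. Let $B(\epsilon,\mathcal{P})=\{t>0:\liminf_{n\to\infty}\frac{S_{\mathcal{P}}(T,n,\epsilon)}{a_n(t)}>0\}$, let $A(\epsilon,\mathcal{P})=\sup B(\epsilon,\mathcal{P})$ if this set is nonempty and $A(\epsilon,\mathcal{P})=0$ otherwise. Then $\underline{\mathrm{ent}}_{a_n(t)}^{\mu}(T,\mathcal{P})=\lim_{\epsilon\to0}A(\epsilon,\mathcal{P})$ and $\underline{\mathrm{ent}}_{a_n(t)}^{\mu}(T)=\sup_{\mathcal{P}}\underline{\mathrm{ent}}_{a_n(t)}^{\mu}(T,\mathcal{P})$, the supremum being over all finite measurable partitions. Finite rank. A system is of rank at most $\ell$ if for every finite measurable partition $\mathcal{P}$ of $X$ and every $\epsilon>0$ there exist $\ell$ subsets $B_i$ of $X$, $\ell$ positive integers $h_i$ and a partition $\mathcal{P}'$ of $X$ such that: (a) the sets $T^jB_i$, $1\le i\le\ell$, $0\le j\le h_i-1$, are pairwise disjoint; (b) $|\mathcal{P}-\mathcal{P}'|<\epsilon$ (the partition distance, i.e. the sum of the measures of symmetric differences of corresponding atoms); (c) $\mathcal{P}'$ is refined by the partition $\{T^jB_i:1\le i\le\ell,0\le j\le h_i-1\}\cup\{X\setminus\bigcup_{i,j}T^jB_i\}$. It is of rank $\ell$ if it is of rank at most $\ell$ and not of rank at most $\ell-1$; "rank two" means rank $2$. *)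

theory Defs
  imports "HOL-Probability.Probability"
begin

section \<open>Scaling functions\<close>

definition scaling_function :: "(nat \<Rightarrow> real \<Rightarrow> real) \<Rightarrow> bool" where
  "scaling_function a \<longleftrightarrow>
     (\<forall>t>0. \<forall>n. 0 < a n t) \<and>
     (\<forall>t>0. \<forall>n. a n t \<le> a (Suc n) t) \<and>
     (\<forall>t>0. filterlim (\<lambda>n. a n t) at_top sequentially) \<and>
     (\<forall>n s t. 0 < s \<and> s < t \<longrightarrow> a n s \<le> a n t)"


section \<open>Measure-preserving systems\<close>

text \<open>The transformation is a genuine bijection of the space (not merely a bijection modulo null
  sets), with measurable inverse.\<close>

definition invertible_mpt :: "'a measure \<Rightarrow> ('a \<Rightarrow> 'a) \<Rightarrow> bool" where
  "invertible_mpt M T \<longleftrightarrow>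
     prob_space M \<and>
     bij_betw T (space M) (space M) \<and>
     T \<in> measurable M M \<and>
     inv_into (space M) T \<in> measurable M M \<and>
     (\<forall>A\<in>sets M. measure M (T -` A \<inter> space M) = measure M A)"

definition ergodic :: "'a measure \<Rightarrow> ('a \<Rightarrow> 'a) \<Rightarrow> bool" where
  "ergodic M T \<longleftrightarrow>
     (\<forall>A\<in>sets M. T -` A \<inter> space M = A \<longrightarrow> measure M A = 0 \<or> measure M A = 1)"

text \<open>A partition into atoms \<open>P 1, \<dots>, P m\<close>; the values of \<open>P\<close> outside \<open>{1..m}\<close> are
  irrelevant, and atoms may be empty.\<close>

definition finite_partition :: "'a measure \<Rightarrow> nat \<Rightarrow> (nat \<Rightarrow> 'a set) \<Rightarrow> bool" where
  "finite_partition M m P \<longleftrightarrow>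
     (\<forall>i\<in>{1..m}. P i \<in> sets M) \<and>
     disjoint_family_on P {1..m} \<and>
     (\<Union>i\<in>{1..m}. P i) = space M"


section \<open>Lower slow entropy\<close>

text \<open>The \<open>n\<close>-name of \<open>x\<close> is the restriction of \<open>itinerary m P T x\<close> to \<open>{..<n}\<close>.\<close>

definition itinerary :: "nat \<Rightarrow> (nat \<Rightarrow> 'a set) \<Rightarrow> ('a \<Rightarrow> 'a) \<Rightarrow> 'a \<Rightarrow> nat \<Rightarrow> nat" where
  "itinerary m P T x k = (THE i. i \<in> {1..m} \<and> (T ^^ k) x \<in> P i)"

definition hamming_dist :: "nat \<Rightarrow> (nat \<Rightarrow> nat) \<Rightarrow> (nat \<Rightarrow> nat) \<Rightarrow> real" where
  "hamming_dist n w w' = real (card {k. k < n \<and> w k \<noteq> w' k}) / real n"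

definition hamming_ball ::
  "'a measure \<Rightarrow> nat \<Rightarrow> (nat \<Rightarrow> 'a set) \<Rightarrow> ('a \<Rightarrow> 'a) \<Rightarrow> nat \<Rightarrow> real \<Rightarrow> 'a \<Rightarrow> 'a set" where
  "hamming_ball M m P T n \<epsilon> x =
     {y \<in> space M. hamming_dist n (itinerary m P T x) (itinerary m P T y) < \<epsilon>}"

definition hamming_cover_number ::
  "'a measure \<Rightarrow> nat \<Rightarrow> (nat \<Rightarrow> 'a set) \<Rightarrow> ('a \<Rightarrow> 'a) \<Rightarrow> nat \<Rightarrow> real \<Rightarrow> nat" where
  "hamming_cover_number M m P T n \<epsilon> =
     (LEAST c. \<exists>F. F \<subseteq> hamming_ball M m P T n \<epsilon> ` space M \<and> finite F \<and> card F = c \<and>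
        measure M (\<Union>F) > 1 - \<epsilon>)"

definition slow_growth_set ::
  "(nat \<Rightarrow> real \<Rightarrow> real) \<Rightarrow> 'a measure \<Rightarrow> nat \<Rightarrow> (nat \<Rightarrow> 'a set) \<Rightarrow> ('a \<Rightarrow> 'a) \<Rightarrow> real \<Rightarrow> real set" where
  "slow_growth_set a M m P T \<epsilon> =
     {t. 0 < t \<and>
        Liminf sequentially (\<lambda>n. ereal (real (hamming_cover_number M m P T n \<epsilon>) / a n t)) > 0}"

definition slow_growth_rate ::
  "(nat \<Rightarrow> real \<Rightarrow> real) \<Rightarrow> 'a measure \<Rightarrow> nat \<Rightarrow> (nat \<Rightarrow> 'a set) \<Rightarrow> ('a \<Rightarrow> 'a) \<Rightarrow> real \<Rightarrow> ereal" where
  "slow_growth_rate a M m P T \<epsilon> =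
     (let B = slow_growth_set a M m P T \<epsilon> in if B = {} then 0 else Sup (ereal ` B))"

text \<open>The limit below always exists in the extended reals for an invertible measure-preserving
  transformation and a finite partition: the cover number, and hence the growth rate, is
  nonincreasing in \<open>\<epsilon>\<close>.\<close>

definition lower_slow_entropy_partition ::
  "(nat \<Rightarrow> real \<Rightarrow> real) \<Rightarrow> 'a measure \<Rightarrow> nat \<Rightarrow> (nat \<Rightarrow> 'a set) \<Rightarrow> ('a \<Rightarrow> 'a) \<Rightarrow> ereal" where
  "lower_slow_entropy_partition a M m P T =
     Lim (at_right 0) (\<lambda>\<epsilon>. slow_growth_rate a M m P T \<epsilon>)"

definition lower_slow_entropy ::
  "(nat \<Rightarrow> real \<Rightarrow> real) \<Rightarrow> 'a measure \<Rightarrow> ('a \<Rightarrow> 'a) \<Rightarrow> ereal" where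
  "lower_slow_entropy a M T =
     Sup {lower_slow_entropy_partition a M m P T | m P. finite_partition M m P}"


section \<open>Finite rank\<close>

definition tower_levels ::
  "nat \<Rightarrow> ('a \<Rightarrow> 'a) \<Rightarrow> (nat \<Rightarrow> 'a set) \<Rightarrow> (nat \<Rightarrow> nat) \<Rightarrow> 'a set set" where
  "tower_levels l T B h = {(T ^^ j) ` B i | i j. i \<in> {1..l} \<and> j < h i}"

definition partition_distance ::
  "'a measure \<Rightarrow> nat \<Rightarrow> (nat \<Rightarrow> 'a set) \<Rightarrow> (nat \<Rightarrow> 'a set) \<Rightarrow> real" where
  "partition_distance M m P Q = (\<Sum>i=1..m. measure M ((P i - Q i) \<union> (Q i - P i)))"

text \<open>Empty sets are removed before applying \<^const>\<open>refines\<close>, because \<^const>\<open>partition_on\<close>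
  does not admit empty blocks.\<close>

definition rank_at_most :: "nat \<Rightarrow> 'a measure \<Rightarrow> ('a \<Rightarrow> 'a) \<Rightarrow> bool" where
  "rank_at_most l M T \<longleftrightarrow>
     (\<forall>m P. finite_partition M m P \<longrightarrow> (\<forall>\<epsilon>>0. \<exists>B h P'.
        (\<forall>i\<in>{1..l}. B i \<in> sets M \<and> 0 < h i) \<and>
        finite_partition M m P' \<and>
        disjoint_family_on (\<lambda>(i, j). (T ^^ j) ` B i) (SIGMA i:{1..l}. {..<h i}) \<and>
        partition_distance M m P P' < \<epsilon> \<and>
        refines (space M)
          (insert (space M - \<Union>(tower_levels l T B h)) (tower_levels l T B h) - {{}})
          (P' ` {1..m} - {{}})))"

definition has_rank :: "nat \<Rightarrow> 'a measure \<Rightarrow> ('a \<Rightarrow> 'a) \<Rightarrow> bool" where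
  "has_rank l M T \<longleftrightarrow> rank_at_most l M T \<and> \<not> rank_at_most (l - 1) M T"


section \<open>Normalized Lebesgue measure on an interval\<close>

definition normalized_lborel :: "real set \<Rightarrow> real measure" where
  "normalized_lborel X = uniform_measure (restrict_space lborel X) X"

lemma space_normalized_lborel [simp]: "space (normalized_lborel X) = X"
  by (simp add: normalized_lborel_def space_restrict_space)

lemma sets_normalized_lborel: "sets (normalized_lborel X) = sets (restrict_space borel X)"
  by (simp add: normalized_lborel_def cong: sets_restrict_space_cong)

lemma measure_normalized_lborel:
  assumes X: "X \<in> sets borel" "bounded X" "0 < measure lborel X"
    and A: "A \<in> sets (normalized_lborel X)"
  shows "measure (normalized_lborel X) A = measure lborel (A \<inter> X) / measure lborel X"
proof -
  have fin: "emeasure lborel X < \<infinity>"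
    using X(2) by (rule emeasure_bounded_finite)
  have Xs: "X \<inter> space lborel \<in> sets lborel" using X(1) by simp
  have AX: "A \<subseteq> X"
    using sets.sets_into_space[OF A] by simp
  have A': "A \<in> sets (restrict_space lborel X)"
    using A by (simp add: normalized_lborel_def)
  have "emeasure lborel X \<noteq> 0" using X(3) by (auto simp: measure_def)
  then show ?thesis
    unfolding normalized_lborel_def using fin AX A'
    by (subst measure_uniform_measure)
       (auto simp: emeasure_restrict_space[OF Xs] measure_restrict_space[OF Xs]
          Int_absorb1 Int_absorb2)
qed

end

theory Submission
  imports Defs
begin

text \<open>The system is built by cutting and stacking with two towers at each stage, a short one and an
  extremely long one. The short tower of the next stage runs once through all columns of the present
  stage. The long one first runs through a code: all words of a huge length over the letters
  \<open>s\<^sup>d A\<^sup>p s\<^sup>a\<^sup>-\<^sup>d\<close>, where \<open>A\<close> is the present short tower, \<open>a\<close> its height, \<open>s\<close> a spacer and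
  \<open>0 \<le> d < a\<close>. As the shift \<open>d\<close> varies, two such letters are on average a definite proportion apart in
  the Hamming metric, because both symbols occur in \<open>A\<close> with frequency at least \<open>1/3\<close>; so a Hamming
  ball catches only an exponentially small part of the words, and the cover number grows
  exponentially in \<open>n / (p + 1) a\<close> for all \<open>n\<close> up to half of the word length. The word length is chosen
  only after the height of the next short tower is known, so that this range of \<open>n\<close> reaches the point
  where the next code already beats the scaling function.

  Two towers that generate give rank at most two. In a rank one system the cover number is at most
  linear along a sequence of \<open>n\<close>, which excludes rank one. Every stage cuts each interval into halves
  that go to the short and the long tower, so an invariant set has the same density in all intervals
  of a stage; this gives ergodicity.\<close>

section \<open>Two towers\<close>

text \<open>The lower entropy asks for large cover numbers at every length \<open>n\<close>, not
  only along a sequence. If the code sat in a single tower, prolonging its words would also lengthen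
  the letters of the next code, and the lengths between the two codes would escape control. Here
  \<open>a (k + 1) = r k * a k + b k\<close> is settled before \<open>\<nu> k\<close> enters;
  \<open>\<nu> k\<close> influences only \<open>r (k + 1)\<close> and \<open>b (k + 1)\<close>. So
  the next letter length \<open>l (k + 1)\<close> is known when the word length
  \<open>2 * \<nu> k\<close> is chosen, and the words can be made long compared with it. The shifts
  cost one spacer per \<open>reps k = 2 ^ (k + 2)\<close> symbols. This is summable: the total
  length stays between 4 and 6, and the symbol 1, which always occupies length 2, has frequency
  between 1/3 and 1/2. Constants: the mean distance of a letter from a fixed one is at least 1/6 of
  its length, which yields an exponential moment with rate 1/12 per letter. Words at distance at
  most 1/24 per letter give back half of this rate. Two points of an \<epsilon>-ball with \<epsilon>
  \<le> 1/96 differ in at most \<open>n / 48\<close> places, and \<open>n\<close> is at most twice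
  the length of the letters read in full.\<close>

definition reps :: "nat \<Rightarrow> nat" where "reps k = 2 ^ (k + 2)"

lemma reps_ge: "4 \<le> reps k"
proof -
  have "(2::nat) ^ 2 \<le> 2 ^ (k + 2)" by (rule power_increasing) auto
  then show ?thesis by (simp add: reps_def)
qed

text \<open>At stage \<open>k\<close> there are \<open>r k\<close> columns of height \<open>a k\<close> (the short tower \<open>A\<^sub>k\<close>) and one column of
  height \<open>b k\<close> (the long tower), laid out in this order on a line of length \<open>a (k + 1)\<close>, which is also
  the word \<open>A\<^sub>k\<^sub>+\<^sub>1\<close>. Every interval is cut into \<open>2 * r (k + 1)\<close> copies, the first half for the short
  tower. \<open>orig k x\<close> is \<open>Inl (i, c)\<close> if position \<open>x\<close> of line \<open>k + 1\<close> is copy \<open>c\<close> of position \<open>i\<close> of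
  line \<open>k\<close>, and \<open>Inr s\<close> if it is the new spacer number \<open>s\<close>. \<open>idx k x\<close> is the rank from the left on
  the real line of the interval at position \<open>x\<close>, and \<open>sym k x\<close> its symbol.\<close>

locale two_towers =
  fixes a b r \<nu> :: "nat \<Rightarrow> nat"
  assumes init: "a 0 = 2" "r 0 = 1" "b 0 = 2"
    and a_Suc: "a (Suc k) = r k * a k + b k"
    and r_Suc: "r (Suc k) = reps k * (2 * \<nu> k * a k ^ (2 * \<nu> k))"
    and b_Suc: "b (Suc k) = r (Suc k) * a (Suc k) + r k * (2 * \<nu> k * a k ^ (2 * \<nu> k)) * a k"
    and \<nu>_pos: "0 < \<nu> k"
begin

text \<open>Letters per word, letters in one run through all words, and length of a letter.\<close>

definition m :: "nat \<Rightarrow> nat" where "m k = 2 * \<nu> k"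
definition W :: "nat \<Rightarrow> nat" where "W k = m k * a k ^ m k"
definition l :: "nat \<Rightarrow> nat" where "l k = (reps k + 1) * a k"

text \<open>Letter \<open>i\<close> belongs to word number \<open>i div m k\<close>, and its shift
  is a base \<open>a k\<close> digit of this number; so \<open>a k ^ m k\<close> consecutive words
  are all the words. In later runs the word number exceeds \<open>a k ^ m k\<close>, but the final
  \<open>mod\<close> discards the excess.\<close>

definition digit :: "nat \<Rightarrow> nat \<Rightarrow> nat" where
  "digit k i = i div m k div a k ^ (i mod m k) mod a k"

text \<open>Run \<open>i div W k\<close> is fed by the column with the same number, and every letter
  takes \<open>reps k\<close> copies of it. A run has \<open>W k\<close> letters, so it uses up
  exactly the \<open>reps k * W k = r (Suc k)\<close> copies that the short tower leaves. Spacers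
  are numbered \<open>a k\<close> per letter, jumping over the middle block.\<close>

definition cell :: "nat \<Rightarrow> nat \<Rightarrow> nat \<Rightarrow> nat \<times> nat + nat" where
  "cell k i t = (let d = digit k i in
     if d \<le> t \<and> t < d + reps k * a k
     then Inl (i div W k * a k + (t - d) mod a k, r (Suc k) + i mod W k * reps k + (t - d) div a k)
     else Inr (i * a k + (if t < d then t else t - reps k * a k)))"

definition orig :: "nat \<Rightarrow> nat \<Rightarrow> nat \<times> nat + nat" where
  "orig k x = (let A = r (Suc k) * a (Suc k); C = r k * W k * l k in
     if x < A then Inl (x mod a (Suc k), x div a (Suc k))
     else if x < A + C then cell k ((x - A) div l k) ((x - A) mod l k)
     else Inl (r k * a k + (x - A - C) mod b k, r (Suc k) + (x - A - C) div b k))"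

primrec idx :: "nat \<Rightarrow> nat \<Rightarrow> nat" where
  "idx 0 x = x"
| "idx (Suc k) x = (case orig k x of Inl (i, c) \<Rightarrow> idx k i * (2 * r (Suc k)) + c
      | Inr s \<Rightarrow> a (Suc k) * (2 * r (Suc k)) + s)"

primrec sym :: "nat \<Rightarrow> nat \<Rightarrow> bool" where
  "sym 0 x = odd x"
| "sym (Suc k) x = (case orig k x of Inl (i, c) \<Rightarrow> sym k i | Inr s \<Rightarrow> False)"

text \<open>A line holds \<open>r k\<close> columns of height \<open>a k\<close> and one of height
  \<open>b k\<close>. These are the positions with a successor in the same column, where stage
  \<open>k\<close> already prescribes the map.\<close>

definition below_top :: "nat \<Rightarrow> nat \<Rightarrow> bool" where
  "below_top k i \<longleftrightarrow> Suc i < a (Suc k) \<and> \<not> (Suc i \<le> r k * a k \<and> a k dvd Suc i)"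

lemma a_r_b_pos: "2 \<le> a k \<and> 0 < r k \<and> 2 \<le> b k"
proof (induction k)
  case 0 show ?case using init by simp
next
  case (Suc k)
  have A: "2 \<le> a (Suc k)" using Suc a_Suc by simp
  have R: "0 < r (Suc k)" using Suc \<nu>_pos[of k] reps_ge[of k] by (simp add: r_Suc)
  have "1 * 2 \<le> r (Suc k) * a (Suc k)" using A R by (intro mult_le_mono) auto
  then show ?case using A R by (simp add: b_Suc)
qed

lemma a_ge2: "2 \<le> a k" and r_pos: "0 < r k" and b_ge2: "2 \<le> b k"
  using a_r_b_pos by auto

lemma a_pos: "0 < a k" and b_pos: "0 < b k"
  using a_ge2[of k] b_ge2[of k] by auto

lemma l_pos: "0 < l k" using a_pos by (simp add: l_def)

lemma r_Suc_W: "r (Suc k) = reps k * W k"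
  by (simp add: r_Suc W_def m_def)

lemma b_Suc_W: "b (Suc k) = r (Suc k) * a (Suc k) + r k * W k * a k"
  by (simp add: b_Suc W_def m_def)

text \<open>In the long tower the \<open>b k\<close> part of the line is repeated unchanged, while
  the \<open>r (Suc k) * (r k * a k)\<close> symbols of the columns are rearranged into the code;
  the spacers account for the difference.\<close>

lemma b_Suc_parts: "b (Suc k) = r k * W k * l k + r (Suc k) * b k"
  unfolding b_Suc_W r_Suc_W a_Suc l_def by (simp add: algebra_simps)

lemma a_Suc_Suc: "a (Suc (Suc k)) = a (Suc k) * (2 * r (Suc k)) + r k * W k * a k"
  by (simp add: a_Suc[of "Suc k"] b_Suc_W)

lemma digit_less: "digit k i < a k"
  using a_pos by (simp add: digit_def)

section \<open>The three segments of a line\<close>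

lemma orig_A:
  assumes "o' < a (Suc k)" "c < r (Suc k)"
  shows "c * a (Suc k) + o' < r (Suc k) * a (Suc k)"
    and "orig k (c * a (Suc k) + o') = Inl (o', c)"
proof -
  have "c * a (Suc k) + o' < c * a (Suc k) + a (Suc k)" using assms by simp
  also have "\<dots> = Suc c * a (Suc k)" by simp
  also have "\<dots> \<le> r (Suc k) * a (Suc k)" using assms by (intro mult_le_mono1) simp
  finally show "c * a (Suc k) + o' < r (Suc k) * a (Suc k)" .
  then show "orig k (c * a (Suc k) + o') = Inl (o', c)"
    using assms by (simp add: orig_def)
qed

lemma orig_code:
  assumes "i < r k * W k" "t < l k"
  shows "i * l k + t < r k * W k * l k"
    and "orig k (r (Suc k) * a (Suc k) + (i * l k + t)) = cell k i t"
proof -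
  have "i * l k + t < Suc i * l k" using assms by simp
  also have "\<dots> \<le> r k * W k * l k" using assms by (intro mult_le_mono1) simp
  finally show *: "i * l k + t < r k * W k * l k" .
  show "orig k (r (Suc k) * a (Suc k) + (i * l k + t)) = cell k i t"
    using * assms by (simp add: orig_def Let_def)
qed

lemma orig_B:
  assumes "z < b k" "c < r (Suc k)"
  shows "c * b k + z < r (Suc k) * b k"
   and "orig k (r (Suc k) * a (Suc k) + r k * W k * l k + (c * b k + z)) = Inl (r k * a k + z, r (Suc k) + c)"
proof -
  have "c * b k + z < Suc c * b k" using assms by simp
  also have "\<dots> \<le> r (Suc k) * b k" using assms by (intro mult_le_mono1) simp
  finally show "c * b k + z < r (Suc k) * b k" .
  show "orig k (r (Suc k) * a (Suc k) + r k * W k * l k + (c * b k + z)) = Inl (r k * a k + z, r (Suc k) + c)"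
    using assms by (simp add: orig_def Let_def)
qed

lemma line_parts: "a (Suc (Suc k)) = r (Suc k) * a (Suc k) + r k * W k * l k + r (Suc k) * b k"
  by (simp add: a_Suc[of "Suc k"] b_Suc_parts)

lemma line_cases:
  assumes "x < a (Suc (Suc k))"
  obtains (A) o' c where "o' < a (Suc k)" "c < r (Suc k)" "x = c * a (Suc k) + o'" "orig k x = Inl (o', c)"
   | (code) i t where "i < r k * W k" "t < l k" "x = r (Suc k) * a (Suc k) + (i * l k + t)" "orig k x = cell k i t"
   | (B) z c where "z < b k" "c < r (Suc k)" "x = r (Suc k) * a (Suc k) + r k * W k * l k + (c * b k + z)"
       "orig k x = Inl (r k * a k + z, r (Suc k) + c)"
proof -
  consider "x < r (Suc k) * a (Suc k)"
    | "r (Suc k) * a (Suc k) \<le> x" "x < r (Suc k) * a (Suc k) + r k * W k * l k"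
    | "r (Suc k) * a (Suc k) + r k * W k * l k \<le> x" by linarith
  then show ?thesis
  proof cases
    case 1
    have "x mod a (Suc k) < a (Suc k)" using a_pos by simp
    moreover have "x div a (Suc k) < r (Suc k)" using 1 a_pos by (simp add: less_mult_imp_div_less)
    ultimately show ?thesis
      using A[of "x mod a (Suc k)" "x div a (Suc k)"] orig_A(2)[of "x mod a (Suc k)" k "x div a (Suc k)"]
        div_mult_mod_eq[of x "a (Suc k)"] by metis
  next
    case 2
    define y where "y = x - r (Suc k) * a (Suc k)"
    have y: "x = r (Suc k) * a (Suc k) + y" "y < r k * W k * l k" using 2 by (auto simp: y_def)
    have "y mod l k < l k" using l_pos by simp
    moreover have "y div l k < r k * W k" using y by (simp add: less_mult_imp_div_less)
    ultimately show ?thesis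
      using code[of "y div l k" "y mod l k"] orig_code(2)[of "y div l k" k "y mod l k"] y(1)
        div_mult_mod_eq[of y "l k"] by metis
  next
    case 3
    define y where "y = x - (r (Suc k) * a (Suc k) + r k * W k * l k)"
    have y: "x = r (Suc k) * a (Suc k) + r k * W k * l k + y" "y < r (Suc k) * b k"
      using 3 assms by (auto simp: y_def line_parts)
    have "y mod b k < b k" using b_pos by simp
    moreover have "y div b k < r (Suc k)" using y by (simp add: less_mult_imp_div_less)
    ultimately show ?thesis
      using B[of "y mod b k" "y div b k"] orig_B(2)[of "y mod b k" k "y div b k"] y(1)
        div_mult_mod_eq[of y "b k"] by metis
  qed
qed

lemma cell_block:
  assumes "s < reps k" "u < a k"
  shows "digit k i + (s * a k + u) < l k"
    and "cell k i (digit k i + (s * a k + u)) = Inl (i div W k * a k + u, r (Suc k) + i mod W k * reps k + s)"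
proof -
  have "s * a k + u < Suc s * a k" using assms by simp
  also have "\<dots> \<le> reps k * a k" using assms by (intro mult_le_mono1) simp
  finally have *: "s * a k + u < reps k * a k" .
  then show "digit k i + (s * a k + u) < l k"
    using digit_less[of k i] by (simp add: l_def)
  show "cell k i (digit k i + (s * a k + u)) = Inl (i div W k * a k + u, r (Suc k) + i mod W k * reps k + s)"
    using * assms by (simp add: cell_def)
qed

lemma cell_spacer:
  assumes "u < a k"
  shows "\<exists>t < l k. cell k i t = Inr (i * a k + u)"
proof (cases "u < digit k i")
  case True
  then have "cell k i u = Inr (i * a k + u)" by (simp add: cell_def)
  moreover have "u < l k" using assms by (simp add: l_def)
  ultimately show ?thesis by blast
next
  case False
  then have "cell k i (u + reps k * a k) = Inr (i * a k + u)" by (simp add: cell_def)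
  moreover have "u + reps k * a k < l k" using assms by (simp add: l_def)
  ultimately show ?thesis by blast
qed

text \<open>Every copy and every spacer is hit, and both sides have the same size by
  \<open>a_Suc_Suc\<close>. A surjection between finite sets of equal size is injective, so only
  preimages have to be exhibited.\<close>

lemma orig_image:
  "orig k ` {..<a (Suc (Suc k))} =
     Inl ` ({..<a (Suc k)} \<times> {..<2 * r (Suc k)}) \<union> Inr ` {..<r k * W k * a k}" (is "_ = ?S")
  and orig_inj: "inj_on (orig k) {..<a (Suc (Suc k))}"
proof -
  let ?D = "{..<a (Suc (Suc k))}"
  have card: "card ?S = card ?D"
    by (subst card_Un_disjoint)
       (auto simp: card_image inj_on_def card_cartesian_product a_Suc_Suc)
  have sub: "?S \<subseteq> orig k ` ?D"
  proof
    fix y assume "y \<in> ?S"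
    then consider (l) i c where "y = Inl (i, c)" "i < a (Suc k)" "c < 2 * r (Suc k)"
      | (s) s where "y = Inr s" "s < r k * W k * a k" by auto
    then show "y \<in> orig k ` ?D"
    proof cases
      case l
      consider "c < r (Suc k)" | "r (Suc k) \<le> c" "i < r k * a k" | "r (Suc k) \<le> c" "r k * a k \<le> i"
        by linarith
      then show ?thesis
      proof cases
        case 1
        have "c * a (Suc k) + i \<in> ?D" using orig_A(1)[OF l(2) 1] line_parts[of k] by simp
        then show ?thesis using orig_A(2)[OF l(2) 1] l(1) by (metis imageI)
      next
        case 2
        \<comment> \<open>Copy \<open>c\<close> was used in run \<open>i div a k\<close>, in its
          letter number \<open>(c - r (Suc k)) div reps k\<close>, as repetition number
          \<open>(c - r (Suc k)) mod reps k\<close>.\<close>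
        define j where "j = i div a k * W k + (c - r (Suc k)) div reps k"
        have cW: "(c - r (Suc k)) div reps k < W k"
          using l 2 by (intro less_mult_imp_div_less) (simp add: r_Suc_W mult.commute)
        have jW: "j div W k = i div a k" "j mod W k = (c - r (Suc k)) div reps k"
          using cW by (auto simp: j_def)
        have ia: "i div a k < r k" using 2 by (simp add: less_mult_imp_div_less)
        have "j < Suc (i div a k) * W k" using cW by (simp add: j_def)
        also have "\<dots> \<le> r k * W k" using ia by (intro mult_le_mono1) simp
        finally have j: "j < r k * W k" .
        have s: "(c - r (Suc k)) mod reps k < reps k" using reps_ge[of k] by simp
        have u: "i mod a k < a k" using a_pos by simp
        let ?t = "digit k j + ((c - r (Suc k)) mod reps k * a k + i mod a k)"
        have t: "?t < l k" using cell_block(1)[OF s u] .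
        have "orig k (r (Suc k) * a (Suc k) + (j * l k + ?t)) = y"
          using orig_code(2)[OF j t] cell_block(2)[OF s u, of j] l(1) 2 by (simp add: jW)
        moreover have "r (Suc k) * a (Suc k) + (j * l k + ?t) \<in> ?D"
          using orig_code(1)[OF j t] by (simp add: line_parts)
        ultimately show ?thesis by (metis imageI)
      next
        case 3
        have z: "i - r k * a k < b k" using l 3 by (simp add: a_Suc)
        have c: "c - r (Suc k) < r (Suc k)" using l 3 by simp
        show ?thesis using orig_B[OF z c] l 3 line_parts[of k]
          by (intro image_eqI[where x = "r (Suc k) * a (Suc k) + r k * W k * l k + ((c - r (Suc k)) * b k + (i - r k * a k))"])
             auto
      qed
    next
      case s
      have u: "s mod a k < a k" using a_pos by simp
      have i: "s div a k < r k * W k" using s by (simp add: less_mult_imp_div_less)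
      obtain t where t: "t < l k" "cell k (s div a k) t = Inr (s div a k * a k + s mod a k)"
        using cell_spacer[OF u] by blast
      have "orig k (r (Suc k) * a (Suc k) + (s div a k * l k + t)) = y"
        using orig_code(2)[OF i t(1)] t(2) s by simp
      moreover have "r (Suc k) * a (Suc k) + (s div a k * l k + t) \<in> ?D"
        using orig_code(1)[OF i t(1)] by (simp add: line_parts)
      ultimately show ?thesis by (metis imageI)
    qed
  qed
  have le: "card (orig k ` ?D) \<le> card ?S" using card card_image_le[of ?D "orig k"] by simp
  show eq: "orig k ` ?D = ?S" using card_seteq[OF _ sub le] by simp
  show "inj_on (orig k) ?D" using card eq by (intro eq_card_imp_inj_on) auto
qed

lemma orig_Inl_bounds:
  assumes "x < a (Suc (Suc k))" "orig k x = Inl (i, c)"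
  shows "i < a (Suc k)" "c < 2 * r (Suc k)"
proof -
  have "Inl (i, c) \<in> orig k ` {..<a (Suc (Suc k))}" using assms by (metis imageI lessThan_iff)
  then show "i < a (Suc k)" "c < 2 * r (Suc k)" by (auto simp: orig_image)
qed

lemma orig_exists:
  assumes "i < a (Suc k)" "c < 2 * r (Suc k)"
  shows "\<exists>x < a (Suc (Suc k)). orig k x = Inl (i, c)"
proof -
  have "Inl (i, c) \<in> orig k ` {..<a (Suc (Suc k))}" unfolding orig_image using assms by auto
  then show ?thesis by force
qed

text \<open>Old intervals are subdivided in place, so a rank below
  \<open>a (Suc k) * (2 * r (Suc k))\<close> splits into quotient and remainder; the spacers follow
  on the right. Surjectivity again implies injectivity.\<close>

lemma idx_bij: "bij_betw (idx k) {..<a (Suc k)} {..<a (Suc k)}"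
proof (induction k)
  case 0
  show ?case by (simp add: bij_betw_def inj_on_def)
next
  case (Suc k)
  have sub: "{..<a (Suc (Suc k))} \<subseteq> idx (Suc k) ` {..<a (Suc (Suc k))}"
  proof
    fix y assume y: "y \<in> {..<a (Suc (Suc k))}"
    let ?q = "2 * r (Suc k)"
    have q: "0 < ?q" using r_pos by simp
    show "y \<in> idx (Suc k) ` {..<a (Suc (Suc k))}"
    proof (cases "y < a (Suc k) * ?q")
      case True
      have "y div ?q < a (Suc k)" using True by (simp only: less_mult_imp_div_less)
      then obtain i where i: "i < a (Suc k)" "idx k i = y div ?q"
        using Suc by (metis bij_betw_imp_surj_on imageE lessThan_iff)
      obtain x where "x < a (Suc (Suc k))" "orig k x = Inl (i, y mod ?q)"
        using orig_exists[OF i(1), of "y mod ?q"] q by auto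
      then have "x < a (Suc (Suc k))" "idx (Suc k) x = y" using i div_mult_mod_eq[of y ?q] by simp_all
      then show ?thesis by blast
    next
      case False
      then have "y - a (Suc k) * ?q < r k * W k * a k" using y by (auto simp: a_Suc_Suc)
      then have "Inr (y - a (Suc k) * ?q) \<in> orig k ` {..<a (Suc (Suc k))}"
        unfolding orig_image by blast
      then obtain x where "x < a (Suc (Suc k))" "orig k x = Inr (y - a (Suc k) * ?q)" by force
      then have "x < a (Suc (Suc k))" "idx (Suc k) x = y" using False by auto
      then show ?thesis by blast
    qed
  qed
  have le: "card (idx (Suc k) ` {..<a (Suc (Suc k))}) \<le> card {..<a (Suc (Suc k))}"
    by (rule card_image_le) simp
  have eq: "idx (Suc k) ` {..<a (Suc (Suc k))} = {..<a (Suc (Suc k))}"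
    using card_seteq[OF _ sub le] by simp
  then show ?case unfolding bij_betw_def by (intro conjI eq_card_imp_inj_on) auto
qed

lemma idx_less: "x < a (Suc k) \<Longrightarrow> idx k x < a (Suc k)"
  using idx_bij[of k] by (auto simp: bij_betw_def)

lemma idx_inj: "\<lbrakk>x < a (Suc k); y < a (Suc k); idx k x = idx k y\<rbrakk> \<Longrightarrow> x = y"
  using idx_bij[of k] by (auto simp: bij_betw_def inj_on_def)

text \<open>The coherence of the construction: the new towers are made of whole columns of line
  \<open>k\<close> and never interrupt one, so an upward step of stage \<open>k\<close> persists in
  each of its copies.\<close>

lemma orig_Suc:
  assumes "x < a (Suc (Suc k))" "orig k x = Inl (i, c)" "below_top k i"
  shows "below_top (Suc k) x" "orig k (Suc x) = Inl (Suc i, c)"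
proof -
  have "below_top (Suc k) x \<and> orig k (Suc x) = Inl (Suc i, c)"
    using assms(1)
  proof (cases rule: line_cases)
    case (A o' c')
    then have eq: "o' = i" "c' = c" using assms by auto
    have i: "Suc i < a (Suc k)" using assms(3) by (simp add: below_top_def)
    have c: "c < r (Suc k)" using A eq by simp
    have x: "Suc x = c * a (Suc k) + Suc i" using A eq by simp
    have "\<not> a (Suc k) dvd Suc x"
    proof
      assume "a (Suc k) dvd Suc x"
      then have "a (Suc k) dvd Suc i" unfolding x using dvd_add_right_iff[of "a (Suc k)" "c * a (Suc k)" "Suc i"]
        by simp
      then show False using i by (auto dest: dvd_imp_le)
    qed
    then show ?thesis
      using orig_A[OF i c] x line_parts[of k] by (simp add: below_top_def)
  next
    case (code j t)
    let ?d = "digit k j"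
    have cell: "cell k j t = Inl (i, c)" using code assms by simp
    then have dt: "?d \<le> t" "t < ?d + reps k * a k"
      and ieq: "i = j div W k * a k + (t - ?d) mod a k"
      and ceq: "c = r (Suc k) + j mod W k * reps k + (t - ?d) div a k"
      by (auto simp: cell_def Let_def split: if_splits)
    define s u where "s = (t - ?d) div a k" and "u = (t - ?d) mod a k"
    have su: "t = ?d + (s * a k + u)" "u < a k" using dt a_pos by (auto simp: s_def u_def)
    have s: "s < reps k" using dt by (auto simp: s_def intro!: less_mult_imp_div_less)
    have jW: "j div W k < r k" using code by (simp add: less_mult_imp_div_less)
    \<comment> \<open>A block inside a letter ends exactly where a column of line \<open>k\<close>
      ends, and there \<open>below_top\<close> fails.\<close>
    have "Suc u \<noteq> a k"
    proof
      assume "Suc u = a k"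
      then have si: "Suc i = Suc (j div W k) * a k" using ieq u_def by simp
      also have "\<dots> \<le> r k * a k" using jW by (intro mult_le_mono1) simp
      finally show False using assms(3) si unfolding below_top_def by (metis dvd_triv_right)
    qed
    then have u: "Suc u < a k" using su by simp
    have "Suc t < l k" using cell_block(1)[OF s u] su by simp
    have X: "Suc x = r (Suc k) * a (Suc k) + (j * l k + Suc t)" using code by simp
    have t': "Suc t = ?d + (s * a k + Suc u)" using su(1) by simp
    have "cell k j (Suc t) = Inl (j div W k * a k + Suc u, r (Suc k) + j mod W k * reps k + s)"
      unfolding t' by (rule cell_block(2)[OF s u])
    then have "cell k j (Suc t) = Inl (Suc i, c)"
      unfolding ieq ceq s_def[symmetric] u_def[symmetric] by simp
    moreover have "j * l k + Suc t < r k * W k * l k" using orig_code(1)[OF code(1) \<open>Suc t < l k\<close>] .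
    ultimately show ?thesis
      using orig_code(2)[OF code(1) \<open>Suc t < l k\<close>] X by (simp add: below_top_def line_parts)
  next
    case (B z c')
    then have eq: "i = r k * a k + z" "c = r (Suc k) + c'" using assms by auto
    have z: "Suc z < b k" using assms(3) eq by (simp add: below_top_def a_Suc)
    show ?thesis using orig_B[OF z B(2)] B eq by (simp add: below_top_def line_parts)
  qed
  then show "below_top (Suc k) x" "orig k (Suc x) = Inl (Suc i, c)" by auto
qed

end

section \<open>Piecewise translations of an interval\<close>

lemma sets_normalized_lborel_iff:
  assumes "X \<in> sets borel"
  shows "A \<in> sets (normalized_lborel X) \<longleftrightarrow> A \<in> sets borel \<and> A \<subseteq> X"
  unfolding sets_normalized_lborel using assms by (subst sets_restrict_space_iff) auto

lemma translate_borel [measurable]: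
  fixes S :: "real set"
  assumes "S \<in> sets borel"
  shows "(\<lambda>x. x + c) -` S \<in> sets borel"
  using measurable_sets[of "\<lambda>x. x + c" borel borel S] assms by simp

lemma emeasure_translate:
  fixes S :: "real set"
  assumes "S \<in> sets borel"
  shows "emeasure lborel ((\<lambda>x. x + c) -` S) = emeasure lborel S"
proof -
  have "emeasure lborel S = emeasure (distr lborel borel ((+) c)) S"
    by (simp add: lborel_distr_plus)
  also have "\<dots> = emeasure lborel ((+) c -` S)"
    using assms by (subst emeasure_distr) auto
  also have "(+) c -` S = (\<lambda>x. x + c) -` S" by (auto simp: add.commute)
  finally show ?thesis by simp
qed

lemma image_translate: "(\<lambda>x. x + c) ` S = (\<lambda>x. x + - c) -` S" for S :: "real set"
  by (force simp: image_iff)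

text \<open>Overlaps must be allowed, as the intervals of all stages will be used together. The
  locale below requires equal translations on overlaps, so the choice made by \<open>LEAST\<close>
  does not affect the value.\<close>

definition pieces_map :: "(nat \<Rightarrow> real set) \<Rightarrow> (nat \<Rightarrow> real) \<Rightarrow> real \<Rightarrow> real" where
  "pieces_map I c x = (if \<exists>j. x \<in> I j then x + c (LEAST j. x \<in> I j) else x)"

locale translation_pieces =
  fixes I :: "nat \<Rightarrow> real set" and c :: "nat \<Rightarrow> real"
  assumes borel [measurable]: "\<And>j. I j \<in> sets borel"
    and consistent: "\<And>i j x. x \<in> I i \<Longrightarrow> x \<in> I j \<Longrightarrow> c i = c j"
    and injective: "\<And>i j x y. x \<in> I i \<Longrightarrow> y \<in> I j \<Longrightarrow> x + c i = y + c j \<Longrightarrow> x = y"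
begin

abbreviation "f \<equiv> pieces_map I c"
abbreviation "source \<equiv> \<Union>j. I j"
abbreviation "target \<equiv> \<Union>j. (\<lambda>x. x + c j) ` I j"

lemma f_eq:
  assumes "x \<in> I j"
  shows "f x = x + c j"
proof -
  have "x \<in> I (LEAST j. x \<in> I j)" using assms by (rule LeastI)
  then have "c (LEAST j. x \<in> I j) = c j" using assms by (rule consistent)
  moreover have "\<exists>j. x \<in> I j" using assms by blast
  ultimately show ?thesis unfolding pieces_map_def by simp
qed

lemma f_outside: "x \<notin> source \<Longrightarrow> f x = x"
  by (auto simp: pieces_map_def)

lemma vimage_f: "f -` S = (\<Union>j. I j \<inter> (\<lambda>x. x + c j) -` S) \<union> (S - source)"
proof (intro equalityI subsetI)
  fix x assume "x \<in> f -` S"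
  then show "x \<in> (\<Union>j. I j \<inter> (\<lambda>x. x + c j) -` S) \<union> (S - source)"
    using f_eq f_outside[of x] by (cases "x \<in> source") auto
next
  fix x assume "x \<in> (\<Union>j. I j \<inter> (\<lambda>x. x + c j) -` S) \<union> (S - source)"
  then show "x \<in> f -` S"
    using f_eq f_outside[of x] by auto
qed

lemma f_measurable [measurable]: "f \<in> borel_measurable borel"
proof (rule measurableI)
  fix S :: "real set" assume [measurable]: "S \<in> sets borel"
  show "f -` S \<inter> space borel \<in> sets borel" by (simp add: vimage_f)
qed simp

lemma null_vimage:
  assumes "S \<in> null_sets lborel"
  shows "f -` S \<in> null_sets lborel"
proof -
  have [measurable]: "S \<in> sets borel" using assms by auto
  have "(\<Union>j. (\<lambda>x. x + c j) -` S) \<union> S \<in> null_sets lborel"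
    using assms by (intro null_sets.Un null_sets_UN) (auto simp: null_sets_def emeasure_translate)
  then show ?thesis
    by (rule null_sets_subset) (auto simp: vimage_f)
qed

lemma null_vimage_iterate:
  assumes "S \<in> null_sets lborel"
  shows "(f ^^ n) -` S \<in> null_sets lborel"
proof (induction n)
  case 0 then show ?case using assms by simp
next
  case (Suc n)
  have "(f ^^ Suc n) -` S = f -` ((f ^^ n) -` S)"
    by (simp only: funpow_Suc_right vimage_comp)
  then show ?case using null_vimage[OF Suc] by (simp del: funpow.simps)
qed

lemma translation_pieces_inverse: "translation_pieces (\<lambda>j. (\<lambda>x. x + c j) ` I j) (\<lambda>j. - c j)"
proof
  show "(\<lambda>x. x + c j) ` I j \<in> sets borel" for j
    unfolding image_translate using translate_borel[OF borel] .
  show "- c i = - c j" if *: "x \<in> (\<lambda>x. x + c i) ` I i" "x \<in> (\<lambda>x. x + c j) ` I j" for i j x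
  proof -
    obtain u v where "u \<in> I i" "x = u + c i" "v \<in> I j" "x = v + c j" using * by blast
    then show ?thesis using injective[of u i v j] by simp
  qed
  show "x = y" if *: "x \<in> (\<lambda>x. x + c i) ` I i" "y \<in> (\<lambda>x. x + c j) ` I j" "x + - c i = y + - c j" for i j x y
  proof -
    obtain u v where "u \<in> I i" "x = u + c i" "v \<in> I j" "y = v + c j" using * by blast
    then show ?thesis using *(3) consistent[of u i j] by simp
  qed
qed

text \<open>Once the sources are made disjoint, injectivity makes their images disjoint too, and
  translation invariance can be applied piece by piece.\<close>

lemma emeasure_f:
  assumes [measurable]: "S \<in> sets borel"
  shows "emeasure lborel (f -` S \<inter> source) = emeasure lborel (S \<inter> target)"
proof -
  let ?D = "disjointed I" and ?t = "\<lambda>j x. x + c j"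
  have DI: "?D j \<subseteq> I j" for j by (rule disjointed_subset)
  have [measurable]: "?D j \<in> sets borel" for j
    using sets.range_disjointed_sets[of I borel] borel by (auto simp: image_subset_iff)
  have im[measurable]: "?t j ` ?D j \<in> sets borel" for j
    unfolding image_translate by (rule translate_borel) measurable
  have UD: "(\<Union>j. ?D j) = source" by (rule UN_disjointed_eq)
  have eq1: "f -` S \<inter> source = (\<Union>j. ?D j \<inter> ?t j -` S)"
  proof -
    have "x \<in> f -` S \<longleftrightarrow> x + c j \<in> S" if "x \<in> ?D j" for x j
      using f_eq[of x j] that DI[of j] by auto
    then show ?thesis unfolding UD[symmetric] by auto
  qed
  have Ur: "target = (\<Union>j. ?t j ` ?D j)"
  proof (intro equalityI subsetI)
    fix y assume "y \<in> target"
    then obtain i x where i: "x \<in> I i" "y = x + c i" by auto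
    then obtain j where "x \<in> ?D j" using UD by blast
    moreover have "c j = c i" using consistent DI i calculation by blast
    ultimately have "y \<in> ?t j ` ?D j" using i(2) by (intro image_eqI[of _ _ x]) auto
    then show "y \<in> (\<Union>j. ?t j ` ?D j)" by blast
  qed (use DI in blast)
  have eq2: "S \<inter> target = (\<Union>j. S \<inter> ?t j ` ?D j)" unfolding Ur by blast
  have d1: "disjoint_family (\<lambda>j. ?D j \<inter> ?t j -` S)"
    using disjoint_family_disjointed[of I] unfolding disjoint_family_on_def by blast
  have d2: "disjoint_family (\<lambda>j. S \<inter> ?t j ` ?D j)"
  proof -
    have "?t i ` ?D i \<inter> ?t j ` ?D j = {}" if "i \<noteq> j" for i j
    proof (rule ccontr)
      assume "?t i ` ?D i \<inter> ?t j ` ?D j \<noteq> {}"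
      then obtain x y where xy: "x \<in> ?D i" "y \<in> ?D j" "x + c i = y + c j" by auto
      then have "x = y" using injective DI by blast
      then show False using xy disjoint_family_disjointed[of I] that unfolding disjoint_family_on_def by blast
    qed
    then show ?thesis unfolding disjoint_family_on_def by blast
  qed
  have eq: "?D j \<inter> ?t j -` S = ?t j -` (S \<inter> ?t j ` ?D j)" for j by auto
  have "emeasure lborel (f -` S \<inter> source) = (\<Sum>j. emeasure lborel (?D j \<inter> ?t j -` S))"
    unfolding eq1 using d1 by (intro suminf_emeasure[symmetric]) auto
  also have "\<dots> = (\<Sum>j. emeasure lborel (S \<inter> ?t j ` ?D j))"
    unfolding eq by (intro suminf_cong emeasure_translate) auto
  also have "\<dots> = emeasure lborel (S \<inter> target)"
    unfolding eq2 using d2 by (intro suminf_emeasure) auto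
  finally show ?thesis .
qed

end

text \<open>The pieces give a bijection only up to null sets, whereas a bijection of the whole
  interval is required. The points with a forward or backward orbit that leaves the pieces form a
  null set, and the map is altered there.\<close>

theorem piecewise_translation_extension:
  fixes X :: "real set" and I :: "nat \<Rightarrow> real set" and c :: "nat \<Rightarrow> real"
  assumes X: "X \<in> sets borel" "bounded X" "0 < measure lborel X"
    and pieces: "translation_pieces I c"
    and sub: "\<And>j. I j \<subseteq> X" "\<And>j. (\<lambda>x. x + c j) ` I j \<subseteq> X"
    and dom: "X - (\<Union>j. I j) \<in> null_sets lborel"
    and ran: "X - (\<Union>j. (\<lambda>x. x + c j) ` I j) \<in> null_sets lborel"
  obtains X0 T where "X0 \<in> sets borel" "X0 \<subseteq> X" "X - X0 \<in> null_sets lborel"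
    "invertible_mpt (normalized_lborel X) T" "\<And>x. x \<in> X0 \<Longrightarrow> T x \<in> X0"
    "\<And>j. T ` (I j \<inter> X0) = (\<lambda>x. x + c j) ` I j \<inter> X0"
proof -
  interpret F: translation_pieces I c by fact
  interpret G: translation_pieces "\<lambda>j. (\<lambda>x. x + c j) ` I j" "\<lambda>j. - c j"
    by (rule F.translation_pieces_inverse)
  note [measurable] = X(1)
  have Gran: "(\<lambda>x. x + - c j) ` (\<lambda>x. x + c j) ` I j = I j" for j by (force simp: image_iff)
  define f g where "f = pieces_map I c" and "g = pieces_map (\<lambda>j. (\<lambda>x. x + c j) ` I j) (\<lambda>j. - c j)"
  have [measurable]: "f \<in> borel_measurable borel" "g \<in> borel_measurable borel"
    unfolding f_def g_def by measurable
  define D R where "D = (\<Union>j. I j)" and "R = (\<Union>j. (\<lambda>x. x + c j) ` I j)"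
  have [measurable]: "D \<in> sets borel" "R \<in> sets borel"
    unfolding D_def R_def using F.borel G.borel by auto
  have DX: "D \<subseteq> X" and RX: "R \<subseteq> X" unfolding D_def R_def using sub by blast+
  have fD: "f x \<in> R \<and> g (f x) = x" if "x \<in> D" for x
  proof -
    from that obtain j where j: "x \<in> I j" by (auto simp: D_def)
    then have "f x = x + c j" "x + c j \<in> (\<lambda>x. x + c j) ` I j" using F.f_eq by (auto simp: f_def)
    then show ?thesis using G.f_eq[of "f x" j] by (auto simp: g_def R_def)
  qed
  have gR: "g x \<in> D \<and> f (g x) = x" if "x \<in> R" for x
  proof -
    from that obtain j y where j: "y \<in> I j" "x = y + c j" by (auto simp: R_def)
    then have "g x = y" using G.f_eq[of x j] by (auto simp: g_def)
    then show ?thesis using j F.f_eq[of y j] by (auto simp: f_def D_def)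
  qed
  have fX: "f x \<in> X" if "x \<in> X" for x
    using that fD[of x] RX F.f_outside[of x] by (cases "x \<in> D") (auto simp: f_def D_def)
  have gX: "g x \<in> X" if "x \<in> X" for x
    using that gR[of x] DX G.f_outside[of x] by (cases "x \<in> R") (auto simp: g_def R_def)
  have fnX: "(f ^^ n) x \<in> X" if "x \<in> X" for x n using that fX by (induction n) auto
  have gnX: "(g ^^ n) x \<in> X" if "x \<in> X" for x n using that gX by (induction n) auto
  define X0 where "X0 = {x \<in> X. \<forall>n. (f ^^ n) x \<in> D \<and> (g ^^ n) x \<in> R}"
  have X0: "X0 = X - (\<Union>n. (f ^^ n) -` (X - D) \<union> (g ^^ n) -` (X - R))"
    using fnX gnX by (auto simp: X0_def)
  have null: "(\<Union>n. (f ^^ n) -` (X - D) \<union> (g ^^ n) -` (X - R)) \<in> null_sets lborel" (is "?N \<in> _")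
    using F.null_vimage_iterate[of "X - D"] G.null_vimage_iterate[of "X - R"] dom ran
    by (intro null_sets_UN null_sets.Un) (auto simp: f_def g_def D_def R_def)
  have X0m[measurable]: "X0 \<in> sets borel" unfolding X0 using null by auto
  have X0X: "X0 \<subseteq> X" by (auto simp: X0_def)
  have co: "X - X0 \<in> null_sets lborel"
    by (rule null_sets_subset[OF null]) (measurable, auto simp: X0)
  have XD: "x \<in> D" "x \<in> R" if "x \<in> X0" for x
    using that by (auto simp: X0_def dest: spec[of _ 0])
  have fX0: "f x \<in> X0" if x: "x \<in> X0" for x
  proof -
    have "(g ^^ n) (f x) \<in> R" for n
    proof (cases n)
      case 0 then show ?thesis using XD[OF x] fD by auto
    next
      case (Suc i)
      then have "(g ^^ n) (f x) = (g ^^ i) x" using XD[OF x] fD by (simp add: funpow_Suc_right del: funpow.simps)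
      then show ?thesis using x by (auto simp: X0_def)
    qed
    moreover have "(f ^^ n) (f x) = (f ^^ Suc n) x" for n by (simp add: funpow_Suc_right del: funpow.simps)
    ultimately show ?thesis using x fX by (simp add: X0_def del: funpow.simps)
  qed
  have gX0: "g x \<in> X0" if x: "x \<in> X0" for x
  proof -
    have "(f ^^ n) (g x) \<in> D" for n
    proof (cases n)
      case 0 then show ?thesis using XD[OF x] gR by auto
    next
      case (Suc i)
      then have "(f ^^ n) (g x) = (f ^^ i) x" using XD[OF x] gR by (simp add: funpow_Suc_right del: funpow.simps)
      then show ?thesis using x by (auto simp: X0_def)
    qed
    moreover have "(g ^^ n) (g x) = (g ^^ Suc n) x" for n by (simp add: funpow_Suc_right del: funpow.simps)
    ultimately show ?thesis using x gX by (simp add: X0_def del: funpow.simps)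
  qed
  \<comment> \<open>\<open>X0\<close> is invariant under \<open>f\<close> and \<open>g\<close>, so
    setting both maps to the identity outside it keeps them inverse to each other.\<close>
  define T T' where "T x = (if x \<in> X0 then f x else x)" and "T' x = (if x \<in> X0 then g x else x)" for x
  have [measurable]: "T \<in> borel_measurable borel" "T' \<in> borel_measurable borel"
    unfolding T_def T'_def by measurable
  have TT': "T' (T x) = x" "T (T' x) = x" for x
    using fX0 gX0 fD gR XD by (auto simp: T_def T'_def)
  have TX: "T x \<in> X" "T' x \<in> X" if "x \<in> X" for x
    using that fX gX by (auto simp: T_def T'_def)
  let ?M = "normalized_lborel X"
  have bij: "bij_betw T X X"
    by (rule bij_betw_byWitness[of _ T']) (use TT' TX in auto)
  have inv: "inv_into X T x = T' x" if "x \<in> X" for x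
    using that TT' TX bij by (intro inv_into_f_eq) (auto simp: bij_betw_def)
  have meas: "h \<in> measurable ?M ?M" if [measurable]: "h \<in> borel_measurable borel" and "\<And>x. x \<in> X \<Longrightarrow> h x \<in> X" for h
  proof (rule measurableI)
    fix A assume "A \<in> sets ?M"
    then have [measurable]: "A \<in> sets borel" by (simp add: sets_normalized_lborel_iff X)
    have "h -` A \<inter> X \<in> sets borel" by measurable
    then show "h -` A \<inter> space ?M \<in> sets ?M" by (simp add: sets_normalized_lborel_iff X)
  qed (use that in auto)
  have Tm: "T \<in> measurable ?M ?M" using TX by (intro meas) auto
  have T'm: "inv_into X T \<in> measurable ?M ?M"
    using TX inv by (subst measurable_cong[of _ _ T']) (auto intro!: meas)
  have fin: "emeasure lborel X < \<infinity>" using X(2) by (rule emeasure_bounded_finite)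
  have prob: "prob_space ?M"
    unfolding normalized_lborel_def
    by (rule prob_space_uniform_measure)
       (use X(3) fin in \<open>auto simp: emeasure_restrict_space measure_def\<close>)
  have AE: "AE x in lborel. x \<in> X \<longrightarrow> x \<in> X0"
    using AE_not_in[OF co] by eventually_elim auto
  have AER: "AE x in lborel. x \<in> X \<longrightarrow> x \<in> R"
    using AE_not_in[OF ran] by eventually_elim (auto simp: R_def)
  have mp: "measure ?M (T -` A \<inter> X) = measure ?M A" if "A \<in> sets ?M" for A
  proof -
    have [measurable]: "A \<in> sets borel" and AX: "A \<subseteq> X"
      using that by (auto simp: sets_normalized_lborel_iff X)
    have TA: "T -` A \<inter> X \<in> sets ?M" using measurable_sets[OF Tm that] by simp
    have "emeasure lborel (T -` A \<inter> X) = emeasure lborel (f -` A \<inter> D)"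
    proof (rule emeasure_eq_AE)
      show "AE x in lborel. (x \<in> T -` A \<inter> X) = (x \<in> f -` A \<inter> D)"
        using AE by eventually_elim (use XD DX in \<open>auto simp: T_def\<close>)
      show "T -` A \<inter> X \<in> sets lborel" "f -` A \<inter> D \<in> sets lborel"
        using measurable_sets[of T borel borel A] measurable_sets[of f borel borel A] by auto
    qed
    also have "\<dots> = emeasure lborel (A \<inter> R)"
      unfolding f_def D_def R_def by (rule F.emeasure_f) measurable
    also have "\<dots> = emeasure lborel A"
      by (rule emeasure_eq_AE) (use AER AX in auto)
    finally have "measure lborel (T -` A \<inter> X) = measure lborel A" by (simp add: measure_def)
    then show ?thesis
      using X that TA AX by (simp add: measure_normalized_lborel Int_absorb2 Int_assoc)
  qed
  have T: "invertible_mpt ?M T"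
    unfolding invertible_mpt_def using prob bij Tm T'm mp by simp
  have "T ` (I j \<inter> X0) = (\<lambda>x. x + c j) ` I j \<inter> X0" for j
  proof (intro equalityI subsetI)
    fix y assume "y \<in> T ` (I j \<inter> X0)"
    then show "y \<in> (\<lambda>x. x + c j) ` I j \<inter> X0" using fX0 F.f_eq by (auto simp: T_def f_def)
  next
    fix y assume y: "y \<in> (\<lambda>x. x + c j) ` I j \<inter> X0"
    then obtain x where x: "x \<in> I j" "y = x + c j" by auto
    then have "g y = x" using G.f_eq[of y j] by (auto simp: g_def)
    then have "x \<in> X0" using gX0 y by auto
    moreover have "T x = y" using x F.f_eq calculation by (auto simp: T_def f_def)
    ultimately show "y \<in> T ` (I j \<inter> X0)" using x by (intro image_eqI[of _ _ x]) auto
  qed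
  moreover have "T x \<in> X0" if "x \<in> X0" for x using that fX0 by (simp add: T_def)
  ultimately show ?thesis using that X0m X0X co T by blast
qed

section \<open>The transformation\<close>

lemma null_set_approx:
  assumes "E \<in> sets lborel" "\<And>k. emeasure lborel E \<le> ennreal (g k)" "g \<longlonglongrightarrow> 0"
  shows "E \<in> null_sets lborel"
proof -
  have "(\<lambda>k. ennreal (g k)) \<longlonglongrightarrow> ennreal 0" using assms(3) by (rule tendsto_ennrealI)
  then have "emeasure lborel E \<le> ennreal 0" using assms(2) by (intro LIMSEQ_le_const) auto
  then show ?thesis using assms(1) by (auto simp: null_sets_def)
qed

context two_towers
begin

text \<open>\<open>1 / scale k\<close> is the common width of the intervals of stage
  \<open>k\<close>, and \<open>size k\<close> is the length of the segment that they fill; the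
  spacers make it grow towards \<open>total\<close>.\<close>

primrec scale :: "nat \<Rightarrow> nat" where
  "scale 0 = 1"
| "scale (Suc k) = scale k * (2 * r (Suc k))"

definition size :: "nat \<Rightarrow> real" where "size k = a (Suc k) / scale k"

definition total :: real where "total = lim size"

definition lev :: "nat \<Rightarrow> nat \<Rightarrow> real set" where
  "lev k i = {real (idx k i) / scale k ..< (real (idx k i) + 1) / scale k}"

definition shift :: "nat \<Rightarrow> nat \<Rightarrow> real" where
  "shift k i = (real (idx k (Suc i)) - real (idx k i)) / scale k"

section \<open>The total length is finite\<close>

lemma scale_pos: "0 < scale k"
  using r_pos by (induction k) auto

lemma a_ge: "k \<le> a k"
proof (induction k)
  case (Suc k)
  have "1 * a k \<le> r k * a k" using r_pos[of k] by (intro mult_le_mono1) simp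
  then show ?case using Suc b_ge2[of k] a_Suc[of k] by linarith
qed simp

text \<open>A letter has \<open>reps k\<close> symbols of the short tower for each spacer, and the
  code uses \<open>r (Suc k)\<close> copies of each of the first \<open>r k * a k\<close>
  intervals.\<close>

lemma spacers_le: "reps k * (r k * W k * a k) \<le> r (Suc k) * a (Suc k)"
proof -
  have "reps k * (r k * W k * a k) = r (Suc k) * (r k * a k)" by (simp add: r_Suc_W algebra_simps)
  also have "\<dots> \<le> r (Suc k) * a (Suc k)" by (simp add: a_Suc)
  finally show ?thesis .
qed

lemma size_Suc: "size (Suc k) = size k + real (r k * W k * a k) / scale (Suc k)"
  using scale_pos[of k] r_pos[of "Suc k"]
  by (simp add: size_def a_Suc_Suc field_simps)

lemma spacers_size: "real (r k * W k * a k) / scale (Suc k) \<le> size k / (2 * reps k)"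
proof -
  have "real (reps k * (r k * W k * a k)) \<le> real (r (Suc k) * a (Suc k))"
    using spacers_le of_nat_le_iff by blast
  then have "real (r k * W k * a k) \<le> real (r (Suc k) * a (Suc k)) / reps k"
    using reps_ge[of k] by (simp add: field_simps)
  then have "real (r k * W k * a k) / scale (Suc k) \<le> real (r (Suc k) * a (Suc k)) / reps k / scale (Suc k)"
    by (rule divide_right_mono) simp
  also have "\<dots> = size k / (2 * reps k)"
    using scale_pos[of k] r_pos[of "Suc k"] by (simp add: size_def field_simps)
  finally show ?thesis .
qed

text \<open>The bound is shaped for induction: the growth is at most
  \<open>6 / (2 * reps k) = 6 / 2 ^ (k + 3) \<le> 1 / 2 ^ k\<close>, and \<open>1 / 2 ^ k\<close> is
  the increment of the right hand side.\<close>

lemma size_upper: "size k \<le> 6 - 2 / 2 ^ k"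
proof (induction k)
  case 0
  show ?case using init by (simp add: size_def a_Suc[of 0])
next
  case (Suc k)
  have "size k / (2 * reps k) \<le> 6 / (2 * reps k)"
    using Suc by (intro divide_right_mono) (auto intro: order_trans)
  also have "\<dots> \<le> 1 / 2 ^ k" by (simp add: reps_def field_simps)
  finally have "size (Suc k) \<le> 6 - 2 / 2 ^ k + 1 / 2 ^ k"
    using Suc spacers_size[of k] by (simp add: size_Suc)
  also have "\<dots> = 6 - 2 / 2 ^ Suc k" by (simp add: field_simps)
  finally show ?case .
qed

lemma size_le6: "size k \<le> 6"
  using size_upper[of k] by (rule order_trans) simp

lemma size_mono: "incseq size"
  by (rule incseq_SucI) (simp add: size_Suc)

lemma size_0: "size 0 = 4"
  using init by (simp add: size_def a_Suc[of 0])

lemma size_ge4: "4 \<le> size k"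
  using size_mono size_0 by (metis incseq_def le0)

lemma size_tendsto: "size \<longlonglongrightarrow> total"
proof -
  obtain L where "size \<longlonglongrightarrow> L" using incseq_convergent[OF size_mono, of 6] size_le6 by blast
  then show ?thesis unfolding total_def by (simp add: limI)
qed

lemma size_le_total: "size k \<le> total"
  using incseq_le[OF size_mono size_tendsto] .

lemma total_bounds: "4 \<le> total" "total \<le> 6"
  using size_le_total[of 0] size_0 LIMSEQ_le_const2[OF size_tendsto] size_le6 by auto

section \<open>The intervals of a stage\<close>

lemma lev_iff:
  "y \<in> lev k i \<longleftrightarrow> real (idx k i) \<le> y * scale k \<and> y * scale k < real (idx k i) + 1"
  using scale_pos[of k] by (auto simp: lev_def field_simps)

lemma lev_floor: "y \<in> lev k i \<longleftrightarrow> \<lfloor>y * scale k\<rfloor> = int (idx k i)"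
  unfolding lev_iff by (subst floor_eq_iff) simp

lemma lev_borel [measurable]: "lev k i \<in> sets borel"
  by (simp add: lev_def)

lemma emeasure_lev: "emeasure lborel (lev k i) = ennreal (1 / scale k)"
  unfolding lev_def using scale_pos[of k]
  by (subst emeasure_lborel_Ico) (auto simp: field_simps)

lemma lev_disjoint:
  assumes "i < a (Suc k)" "j < a (Suc k)" "y \<in> lev k i" "y \<in> lev k j"
  shows "i = j"
  using assms idx_inj[of i k j] by (auto simp: lev_floor)

lemma lev_cover: "(\<Union>i<a (Suc k). lev k i) = {0..<size k}"
proof (intro equalityI subsetI)
  fix y assume "y \<in> (\<Union>i<a (Suc k). lev k i)"
  then obtain i where i: "i < a (Suc k)" "real (idx k i) \<le> y * scale k" "y * scale k < real (idx k i) + 1"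
    by (auto simp: lev_iff)
  have "real (idx k i) + 1 \<le> a (Suc k)" using idx_less[OF i(1)] by linarith
  then have "0 \<le> y * scale k" "y * scale k < a (Suc k)" using i by linarith+
  then show "y \<in> {0..<size k}" using scale_pos[of k] by (auto simp: size_def field_simps zero_le_mult_iff)
next
  fix y assume y: "y \<in> {0..<size k}"
  then have y': "0 \<le> y * scale k" "y * scale k < a (Suc k)"
    using scale_pos[of k] by (auto simp: size_def field_simps)
  then have "nat \<lfloor>y * scale k\<rfloor> < a (Suc k)" by linarith
  then obtain i where "i < a (Suc k)" "idx k i = nat \<lfloor>y * scale k\<rfloor>"
    using idx_bij[of k] by (metis bij_betw_imp_surj_on imageE lessThan_iff)
  then show "y \<in> (\<Union>i<a (Suc k). lev k i)" using y' by (intro UN_I[of i]) (auto simp: lev_floor)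
qed

lemma lev_subset:
  assumes "i < a (Suc k)"
  shows "lev k i \<subseteq> {0..<total}"
proof -
  have "lev k i \<subseteq> {0..<size k}" unfolding lev_cover[symmetric] using assms by blast
  also have "\<dots> \<subseteq> {0..<total}" using size_le_total[of k] by auto
  finally show ?thesis .
qed

lemma lev_Suc_subset:
  assumes "x < a (Suc (Suc k))" "orig k x = Inl (i, c)"
  shows "lev (Suc k) x \<subseteq> lev k i"
proof
  fix y assume "y \<in> lev (Suc k) x"
  let ?q = "real (2 * r (Suc k))"
  have q: "0 < ?q" using r_pos by simp
  have c: "real c + 1 \<le> ?q" using orig_Inl_bounds(2)[OF assms] by linarith
  have "real (idx k i) * ?q + c \<le> y * scale k * ?q" "y * scale k * ?q < real (idx k i) * ?q + c + 1"
    using \<open>y \<in> _\<close> assms by (auto simp: lev_iff mult.assoc)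
  then have le: "real (idx k i) * ?q \<le> y * scale k * ?q" and less: "y * scale k * ?q < (real (idx k i) + 1) * ?q"
    using c of_nat_0_le_iff[of c] unfolding distrib_right by linarith+
  show "y \<in> lev k i" unfolding lev_iff
    using mult_right_le_imp_le[OF le q] mult_right_less_imp_less[OF less] q by simp
qed

lemma lev_Suc_cover:
  assumes "i < a (Suc k)" "y \<in> lev k i"
  obtains x c where "x < a (Suc (Suc k))" "orig k x = Inl (i, c)" "y \<in> lev (Suc k) x"
proof -
  let ?q = "2 * r (Suc k)"
  have q: "0 < ?q" using r_pos by simp
  have y: "real (idx k i) \<le> y * scale k" "y * scale k < real (idx k i) + 1" using assms by (auto simp: lev_iff)
  define n where "n = nat \<lfloor>y * scale (Suc k)\<rfloor>"
  have eq: "y * scale (Suc k) = y * scale k * real ?q" by simp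
  have lo: "real (idx k i * ?q) \<le> y * scale (Suc k)" and hi: "y * scale (Suc k) < real ((idx k i + 1) * ?q)"
    unfolding eq of_nat_mult using y q by (auto intro!: mult_right_mono mult_strict_right_mono simp del: of_nat_mult)
  have n: "idx k i * ?q \<le> n" "n < (idx k i + 1) * ?q" "\<lfloor>y * scale (Suc k)\<rfloor> = int n"
    using lo hi unfolding n_def by linarith+
  have c: "n - idx k i * ?q < ?q" using n by simp
  obtain x where "x < a (Suc (Suc k))" "orig k x = Inl (i, n - idx k i * ?q)"
    using orig_exists[OF assms(1) c] by blast
  then show ?thesis using that n by (simp add: lev_floor)
qed

section \<open>Coherence of the translations\<close>

lemma shift_lev:
  assumes "y \<in> lev k i"
  shows "y + shift k i \<in> lev k (Suc i)"
proof -
  have "(y + shift k i) * scale k = y * scale k + (real (idx k (Suc i)) - real (idx k i))"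
    using scale_pos[of k] by (simp add: shift_def field_simps)
  then show ?thesis using assms by (simp add: lev_iff)
qed

lemma shift_image: "(\<lambda>x. x + shift k i) ` lev k i = lev k (Suc i)"
proof (intro equalityI subsetI)
  fix y assume y: "y \<in> lev k (Suc i)"
  have "(y - shift k i) * scale k = y * scale k - (real (idx k (Suc i)) - real (idx k i))"
    using scale_pos[of k] by (simp add: shift_def field_simps)
  then have "y - shift k i \<in> lev k i" using y by (simp add: lev_iff)
  then show "y \<in> (\<lambda>x. x + shift k i) ` lev k i" by force
qed (use shift_lev in auto)

lemma below_top_less: "below_top k i \<Longrightarrow> Suc i < a (Suc k)"
  by (simp add: below_top_def)

text \<open>Copies with the same number sit at the same relative place in their intervals, so a
  copied step has the same translation length. This brings pieces of different stages to a common
  one.\<close>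

lemma lift_piece:
  assumes "below_top k i" "y \<in> lev k i" "k \<le> K"
  shows "\<exists>j. below_top K j \<and> y \<in> lev K j \<and> shift K j = shift k i"
  using assms(3)
proof (induction K rule: dec_induct)
  case base then show ?case using assms by blast
next
  case (step K)
  then obtain j where j: "below_top K j" "y \<in> lev K j" "shift K j = shift k i" by blast
  have "j < a (Suc K)" using below_top_less[OF j(1)] by simp
  then obtain x c where x: "x < a (Suc (Suc K))" "orig K x = Inl (j, c)" "y \<in> lev (Suc K) x"
    using lev_Suc_cover j(2) by blast
  have "real (idx (Suc K) (Suc x)) - real (idx (Suc K) x) = (real (idx K (Suc j)) - real (idx K j)) * (2 * r (Suc K))"
    using x(2) orig_Suc(2)[OF x(1,2) j(1)] by (simp add: algebra_simps)
  then have "shift (Suc K) x = shift K j"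
    using r_pos[of "Suc K"] by (simp add: shift_def)
  then show ?case using orig_Suc(1)[OF x(1,2) j(1)] x(3) j(3) by auto
qed

text \<open>The steps of all stages in one sequence, as \<open>translation_pieces\<close> expects;
  the empty set stands for positions with no step.\<close>

definition piece :: "nat \<Rightarrow> real set" where
  "piece n = (case prod_decode n of (k, i) \<Rightarrow> if below_top k i then lev k i else {})"

definition pshift :: "nat \<Rightarrow> real" where
  "pshift n = (case prod_decode n of (k, i) \<Rightarrow> shift k i)"

lemma piece_encode: "piece (prod_encode (k, i)) = (if below_top k i then lev k i else {})"
  "pshift (prod_encode (k, i)) = shift k i"
  by (simp_all add: piece_def pshift_def)

lemma in_pieceE:
  assumes "y \<in> piece n"
  obtains k i where "below_top k i" "y \<in> lev k i" "pshift n = shift k i"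
  using assms by (auto simp: piece_def pshift_def split: prod.splits if_splits)

text \<open>Both conditions are checked at the later of the two stages, where distinct intervals are
  disjoint.\<close>

lemma pieces: "translation_pieces piece pshift"
proof
  show "piece j \<in> sets borel" for j
    by (auto simp: piece_def split: prod.splits)
  show "pshift n = pshift n'" if "y \<in> piece n" "y \<in> piece n'" for n n' y
  proof -
    obtain k i where 1: "below_top k i" "y \<in> lev k i" "pshift n = shift k i" using \<open>y \<in> piece n\<close> by (rule in_pieceE)
    obtain k' i' where 2: "below_top k' i'" "y \<in> lev k' i'" "pshift n' = shift k' i'" using \<open>y \<in> piece n'\<close> by (rule in_pieceE)
    obtain j where j: "below_top (max k k') j" "y \<in> lev (max k k') j" "shift (max k k') j = shift k i"
      using lift_piece[OF 1(1,2), of "max k k'"] by auto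
    obtain j' where j': "below_top (max k k') j'" "y \<in> lev (max k k') j'" "shift (max k k') j' = shift k' i'"
      using lift_piece[OF 2(1,2), of "max k k'"] by auto
    have "j = j'" using j j' below_top_less by (intro lev_disjoint[of j "max k k'" j' y]) (auto intro: Suc_lessD)
    then show ?thesis using 1 2 j j' by simp
  qed
  show "x = y" if "x \<in> piece n" "y \<in> piece n'" and eq: "x + pshift n = y + pshift n'" for n n' x y
  proof -
    obtain k i where 1: "below_top k i" "x \<in> lev k i" "pshift n = shift k i" using \<open>x \<in> piece n\<close> by (rule in_pieceE)
    obtain k' i' where 2: "below_top k' i'" "y \<in> lev k' i'" "pshift n' = shift k' i'" using \<open>y \<in> piece n'\<close> by (rule in_pieceE)
    obtain j where j: "below_top (max k k') j" "x \<in> lev (max k k') j" "shift (max k k') j = shift k i"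
      using lift_piece[OF 1(1,2), of "max k k'"] by auto
    obtain j' where j': "below_top (max k k') j'" "y \<in> lev (max k k') j'" "shift (max k k') j' = shift k' i'"
      using lift_piece[OF 2(1,2), of "max k k'"] by auto
    have "x + pshift n \<in> lev (max k k') (Suc j)" "x + pshift n \<in> lev (max k k') (Suc j')"
      using shift_lev[OF j(2)] shift_lev[OF j'(2)] 1 2 j j' eq by simp_all
    then have "Suc j = Suc j'" using j j' below_top_less by (intro lev_disjoint[of "Suc j" "max k k'" "Suc j'"]) auto
    then show ?thesis using 1 2 j j' eq by simp
  qed
qed

section \<open>The map and its inverse are defined almost everywhere\<close>

lemma top_card: "finite {i. i < a (Suc k) \<and> \<not> below_top k i}" "card {i. i < a (Suc k) \<and> \<not> below_top k i} \<le> r k + 1"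
proof -
  let ?S = "(\<lambda>c. c * a k - 1) ` {1..r k} \<union> {a (Suc k) - 1}"
  have sub: "{i. i < a (Suc k) \<and> \<not> below_top k i} \<subseteq> ?S"
  proof
    fix i assume "i \<in> {i. i < a (Suc k) \<and> \<not> below_top k i}"
    then consider "Suc i = a (Suc k)" | "Suc i \<le> r k * a k" "a k dvd Suc i" by (auto simp: below_top_def)
    then show "i \<in> ?S"
    proof cases
      case 1 then show ?thesis by auto
    next
      case 2
      then obtain c where c: "Suc i = c * a k" by (metis dvd_def mult.commute)
      then have "c * a k \<le> r k * a k" using 2 by simp
      then have "c \<le> r k" using a_pos[of k] by simp
      moreover have "1 \<le> c" using c by (cases c) auto
      moreover have "i = c * a k - 1" using c by simp
      ultimately show ?thesis by auto
    qed
  qed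
  show "finite {i. i < a (Suc k) \<and> \<not> below_top k i}" by simp
  have "card ?S \<le> card ((\<lambda>c. c * a k - 1) ` {1..r k}) + card {a (Suc k) - 1}" by (rule card_Un_le)
  also have "card ((\<lambda>c. c * a k - 1) ` {1..r k}) \<le> r k" using card_image_le[of "{1..r k}"] by fastforce
  finally have "card ?S \<le> r k + 1" by simp
  then show "card {i. i < a (Suc k) \<and> \<not> below_top k i} \<le> r k + 1"
    using card_mono[OF _ sub] by simp
qed

text \<open>The gaps of stage \<open>k\<close> are the tops, or the bottoms, of its
  \<open>r k + 1\<close> columns, and columns of height \<open>a k\<close> make them a fraction of
  order \<open>1 / a k\<close>. The factor 3 leaves room for the \<open>r k + 2\<close> candidates
  in the case of bottoms, and 18 is 3 times the bound 6 on the length.\<close>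

lemma emeasure_missing:
  assumes N: "N \<subseteq> {..<a (Suc k)}" "card N \<le> 3 * r k"
    and E: "E \<in> sets lborel" "E \<subseteq> {0..<total}" "\<And>i. i < a (Suc k) \<Longrightarrow> i \<notin> N \<Longrightarrow> E \<inter> lev k i = {}"
  shows "emeasure lborel E \<le> ennreal (total - size k + 18 / a k)"
proof -
  have finN: "finite N" using N(1) finite_subset by blast
  have "E \<subseteq> {size k..<total} \<union> (\<Union>i\<in>N. lev k i)"
  proof
    fix y assume y: "y \<in> E"
    show "y \<in> {size k..<total} \<union> (\<Union>i\<in>N. lev k i)"
    proof (cases "y < size k")
      case True
      then have "y \<in> (\<Union>i<a (Suc k). lev k i)" unfolding lev_cover using y E by auto
      then show ?thesis using y E(3) by blast
    next
      case False then show ?thesis using y E by auto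
    qed
  qed
  then have "emeasure lborel E \<le> emeasure lborel ({size k..<total} \<union> (\<Union>i\<in>N. lev k i))"
    by (rule emeasure_mono) (use finN in auto)
  also have "\<dots> \<le> emeasure lborel {size k..<total} + emeasure lborel (\<Union>i\<in>N. lev k i)"
    by (rule emeasure_subadditive) (use finN in auto)
  also have "emeasure lborel (\<Union>i\<in>N. lev k i) \<le> (\<Sum>i\<in>N. emeasure lborel (lev k i))"
    by (rule emeasure_subadditive_finite) (use finN in auto)
  also have "(\<Sum>i\<in>N. emeasure lborel (lev k i)) = ennreal (card N * (1 / scale k))"
    by (simp add: emeasure_lev ennreal_of_nat_eq_real_of_nat flip: ennreal_mult)
  also have "\<dots> \<le> ennreal (18 / a k)"
  proof (rule ennreal_leI)
    have "r k * a k \<le> a (Suc k)" by (simp add: a_Suc)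
    then have "real (r k * a k) \<le> real (a (Suc k))" by (rule of_nat_mono)
    also have "\<dots> \<le> 6 * scale k" using size_le6[of k] scale_pos[of k] by (simp add: size_def field_simps)
    finally have "r k * real (a k) \<le> 6 * scale k" by simp
    moreover have "card N * real (a k) \<le> 3 * (r k * real (a k))"
      using of_nat_mono[OF mult_le_mono1[OF N(2), of "a k"], where ?'a = real] by simp
    ultimately have "card N * real (a k) \<le> 18 * scale k" by simp
    then show "card N * (1 / scale k) \<le> 18 / a k"
      using scale_pos[of k] a_pos[of k] by (simp add: field_simps)
  qed
  finally have "emeasure lborel E \<le> emeasure lborel {size k..<total} + ennreal (18 / a k)"
    by (simp add: add_left_mono)
  also have "\<dots> = ennreal (total - size k + 18 / a k)"
    using size_le_total[of k] by (simp add: ennreal_plus)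
  finally show ?thesis .
qed

lemma missing_tendsto: "(\<lambda>k. total - size k + 18 / a k) \<longlonglongrightarrow> 0"
proof -
  have "filterlim a at_top sequentially"
    by (rule filterlim_at_top_mono[OF filterlim_ident]) (simp add: a_ge)
  then have "(\<lambda>k. 18 / real (a k)) \<longlonglongrightarrow> 0"
    by (intro tendsto_divide_0[OF tendsto_const] filterlim_at_top_imp_at_infinity
        filterlim_compose[OF filterlim_real_sequentially])
  moreover have "(\<lambda>k. total - size k) \<longlonglongrightarrow> 0"
    using tendsto_diff[OF tendsto_const size_tendsto, of total] by simp
  ultimately show ?thesis using tendsto_add by fastforce
qed

lemma missing_source: "{0..<total} - (\<Union>n. piece n) \<in> null_sets lborel" (is "?E \<in> _")
proof (rule null_set_approx)
  show meas: "?E \<in> sets lborel" using translation_pieces.borel[OF pieces] by auto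
  show "emeasure lborel ?E \<le> ennreal (total - size k + 18 / a k)" for k
  proof (rule emeasure_missing)
    show "card {i. i < a (Suc k) \<and> \<not> below_top k i} \<le> 3 * r k" using top_card(2)[of k] r_pos[of k] by simp
    fix i assume "i < a (Suc k)" "i \<notin> {i. i < a (Suc k) \<and> \<not> below_top k i}"
    then have "piece (prod_encode (k, i)) = lev k i" by (simp add: piece_encode)
    then show "?E \<inter> lev k i = {}" by blast
  qed (use meas in auto)
qed (rule missing_tendsto)

lemma missing_target: "{0..<total} - (\<Union>n. (\<lambda>x. x + pshift n) ` piece n) \<in> null_sets lborel" (is "?E \<in> _")
proof (rule null_set_approx)
  show meas: "?E \<in> sets lborel"
    using translation_pieces.borel[OF translation_pieces.translation_pieces_inverse[OF pieces]] by auto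
  show "emeasure lborel ?E \<le> ennreal (total - size k + 18 / a k)" for k
  proof (rule emeasure_missing)
    let ?N = "{i. i < a (Suc k) \<and> (\<forall>j. i = Suc j \<longrightarrow> \<not> below_top k j)}"
    let ?P = "{i. i < a (Suc k) \<and> \<not> below_top k i}"
    have "?N \<subseteq> insert 0 (Suc ` ?P)"
    proof
      fix i assume "i \<in> ?N" then show "i \<in> insert 0 (Suc ` ?P)" by (cases i) auto
    qed
    then have "card ?N \<le> card (insert 0 (Suc ` ?P))" by (intro card_mono) auto
    also have "\<dots> \<le> Suc (card ?P)" by (simp add: card_insert_if card_image)
    finally show "card ?N \<le> 3 * r k" using top_card(2)[of k] r_pos[of k] by simp
    fix i assume "i < a (Suc k)" "i \<notin> ?N"
    then obtain j where "i = Suc j" "below_top k j" by blast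
    then have "(\<lambda>x. x + pshift (prod_encode (k, j))) ` piece (prod_encode (k, j)) = lev k i"
      by (simp add: piece_encode shift_image)
    then show "?E \<inter> lev k i = {}" by blast
  qed (use meas in auto)
qed (rule missing_tendsto)

end

text \<open>\<open>J k i\<close> will be \<open>lev k i\<close> without a null set, so that images
  under \<open>T\<close> and the passage to the next stage hold exactly. The later sections use the
  transformation only through these properties.\<close>

locale two_tower_system = two_towers +
  fixes T :: "real \<Rightarrow> real" and J :: "nat \<Rightarrow> nat \<Rightarrow> real set" and M :: "real measure"
  defines "M \<equiv> normalized_lborel {0..<total}"
  assumes mpt: "invertible_mpt M T"
    and J_sets: "i < a (Suc k) \<Longrightarrow> J k i \<in> sets M"
    and J_measure: "i < a (Suc k) \<Longrightarrow> measure M (J k i) = 1 / (scale k * total)"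
    and J_lev: "J k i \<subseteq> lev k i"
    and J_Suc: "\<lbrakk>x < a (Suc (Suc k)); orig k x = Inl (i, c)\<rbrakk> \<Longrightarrow> J (Suc k) x \<subseteq> J k i"
    and J_cover: "\<lbrakk>i < a (Suc k); y \<in> J k i\<rbrakk> \<Longrightarrow> \<exists>x c. x < a (Suc (Suc k)) \<and> orig k x = Inl (i, c) \<and> y \<in> J (Suc k) x"
    and J_step: "below_top k i \<Longrightarrow> T ` J k i = J k (Suc i)"

context two_towers
begin

theorem system_exists: "\<exists>T J. two_tower_system a b r \<nu> T J"
proof -
  let ?X = "{0..<total}"
  have mX: "measure lborel ?X = total" using total_bounds by simp
  have X: "?X \<in> sets borel" "bounded ?X" "0 < measure lborel ?X"
    using mX total_bounds by auto
  have sub: "piece n \<subseteq> ?X" "(\<lambda>x. x + pshift n) ` piece n \<subseteq> ?X" for n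
  proof -
    obtain k i where n: "n = prod_encode (k, i)" by (metis prod_decode_inverse surj_pair)
    show "piece n \<subseteq> ?X" unfolding n piece_encode
      using lev_subset[of i k] Suc_lessD[OF below_top_less[of k i]] by auto
    show "(\<lambda>x. x + pshift n) ` piece n \<subseteq> ?X" unfolding n piece_encode
      using lev_subset[of "Suc i" k] below_top_less[of k i] by (simp add: shift_image)
  qed
  obtain X0 T where T: "X0 \<in> sets borel" "X0 \<subseteq> ?X" "?X - X0 \<in> null_sets lborel"
    "invertible_mpt (normalized_lborel ?X) T" "\<And>x. x \<in> X0 \<Longrightarrow> T x \<in> X0"
    "\<And>n. T ` (piece n \<inter> X0) = (\<lambda>x. x + pshift n) ` piece n \<inter> X0"
    by (rule piecewise_translation_extension[OF X pieces sub missing_source missing_target]) (rule that)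
  have "two_tower_system a b r \<nu> T (\<lambda>k i. lev k i \<inter> X0)"
  proof
    show "invertible_mpt (normalized_lborel ?X) T" by fact
  next
    fix k i assume i: "i < a (Suc k)"
    show J: "lev k i \<inter> X0 \<in> sets (normalized_lborel ?X)"
      using T(1,2) by (auto simp: sets_normalized_lborel_iff)
    have "AE x in lborel. (x \<in> lev k i \<inter> X0 \<inter> ?X) = (x \<in> lev k i)"
      using AE_not_in[OF T(3)] by eventually_elim (use lev_subset[OF i] T(2) in auto)
    then have "emeasure lborel (lev k i \<inter> X0 \<inter> ?X) = emeasure lborel (lev k i)"
      by (rule emeasure_eq_AE) (use T(1) in auto)
    then have "measure lborel (lev k i \<inter> X0 \<inter> ?X) = 1 / scale k"
      by (simp add: measure_def emeasure_lev)
    then show "measure (normalized_lborel ?X) (lev k i \<inter> X0) = 1 / (scale k * total)"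
      using J X mX by (simp add: measure_normalized_lborel)
  next
    fix x k i c assume "x < a (Suc (Suc k))" "orig k x = Inl (i, c)"
    then show "lev (Suc k) x \<inter> X0 \<subseteq> lev k i \<inter> X0" using lev_Suc_subset by blast
  next
    fix i k y assume "i < a (Suc k)" "y \<in> lev k i \<inter> X0"
    then show "\<exists>x c. x < a (Suc (Suc k)) \<and> orig k x = Inl (i, c) \<and> y \<in> lev (Suc k) x \<inter> X0"
      using lev_Suc_cover[of i k y] by blast
  next
    fix k i assume "below_top k i"
    then show "T ` (lev k i \<inter> X0) = lev k (Suc i) \<inter> X0"
      using T(6)[of "prod_encode (k, i)"] by (simp add: piece_encode shift_image)
  qed auto
  then show ?thesis by blast
qed

end

section \<open>Ergodicity\<close>

text \<open>Inner regularity yields compact cores of the atoms, and disjoint compact sets have a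
  positive distance. A set of diameter less than \<open>d\<close> then meets at most one core; this
  is how intervals of a fine stage are compared with arbitrary measurable sets.\<close>

lemma separated_cores:
  fixes X :: "real set" and P :: "nat \<Rightarrow> real set"
  assumes X: "X \<in> sets borel" "bounded X" "0 < measure lborel X"
    and P: "\<And>i. i \<in> I \<Longrightarrow> P i \<in> sets (normalized_lborel X)" "disjoint_family_on P I"
    and I: "finite I" and e: "0 < e"
  obtains K d where "0 < d" "\<And>i. i \<in> I \<Longrightarrow> K i \<subseteq> P i" "\<And>i. i \<in> I \<Longrightarrow> K i \<in> sets (normalized_lborel X)"
    "\<And>i. i \<in> I \<Longrightarrow> measure (normalized_lborel X) (P i - K i) < e"
    "\<And>i j x y. \<lbrakk>i \<in> I; j \<in> I; i \<noteq> j; x \<in> K i; y \<in> K j\<rbrakk> \<Longrightarrow> d \<le> dist x y"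
proof -
  have Pb: "P i \<in> sets borel" "P i \<subseteq> X" if "i \<in> I" for i
    using P(1)[OF that] by (auto simp: sets_normalized_lborel_iff X(1))
  have "\<exists>K. closed K \<and> K \<subseteq> P i \<and> emeasure lebesgue (P i - K) < ennreal (e * measure lborel X)" if "i \<in> I" for i
  proof -
    have "P i \<in> sets lebesgue" "0 < e * measure lborel X" using Pb[OF that] e X(3) by auto
    then show ?thesis using sets_lebesgue_inner_closed by metis
  qed
  then obtain K where K: "\<And>i. i \<in> I \<Longrightarrow> closed (K i)" "\<And>i. i \<in> I \<Longrightarrow> K i \<subseteq> P i"
    "\<And>i. i \<in> I \<Longrightarrow> emeasure lebesgue (P i - K i) < ennreal (e * measure lborel X)" by metis
  have cpt: "compact (K i)" if "i \<in> I" for i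
    unfolding compact_eq_bounded_closed using K[OF that] Pb[OF that] X(2) bounded_subset by blast
  have "\<exists>d>0. \<forall>x\<in>K i. \<forall>y\<in>K j. d \<le> dist x y" if "i \<in> I" "j \<in> I" "i \<noteq> j" for i j
  proof (rule separate_compact_closed)
    show "K i \<inter> K j = {}"
      using K(2)[of i] K(2)[of j] disjoint_family_onD[OF P(2), of i j] that by blast
  qed (use cpt K(1) that in auto)
  then obtain d where d: "\<And>i j. \<lbrakk>i \<in> I; j \<in> I; i \<noteq> j\<rbrakk> \<Longrightarrow> 0 < d i j \<and> (\<forall>x\<in>K i. \<forall>y\<in>K j. d i j \<le> dist x y)"
    by metis
  \<comment> \<open>The element 1 keeps the minimum meaningful when there are no two distinct
    indices.\<close>
  let ?D = "insert 1 (case_prod d ` {(i, j). i \<in> I \<and> j \<in> I \<and> i \<noteq> j})"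
  have "finite {(i, j). i \<in> I \<and> j \<in> I \<and> i \<noteq> j}"
    by (rule finite_subset[of _ "I \<times> I"]) (use I in auto)
  then have fin: "finite ?D" by simp
  have le: "Min ?D \<le> dist x y" if "i \<in> I" "j \<in> I" "i \<noteq> j" "x \<in> K i" "y \<in> K j" for i j x y
  proof -
    have "Min ?D \<le> d i j" using that fin by (intro Min_le) auto
    then show ?thesis using d[OF that(1-3)] that(4,5) by force
  qed
  have pos: "0 < Min ?D" using fin d by auto
  have Ks: "K i \<in> sets (normalized_lborel X)" if "i \<in> I" for i
    using K(1,2)[OF that] Pb[OF that] by (auto simp: sets_normalized_lborel_iff X(1))
  have meas: "measure (normalized_lborel X) (P i - K i) < e" if i: "i \<in> I" for i
  proof -
    have s: "P i - K i \<in> sets (normalized_lborel X)" using P(1)[OF i] Ks[OF i] by blast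
    then have sb: "P i - K i \<in> sets lborel" "(P i - K i) \<inter> X = P i - K i"
      using Pb[OF i] by (auto simp: sets_normalized_lborel_iff X(1))
    have "emeasure lborel (P i - K i) < ennreal (e * measure lborel X)"
      using K(3)[OF i] sb by simp
    then have "measure lborel (P i - K i) < e * measure lborel X"
      using e X(3) by (metis emeasure_eq_ennreal_measure ennreal_less_iff infinity_ennreal_def measure_nonneg top.extremum_strict top.not_eq_extremum)
    then show ?thesis using X s sb by (simp add: measure_normalized_lborel pos_divide_less_eq)
  qed
  show ?thesis by (rule that; (rule pos K(2) Ks meas le; assumption?))
qed

lemma invertible_mpt_image:
  assumes "invertible_mpt M T" "A \<in> sets M"
  shows "T ` A \<in> sets M" "measure M (T ` A) = measure M A"
proof -
  have T: "bij_betw T (space M) (space M)" "T \<in> measurable M M" "inv_into (space M) T \<in> measurable M M"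
    and mp: "\<And>A. A \<in> sets M \<Longrightarrow> measure M (T -` A \<inter> space M) = measure M A"
    using assms(1) by (auto simp: invertible_mpt_def)
  have sub: "A \<subseteq> space M" using assms(2) by (rule sets.sets_into_space)
  have "T ` A = inv_into (space M) T -` A \<inter> space M"
  proof (intro equalityI subsetI)
    fix y assume "y \<in> T ` A"
    then show "y \<in> inv_into (space M) T -` A \<inter> space M"
      using sub T(1) by (auto simp: bij_betw_def inv_into_f_f)
  next
    fix y assume "y \<in> inv_into (space M) T -` A \<inter> space M"
    then have "T (inv_into (space M) T y) = y" "inv_into (space M) T y \<in> A"
      using T(1) by (auto simp: bij_betw_def f_inv_into_f)
    then show "y \<in> T ` A" by (metis imageI)
  qed
  then show s: "T ` A \<in> sets M" using measurable_sets[OF T(3) assms(2)] by simp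
  have "T -` (T ` A) \<inter> space M = A"
    using sub T(1) by (auto simp: bij_betw_def inj_on_def)
  then show "measure M (T ` A) = measure M A" using mp[OF s] by simp
qed

lemma invertible_mpt_image_funpow:
  assumes "invertible_mpt M T" "A \<in> sets M"
  shows "(T ^^ n) ` A \<in> sets M \<and> measure M ((T ^^ n) ` A) = measure M A"
proof (induction n)
  case (Suc n)
  have "(T ^^ Suc n) ` A = T ` (T ^^ n) ` A" by (simp add: image_comp)
  then show ?case using invertible_mpt_image[OF assms(1)] Suc by simp
qed (use assms in simp)

context two_tower_system
begin

sublocale prob_space M using mpt by (simp add: invertible_mpt_def)

section \<open>Intervals and columns of the system\<close>

lemma X_facts: "{0..<total} \<in> sets borel" "bounded {0..<total}" "0 < measure lborel {0..<total}"
  using total_bounds by auto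

lemma scale_ge: "k \<le> scale k"
proof (induction k)
  case (Suc k)
  have "scale k * 2 \<le> scale k * (2 * r (Suc k))" using r_pos[of "Suc k"] by (intro mult_le_mono2) simp
  then show ?case using Suc scale_pos[of k] unfolding scale.simps(2) by linarith
qed simp

lemma J_disjoint: "\<lbrakk>i < a (Suc k); j < a (Suc k); i \<noteq> j\<rbrakk> \<Longrightarrow> J k i \<inter> J k j = {}"
  using J_lev[of k i] J_lev[of k j] lev_disjoint[of i k j] by blast

lemma disjoint_Int: "I \<subseteq> {..<a (Suc k)} \<Longrightarrow> disjoint_family_on (\<lambda>i. A \<inter> J k i) I"
  unfolding disjoint_family_on_def
proof (intro ballI impI)
  fix i j assume "I \<subseteq> {..<a (Suc k)}" "i \<in> I" "j \<in> I" "i \<noteq> j"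
  then have "J k i \<inter> J k j = {}" by (intro J_disjoint) auto
  then show "A \<inter> J k i \<inter> (A \<inter> J k j) = {}" by blast
qed

lemma J_diam:
  assumes "x \<in> J k i" "y \<in> J k i"
  shows "dist x y < 1 / scale k"
  using subsetD[OF J_lev assms(1)] subsetD[OF J_lev assms(2)] scale_pos[of k]
  by (auto simp: lev_iff dist_real_def field_simps abs_if)

lemma J_subset: "i < a (Suc k) \<Longrightarrow> J k i \<subseteq> space M"
  using J_sets sets.sets_into_space by blast

lemma measure_J_Union:
  assumes "N \<subseteq> {..<a (Suc k)}"
  shows "measure M (\<Union>i\<in>N. J k i) = card N / (scale k * total)"
proof -
  have fin: "finite N" using assms finite_subset by blast
  have "measure M (\<Union>i\<in>N. J k i) = (\<Sum>i\<in>N. measure M (J k i))"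
    using assms J_sets J_disjoint fin
    by (intro finite_measure_finite_Union) (auto simp: disjoint_family_on_def subset_iff)
  also have "\<dots> = (\<Sum>i\<in>N. 1 / (scale k * total))"
    using assms J_measure by (intro sum.cong) auto
  finally show ?thesis by simp
qed

lemma measure_rest: "measure M (space M - (\<Union>i<a (Suc k). J k i)) = 1 - size k / total"
proof -
  have "(\<Union>i<a (Suc k). J k i) \<in> sets M" using J_sets by auto
  then show ?thesis using measure_J_Union[of "{..<a (Suc k)}" k] by (simp add: prob_compl size_def)
qed

lemma rest_tendsto: "(\<lambda>k. 1 - size k / total) \<longlonglongrightarrow> 0"
proof -
  have "(\<lambda>k. 1 - size k / total) \<longlonglongrightarrow> 1 - total / total"
    using total_bounds by (intro tendsto_intros size_tendsto) auto
  then show ?thesis using total_bounds by simp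
qed

lemma fine_stage:
  assumes "0 < d" "0 < e"
  shows "\<exists>k\<ge>K. 1 / scale k \<le> d \<and> 1 - size k / total < e"
proof -
  have "eventually (\<lambda>k. 1 - size k / total < e) sequentially"
    using rest_tendsto assms(2) by (rule order_tendstoD(2))
  then obtain K1 where K1: "\<And>k. k \<ge> K1 \<Longrightarrow> 1 - size k / total < e" by (auto simp: eventually_sequentially)
  obtain K2 where K2: "1 / d < real K2" using reals_Archimedean2 by blast
  let ?k = "max K (max K1 K2)"
  have "1 / d \<le> scale ?k" using K2 scale_ge[of ?k] by linarith
  then have "1 / scale ?k \<le> d" using assms(1) scale_pos[of ?k] by (simp add: field_simps)
  then show ?thesis using K1 by (intro exI[of _ ?k]) auto
qed

lemma below_top_A: "\<lbrakk>c < r k; Suc j < a k\<rbrakk> \<Longrightarrow> below_top k (c * a k + j)"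
proof -
  assume c: "c < r k" and j: "Suc j < a k"
  have "c * a k + Suc j < Suc c * a k" using j by simp
  also have "\<dots> \<le> r k * a k" using c by (intro mult_le_mono1) simp
  finally have "Suc (c * a k + j) < a (Suc k)" by (simp add: a_Suc)
  moreover have "\<not> a k dvd c * a k + Suc j"
  proof
    assume "a k dvd c * a k + Suc j"
    then have "a k dvd Suc j" by (metis dvd_add_right_iff dvd_triv_right)
    then show False using j by (auto dest: dvd_imp_le)
  qed
  ultimately show ?thesis by (simp add: below_top_def)
qed

lemma below_top_B: "Suc j < b k \<Longrightarrow> below_top k (r k * a k + j)"
  by (simp add: below_top_def a_Suc)

lemma column_A: "\<lbrakk>c < r k; j < a k\<rbrakk> \<Longrightarrow> (T ^^ j) ` J k (c * a k) = J k (c * a k + j)"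
proof (induction j)
  case (Suc j)
  have "(T ^^ Suc j) ` J k (c * a k) = T ` (T ^^ j) ` J k (c * a k)" by (simp add: image_comp)
  then show ?case using Suc J_step[OF below_top_A] by simp
qed simp

lemma column_B: "j < b k \<Longrightarrow> (T ^^ j) ` J k (r k * a k) = J k (r k * a k + j)"
proof (induction j)
  case (Suc j)
  have "(T ^^ Suc j) ` J k (r k * a k) = T ` (T ^^ j) ` J k (r k * a k)" by (simp add: image_comp)
  then show ?case using Suc J_step[OF below_top_B] by simp
qed simp

lemma A_index: "\<lbrakk>c < r k; j < a k\<rbrakk> \<Longrightarrow> c * a k + j < r k * a k"
proof -
  assume "c < r k" "j < a k"
  then have "c * a k + j < Suc c * a k" by simp
  also have "\<dots> \<le> r k * a k" using \<open>c < r k\<close> by (intro mult_le_mono1) simp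
  finally show ?thesis .
qed

end

locale invariant_set = two_tower_system a b r \<nu> T J M for a b r \<nu> T J M +
  fixes S :: "real set"
  assumes S: "S \<in> sets M" "T -` S \<inter> space M = S"
begin

definition mass :: "nat \<Rightarrow> nat \<Rightarrow> real" where "mass k i = measure M (S \<inter> J k i)"

lemma mass_step:
  assumes "below_top k i"
  shows "mass k (Suc i) = mass k i"
proof -
  have i: "i < a (Suc k)" using below_top_less[OF assms] by simp
  have "T ` (S \<inter> J k i) = S \<inter> J k (Suc i)"
  proof (intro equalityI subsetI)
    fix y assume y: "y \<in> S \<inter> J k (Suc i)"
    then obtain x where x: "x \<in> J k i" "y = T x" using J_step[OF assms] by blast
    then have "x \<in> T -` S \<inter> space M" using y J_subset[OF i] by auto
    then show "y \<in> T ` (S \<inter> J k i)" using x S(2) by auto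
  next
    fix y assume "y \<in> T ` (S \<inter> J k i)"
    then show "y \<in> S \<inter> J k (Suc i)" using J_step[OF assms] S(2) by blast
  qed
  then show ?thesis
    using invertible_mpt_image(2)[OF mpt, of "S \<inter> J k i"] S(1) J_sets[OF i] by (simp add: mass_def)
qed

lemma mass_A: "\<lbrakk>c < r k; j < a k\<rbrakk> \<Longrightarrow> mass k (c * a k + j) = mass k (c * a k)"
proof (induction j)
  case (Suc j) then show ?case using mass_step[OF below_top_A[of c k j]] by simp
qed simp

lemma mass_B: "j < b k \<Longrightarrow> mass k (r k * a k + j) = mass k (r k * a k)"
proof (induction j)
  case (Suc j) then show ?case using mass_step[OF below_top_B[of j k]] by simp
qed simp

text \<open>Each tower of stage \<open>k + 1\<close> visits every interval of stage \<open>k\<close> equally often, so an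
  invariant set has the same mass in all of these intervals.\<close>

lemma mass_const:
  assumes o': "i < a (Suc k)"
  shows "mass k i = mass k 0"
proof -
  let ?A = "a (Suc k)" and ?R = "r (Suc k)"
  have "mass k i = (\<Sum>c<?R. mass (Suc k) (c * ?A)) + ?R * mass (Suc k) (?R * ?A)" if i: "i < ?A" for i
  proof -
    \<comment> \<open>\<open>F\<close> collects the copies of position \<open>i\<close>. Half of
      them, \<open>F1\<close>, lie in the short part, one per column; the other half lies in the
      long tower, where all levels have equal mass. So the resulting sum does not depend on
      \<open>i\<close>.\<close>
    define F where "F = {x. x < a (Suc (Suc k)) \<and> (\<exists>c. orig k x = Inl (i, c))}"
    define F1 where "F1 = (\<lambda>c. c * ?A + i) ` {..<?R}"
    have finF: "finite F" by (simp add: F_def)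
    have inj1: "inj_on (\<lambda>c. c * ?A + i) {..<?R}" using a_pos[of "Suc k"] by (auto simp: inj_on_def)
    have F1: "F1 \<subseteq> F"
      using orig_A[OF i] by (auto simp: F_def F1_def line_parts intro!: trans_less_add1)
    have "orig k ` F = (\<lambda>c. Inl (i, c)) ` {..<2 * ?R}"
    proof (intro equalityI subsetI)
      fix y assume "y \<in> orig k ` F"
      then show "y \<in> (\<lambda>c. Inl (i, c)) ` {..<2 * ?R}" using orig_Inl_bounds by (fastforce simp: F_def)
    next
      fix y :: "nat \<times> nat + nat" assume "y \<in> (\<lambda>c. Inl (i, c)) ` {..<2 * ?R}"
      then obtain c where c: "c < 2 * ?R" "y = Inl (i, c)" by auto
      then obtain x where "x < a (Suc (Suc k))" "orig k x = y" using orig_exists[OF i] by blast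
      then show "y \<in> orig k ` F" using c by (intro image_eqI[of _ _ x]) (auto simp: F_def)
    qed
    moreover have "inj_on (orig k) F"
      by (rule inj_on_subset[OF orig_inj]) (auto simp: F_def)
    ultimately have "card F = card ((\<lambda>c. Inl (i, c) :: nat \<times> nat + nat) ` {..<2 * ?R})"
      by (metis card_image)
    also have "\<dots> = 2 * ?R" by (subst card_image) (auto simp: inj_on_def)
    finally have cF: "card F = 2 * ?R" .
    have cF1: "card F1 = ?R" unfolding F1_def by (simp add: card_image[OF inj1])
    have cD: "card (F - F1) = ?R" using F1 finF cF cF1 by (simp add: card_Diff_subset finite_subset)
    have Jeq: "J k i = (\<Union>x\<in>F. J (Suc k) x)"
    proof (intro equalityI subsetI)
      fix y assume "y \<in> J k i"
      then show "y \<in> (\<Union>x\<in>F. J (Suc k) x)" using J_cover[OF i, of y] unfolding F_def by blast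
    next
      fix y assume "y \<in> (\<Union>x\<in>F. J (Suc k) x)"
      then obtain x c where "x < a (Suc (Suc k))" "orig k x = Inl (i, c)" "y \<in> J (Suc k) x"
        unfolding F_def by blast
      then show "y \<in> J k i" using J_Suc[of x k i c] by blast
    qed
    have "mass k i = measure M (\<Union>x\<in>F. S \<inter> J (Suc k) x)" unfolding mass_def Jeq Int_UN_distrib ..
    also have "\<dots> = (\<Sum>x\<in>F. mass (Suc k) x)"
      unfolding mass_def
    proof (rule finite_measure_finite_Union[OF finF])
      show "(\<lambda>x. S \<inter> J (Suc k) x) ` F \<subseteq> sets M" using S(1) J_sets by (auto simp: F_def)
      show "disjoint_family_on (\<lambda>x. S \<inter> J (Suc k) x) F"
        by (rule disjoint_Int) (auto simp: F_def)
    qed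
    also have "\<dots> = (\<Sum>x\<in>F - F1. mass (Suc k) x) + (\<Sum>x\<in>F1. mass (Suc k) x)"
      using F1 finF by (rule sum.subset_diff)
    also have "(\<Sum>x\<in>F1. mass (Suc k) x) = (\<Sum>c<?R. mass (Suc k) (c * ?A))"
      unfolding F1_def sum.reindex[OF inj1] o_def
      by (intro sum.cong refl mass_A[OF _ i]) simp
    also have "(\<Sum>x\<in>F - F1. mass (Suc k) x) = (\<Sum>x\<in>F - F1. mass (Suc k) (?R * ?A))"
    proof (rule sum.cong[OF refl])
      fix x assume x: "x \<in> F - F1"
      have "?R * ?A \<le> x"
      proof (rule ccontr)
        assume "\<not> ?R * ?A \<le> x"
        then have lt: "x < ?R * ?A" by simp
        then have "x div ?A < ?R" by (simp add: less_mult_imp_div_less)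
        moreover have "x mod ?A = i" using x lt by (auto simp: F_def orig_def)
        ultimately have "x \<in> F1" unfolding F1_def by (intro image_eqI[of _ _ "x div ?A"]) auto
        then show False using x by simp
      qed
      moreover have "x < a (Suc (Suc k))" using x by (simp add: F_def)
      ultimately show "mass (Suc k) x = mass (Suc k) (?R * ?A)"
        using mass_B[of "x - ?R * ?A" "Suc k"] by (simp add: a_Suc[of "Suc k"])
    qed
    finally show ?thesis by (simp add: cD)
  qed
  from this[OF o'] this[of 0] show ?thesis using a_pos[of "Suc k"] by simp
qed

text \<open>The set and its complement each have constant mass on the intervals of a stage. At a
  fine stage no interval meets both cores, so in each interval one of the two masses lies entirely
  outside the cores, where there is little room. Hence the smaller of the two measures would be
  small.\<close>

lemma trivial: "measure M S = 0 \<or> measure M S = 1"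
proof (rule ccontr)
  assume "\<not> ?thesis"
  then have nz: "measure M S \<noteq> 0" "measure M S \<noteq> 1" by auto
  define C where "C = space M - S"
  have C: "C \<in> sets M" using S(1) by (auto simp: C_def)
  have mC: "measure M C = 1 - measure M S" unfolding C_def by (rule prob_compl[OF S(1)])
  \<comment> \<open>With a quarter of the smaller measure the argument ends in
    \<open>3 * e < 2 * e\<close>: one \<open>e\<close> is lost outside the intervals of the stage,
    and \<open>2 * e\<close> bounds what lies outside the cores.\<close>
  define e where "e = min (measure M S) (measure M C) / 4"
  have "0 < measure M S" using nz by (simp add: zero_less_measure_iff)
  moreover have "measure M S < 1" using nz(2) prob_le_1[of S] by linarith
  ultimately have e: "0 < e" using mC by (simp add: e_def)
  define P where "P i = (if i = (0::nat) then S else C)" for i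
  obtain K d where d: "0 < d" and K: "\<And>i. i \<in> {0, 1} \<Longrightarrow> K i \<subseteq> P i" "\<And>i. i \<in> {0, 1} \<Longrightarrow> K i \<in> sets M"
    "\<And>i. i \<in> {0, 1} \<Longrightarrow> measure M (P i - K i) < e"
    "\<And>i j x y. \<lbrakk>i \<in> {0, 1}; j \<in> {0, 1}; i \<noteq> j; x \<in> K i; y \<in> K j\<rbrakk> \<Longrightarrow> d \<le> dist x y"
  proof (rule separated_cores[of "{0..<total}" "{0, 1}" P e])
    show "P i \<in> sets (normalized_lborel {0..<total})" if "i \<in> {0, 1}" for i
      using S(1) C by (auto simp: P_def M_def)
    show "disjoint_family_on P {0, 1}" by (auto simp: disjoint_family_on_def P_def C_def)
  qed (use X_facts e that in \<open>auto simp: M_def\<close>)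
  obtain k where k: "1 / scale k \<le> d" "1 - size k / total < e" using fine_stage[OF d e] by blast
  define U where "U = (\<Union>i<a (Suc k). J k i)"
  have U: "U \<in> sets M" using J_sets by (auto simp: U_def)
  have rest: "measure M (space M - U) < e" using k(2) measure_rest[of k] by (simp add: U_def)
  define cm where "cm i = measure M (C \<inter> J k i)" for i
  have split: "mass k i + cm i = 1 / (scale k * total)" if i: "i < a (Suc k)" for i
  proof -
    have "measure M (J k i) = measure M ((S \<inter> J k i) \<union> (C \<inter> J k i))"
      using J_subset[OF i] S(1)[THEN sets.sets_into_space] by (intro arg_cong[of _ _ "measure M"]) (auto simp: C_def)
    also have "\<dots> = mass k i + cm i"
      unfolding mass_def cm_def using S(1) C J_sets[OF i] by (intro finite_measure_Union) (auto simp: C_def)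
    finally show ?thesis using J_measure[OF i] by simp
  qed
  have cm_const: "cm i = cm 0" if i: "i < a (Suc k)" for i
    using split[OF i] split[of 0] mass_const[OF i] a_pos[of "Suc k"] by simp
  have sumU: "measure M (A \<inter> U) = (\<Sum>i<a (Suc k). measure M (A \<inter> J k i))" if A: "A \<in> sets M" for A
  proof -
    have "A \<inter> U = (\<Union>i<a (Suc k). A \<inter> J k i)" by (auto simp: U_def)
    also have "measure M \<dots> = (\<Sum>i<a (Suc k). measure M (A \<inter> J k i))"
      using A J_sets disjoint_Int by (intro finite_measure_finite_Union) auto
    finally show ?thesis .
  qed
  have low: "measure M A - e \<le> measure M (A \<inter> U)" if A: "A \<in> sets M" for A
  proof -
    have "measure M A \<le> measure M ((A \<inter> U) \<union> (space M - U))"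
      using A U sets.sets_into_space[OF A] by (intro finite_measure_mono) auto
    also have "\<dots> \<le> measure M (A \<inter> U) + measure M (space M - U)"
      using A U by (intro measure_Un_le) auto
    finally show ?thesis using rest by simp
  qed
  let ?n = "real (a (Suc k))"
  have nS: "measure M S - e \<le> ?n * mass k 0"
  proof -
    have "(\<Sum>i<a (Suc k). mass k i) = (\<Sum>i<a (Suc k). mass k 0)"
      by (intro sum.cong refl mass_const) simp
    then show ?thesis using low[OF S(1)] sumU[OF S(1)] by (simp add: mass_def[symmetric])
  qed
  have nC: "measure M C - e \<le> ?n * cm 0"
  proof -
    have "(\<Sum>i<a (Suc k). cm i) = (\<Sum>i<a (Suc k). cm 0)"
      by (intro sum.cong refl cm_const) simp
    then show ?thesis using low[OF C] sumU[OF C] by (simp add: cm_def[symmetric])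
  qed
  have K0: "S - K 0 \<in> sets M" "C - K 1 \<in> sets M" using S(1) C K(2)[of 0] K(2)[of 1] by auto
  have each: "min (mass k 0) (cm 0) \<le> measure M ((S - K 0) \<inter> J k i) + measure M ((C - K 1) \<inter> J k i)"
    if i: "i < a (Suc k)" for i
  proof -
    have "J k i \<inter> K 0 = {} \<or> J k i \<inter> K 1 = {}"
    proof (rule ccontr)
      assume "\<not> ?thesis"
      then obtain x y where xy: "x \<in> J k i" "x \<in> K 0" "y \<in> J k i" "y \<in> K 1" by blast
      then show False using J_diam[OF xy(1,3)] K(4)[of 0 1 x y] k(1) by simp
    qed
    then consider "J k i \<inter> K 0 = {}" | "J k i \<inter> K 1 = {}" by blast
    then show ?thesis
    proof cases
      case 1
      then have "(S - K 0) \<inter> J k i = S \<inter> J k i" by auto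
      then have "mass k 0 = measure M ((S - K 0) \<inter> J k i)" using mass_const[OF i] by (simp add: mass_def)
      then show ?thesis by (simp add: min_le_iff_disj add_increasing2)
    next
      case 2
      then have "(C - K 1) \<inter> J k i = C \<inter> J k i" by auto
      then have "cm 0 = measure M ((C - K 1) \<inter> J k i)" using cm_const[OF i] by (simp add: cm_def)
      then show ?thesis by (simp add: min_le_iff_disj add_increasing)
    qed
  qed
  have "?n * min (mass k 0) (cm 0) = (\<Sum>i<a (Suc k). min (mass k 0) (cm 0))" by simp
  also have "\<dots> \<le> (\<Sum>i<a (Suc k). measure M ((S - K 0) \<inter> J k i) + measure M ((C - K 1) \<inter> J k i))"
    using each by (intro sum_mono) auto
  also have "\<dots> = measure M ((S - K 0) \<inter> U) + measure M ((C - K 1) \<inter> U)"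
    using sumU[OF K0(1)] sumU[OF K0(2)] by (simp add: sum.distrib)
  also have "\<dots> \<le> measure M (S - K 0) + measure M (C - K 1)"
    using K0 by (intro add_mono finite_measure_mono) auto
  also have "\<dots> < 2 * e" using K(3)[of 0] K(3)[of 1] by (simp add: P_def)
  finally have "?n * min (mass k 0) (cm 0) < 2 * e" .
  then have "min (?n * mass k 0) (?n * cm 0) < 2 * e" by (simp add: min_mult_distrib_left)
  then have "min (measure M S) (measure M C) - e < 2 * e" using nS nC by linarith
  moreover have "min (measure M S) (measure M C) = 4 * e" by (simp add: e_def)
  ultimately show False using e by linarith
qed

end

context two_tower_system
begin

lemma ergodic: "ergodic M T"
  unfolding ergodic_def
proof (intro ballI impI)
  fix A assume "A \<in> sets M" "T -` A \<inter> space M = A"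
  then interpret invariant_set a b r \<nu> T J M A
    by unfold_locales (auto simp: M_def)
  show "measure M A = 0 \<or> measure M A = 1" by (rule trivial)
qed

end

section \<open>Rank at most two\<close>

lemma finite_partition_partition_on:
  assumes "finite_partition M m P"
  shows "partition_on (space M) (P ` {1..m} - {{}})"
proof -
  have "disjoint (P ` {1..m} - {{}})"
    using assms unfolding finite_partition_def disjoint_family_on_def disjoint_def by fast
  moreover have "\<Union>(P ` {1..m} - {{}}) = (\<Union>i\<in>{1..m}. P i)" by blast
  ultimately show ?thesis using assms by (simp add: partition_on_def finite_partition_def)
qed

lemma finite_partition_sets: "finite_partition M m P \<Longrightarrow> i \<in> {1..m} \<Longrightarrow> P i \<in> sets M"
  by (simp add: finite_partition_def)

context two_tower_system
begin

definition height :: "nat \<Rightarrow> nat \<Rightarrow> nat" where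
  "height k i = (if i = 1 then a k else b k)"

text \<open>Tower 1 is the short one: its \<open>r k\<close> columns of equal height stand side by
  side and form one tower. Tower 2 is the long one.\<close>

definition level_index :: "nat \<Rightarrow> nat \<Rightarrow> nat \<Rightarrow> nat set" where
  "level_index k i j = (if i = 1 then (\<lambda>c. c * a k + j) ` {..<r k} else {r k * a k + j})"

definition level :: "nat \<Rightarrow> nat \<Rightarrow> nat \<Rightarrow> real set" where
  "level k i j = (\<Union>x\<in>level_index k i j. J k x)"

lemma height_pos: "0 < height k i"
  using a_pos b_pos by (simp add: height_def)

lemma level_index_subset: "j < height k i \<Longrightarrow> level_index k i j \<subseteq> {..<a (Suc k)}"
  using A_index[of _ k j] by (auto simp: height_def level_index_def a_Suc split: if_splits intro: trans_less_add1)

lemma level_index_disjoint: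
  assumes "j < height k i" "j' < height k i'" "i \<in> {1..2}" "i' \<in> {1..2}" "(i, j) \<noteq> (i', j')"
  shows "level_index k i j \<inter> level_index k i' j' = {}"
proof -
  have "False" if x: "x \<in> level_index k i j" "x \<in> level_index k i' j'" for x
  proof -
    have *: "u \<noteq> 1 \<longrightarrow> r k * a k \<le> x \<and> v = x - r k * a k" "u = 1 \<longrightarrow> x < r k * a k \<and> v = x mod a k"
      if "v < height k u" "x \<in> level_index k u v" for u v
      using that A_index[of _ k v] by (auto simp: level_index_def height_def)
    show False using *[OF assms(1) x(1)] *[OF assms(2) x(2)] assms(3-5) by (cases "i = 1"; cases "i' = 1") auto
  qed
  then show ?thesis by blast
qed

lemma level_index_cover:
  assumes "x < a (Suc k)"
  shows "\<exists>i\<in>{1..2}. \<exists>j<height k i. x \<in> level_index k i j"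
proof (cases "x < r k * a k")
  case True
  then have "x div a k < r k" by (simp add: less_mult_imp_div_less)
  then have "x \<in> level_index k 1 (x mod a k)"
    unfolding level_index_def by (auto intro!: image_eqI[of _ _ "x div a k"])
  moreover have "x mod a k < height k 1" using a_pos by (simp add: height_def)
  ultimately show ?thesis by (intro bexI[of _ 1]) auto
next
  case False
  then show ?thesis using assms
    by (intro bexI[of _ 2] exI[of _ "x - r k * a k"]) (auto simp: height_def level_index_def a_Suc)
qed

lemma level_sets: "j < height k i \<Longrightarrow> level k i j \<in> sets M"
  using level_index_subset[of j k i] J_sets unfolding level_def
  by (intro sets.finite_UN) (auto intro: finite_subset)

lemma level_disjoint:
  assumes "j < height k i" "j' < height k i'" "i \<in> {1..2}" "i' \<in> {1..2}" "(i, j) \<noteq> (i', j')"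
  shows "level k i j \<inter> level k i' j' = {}"
proof -
  have "J k x \<inter> J k y = {}" if "x \<in> level_index k i j" "y \<in> level_index k i' j'" for x y
    using that level_index_disjoint[OF assms] level_index_subset[OF assms(1)] level_index_subset[OF assms(2)]
    by (intro J_disjoint) auto
  then show ?thesis by (auto simp: level_def)
qed

lemma level_funpow:
  assumes "j < height k i"
  shows "(T ^^ j) ` level k i 0 = level k i j"
proof (cases "i = 1")
  case True
  then have "j < a k" using assms by (simp add: height_def)
  then show ?thesis using True column_A[of _ k j]
    by (simp add: level_def level_index_def image_UN)
next
  case False
  then show ?thesis using assms column_B[of j k] by (simp add: level_def level_index_def height_def)
qed

lemma level_Union: "(\<Union>i\<in>{1..2}. \<Union>j<height k i. level k i j) = (\<Union>x<a (Suc k). J k x)"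
proof (intro equalityI subsetI)
  fix y assume "y \<in> (\<Union>i\<in>{1..2}. \<Union>j<height k i. level k i j)"
  then obtain i j where "j < height k i" "y \<in> level k i j" by auto
  then show "y \<in> (\<Union>x<a (Suc k). J k x)" using level_index_subset[of j k i] by (auto simp: level_def)
next
  fix y assume "y \<in> (\<Union>x<a (Suc k). J k x)"
  then obtain x where x: "x < a (Suc k)" "y \<in> J k x" by blast
  obtain i j where ij: "i \<in> {1..2}" "j < height k i" "x \<in> level_index k i j"
    using level_index_cover[OF x(1)] by blast
  then have "y \<in> level k i j" using x(2) unfolding level_def by blast
  then show "y \<in> (\<Union>i\<in>{1..2}. \<Union>j<height k i. level k i j)" using ij by blast
qed

text \<open>Level \<open>j\<close> of the short tower of stage \<open>k + 1\<close> lies in the single interval \<open>j\<close> of stage \<open>k\<close>.\<close>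

lemma level_diam:
  assumes "j < height (Suc k) i" "x \<in> level (Suc k) i j" "y \<in> level (Suc k) i j"
  shows "dist x y < 1 / scale k"
proof (cases "i = 1")
  case True
  then have j: "j < a (Suc k)" using assms by (simp add: height_def)
  have "level (Suc k) i j \<subseteq> J k j"
    unfolding level_def
  proof (rule UN_least)
    fix z assume "z \<in> level_index (Suc k) i j"
    then obtain c where c: "c < r (Suc k)" "z = c * a (Suc k) + j" using True by (auto simp: level_index_def)
    have "z < a (Suc (Suc k))"
      using orig_A(1)[OF j c(1)] c(2) line_parts[of k] by simp
    then show "J (Suc k) z \<subseteq> J k j" using orig_A(2)[OF j c(1)] c(2) J_Suc by blast
  qed
  then show ?thesis using assms by (intro J_diam[of _ k j]) auto
next
  case False
  then have "dist x y < 1 / scale (Suc k)"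
    using assms J_diam[of x "Suc k" _ y] by (simp add: level_def level_index_def)
  also have "\<dots> \<le> 1 / scale k"
  proof (rule divide_left_mono)
    have "scale k * 1 \<le> scale k * (2 * r (Suc k))" using r_pos[of "Suc k"] by (intro mult_le_mono2) simp
    then have "scale k \<le> scale (Suc k)" by (simp only: scale.simps mult_1_right)
    then show "real (scale k) \<le> real (scale (Suc k))" by (rule of_nat_mono)
  qed (use scale_pos[of k] r_pos[of "Suc k"] in auto)
  finally show ?thesis .
qed

text \<open>The levels of a late stage are narrow, so each meets at most one core and is given to
  the atom of that core. All errors then lie outside the towers or outside the cores.\<close>

lemma rank_at_most_2: "rank_at_most 2 M T"
  unfolding rank_at_most_def
proof (intro allI impI)
  fix m :: nat and P and \<epsilon> :: real
  assume fp: "finite_partition M m P" and \<epsilon>: "0 < \<epsilon>"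
  have m: "0 < m"
  proof (rule ccontr)
    assume "\<not> 0 < m"
    then have "space M = {}" using fp by (simp add: finite_partition_def)
    then show False using not_empty by blast
  qed
  \<comment> \<open>Each of the \<open>m\<close> symmetric differences lies in a set of measure at
    most \<open>(m + 1) * e\<close>, so the distance is at most \<open>q * e\<close>, which is half
    of \<epsilon>.\<close>
  define q where "q = real m * (real m + 1)"
  have q: "0 < q" using m by (simp add: q_def)
  define e where "e = \<epsilon> / (2 * q)"
  have e: "0 < e" using \<epsilon> q by (simp add: e_def)
  obtain K d where d: "0 < d" and K: "\<And>i. i \<in> {1..m} \<Longrightarrow> K i \<subseteq> P i" "\<And>i. i \<in> {1..m} \<Longrightarrow> K i \<in> sets M"
    "\<And>i. i \<in> {1..m} \<Longrightarrow> measure M (P i - K i) < e"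
    "\<And>i j x y. \<lbrakk>i \<in> {1..m}; j \<in> {1..m}; i \<noteq> j; x \<in> K i; y \<in> K j\<rbrakk> \<Longrightarrow> d \<le> dist x y"
  proof (rule separated_cores[of "{0..<total}" "{1..m}" P e])
    show "P i \<in> sets (normalized_lborel {0..<total})" if "i \<in> {1..m}" for i
      using finite_partition_sets[OF fp that] by (simp add: M_def)
    show "disjoint_family_on P {1..m}" using fp by (simp add: finite_partition_def)
  qed (use X_facts e that in \<open>auto simp: M_def\<close>)
  obtain k' where k': "1 / scale k' \<le> d" "1 - size k' / total < e" using fine_stage[OF d e] by blast
  \<comment> \<open>One stage further: \<open>level_diam\<close> bounds the levels of stage
    \<open>Suc k'\<close> by the width of the intervals of stage \<open>k'\<close>.\<close>
  let ?k = "Suc k'"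
  define U where "U = (\<Union>x<a (Suc ?k). J ?k x)"
  define E where "E = space M - U"
  have U: "U \<in> sets M" using J_sets by (auto simp: U_def)
  have E: "E \<in> sets M" using U by (auto simp: E_def)
  have mE: "measure M E < e"
  proof -
    have "size k' / total \<le> size ?k / total"
      using size_mono total_bounds by (intro divide_right_mono) (auto simp: incseq_Suc_iff)
    then show ?thesis using k'(2) measure_rest[of ?k] by (simp add: E_def U_def)
  qed
  define L where "L p = level ?k (fst p) (snd p)" for p
  define Z where "Z = (SIGMA i:{1..2::nat}. {..<height ?k i})"
  have finZ: "finite Z" by (simp add: Z_def)
  have Ls: "L p \<in> sets M" if "p \<in> Z" for p
    using that level_sets by (auto simp: L_def Z_def)
  have Ld: "L p \<inter> L q = {}" if "p \<in> Z" "q \<in> Z" "p \<noteq> q" for p q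
  proof -
    have "(fst p, snd p) \<noteq> (fst q, snd q)" using that(3) by simp
    then show ?thesis unfolding L_def using that(1,2)
      by (intro level_disjoint) (auto simp: Z_def)
  qed
  have LU: "(\<Union>p\<in>Z. L p) = U"
    unfolding U_def level_Union[symmetric] by (force simp: Z_def L_def)
  have LX: "L p \<inter> E = {}" if "p \<in> Z" for p using that LU by (auto simp: E_def)
  \<comment> \<open>Levels that meet no core go to atom 1 by default, like the part outside the
    towers.\<close>
  define assign where "assign p = (if \<exists>s\<in>{1..m}. L p \<inter> K s \<noteq> {} then SOME s. s \<in> {1..m} \<and> L p \<inter> K s \<noteq> {} else 1)" for p
  have assign_in: "assign p \<in> {1..m}" for p
  proof (cases "\<exists>s\<in>{1..m}. L p \<inter> K s \<noteq> {}")
    case True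
    then have "\<exists>s. s \<in> {1..m} \<and> L p \<inter> K s \<noteq> {}" by blast
    then have "(SOME s. s \<in> {1..m} \<and> L p \<inter> K s \<noteq> {}) \<in> {1..m}" by (rule someI2_ex) simp
    then show ?thesis using True by (simp only: assign_def if_True)
  next
    case False then show ?thesis using m by (simp only: assign_def if_False) simp
  qed
  have assign_eq: "assign p = s" if p: "p \<in> Z" and s: "s \<in> {1..m}" "L p \<inter> K s \<noteq> {}" for p s
  proof -
    have ex: "\<exists>s. s \<in> {1..m} \<and> L p \<inter> K s \<noteq> {}" using s by blast
    have "t = s" if t: "t \<in> {1..m} \<and> L p \<inter> K t \<noteq> {}" for t
    proof (rule ccontr)
      assume ne: "t \<noteq> s"
      obtain x y where xy: "x \<in> L p" "x \<in> K t" "y \<in> L p" "y \<in> K s" using t s by blast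
      have "dist x y < 1 / scale k'"
        using xy p by (intro level_diam[of "snd p" k' "fst p"]) (auto simp: L_def Z_def)
      then show False using K(4)[of t s x y] t s ne xy k'(1) by simp
    qed
    then have "(SOME s. s \<in> {1..m} \<and> L p \<inter> K s \<noteq> {}) = s" using ex by (intro some_equality s conjI) auto
    moreover have "\<exists>s\<in>{1..m}. L p \<inter> K s \<noteq> {}" using s by blast
    ultimately show ?thesis by (simp only: assign_def if_True)
  qed
  define P' where "P' s = (\<Union>p\<in>{p \<in> Z. assign p = s}. L p) \<union> (if s = 1 then E else {})" for s
  have iff: "x \<in> P' u \<longleftrightarrow> (\<exists>p\<in>Z. x \<in> L p \<and> assign p = u) \<or> u = 1 \<and> x \<in> E" for x u
    unfolding P'_def by (cases "u = 1"; simp only: if_True if_False simp_thms; blast)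
  have P's: "P' s \<in> sets M" for s
    unfolding P'_def using finZ Ls E by (intro sets.Un sets.finite_UN) auto
  have P'd: "P' s \<inter> P' t = {}" if "s \<noteq> t" for s t
  proof -
    have "x \<notin> P' t" if x: "x \<in> P' s" for x
    proof
      assume x': "x \<in> P' t"
      show False
      proof (cases "x \<in> E")
        case True
        then have "s = 1" "t = 1" using x x' LX unfolding iff by blast+
        then show False using \<open>s \<noteq> t\<close> by simp
      next
        case False
        then obtain p q where pq: "p \<in> Z" "x \<in> L p" "assign p = s" "q \<in> Z" "x \<in> L q" "assign q = t"
          using x x' unfolding iff by blast
        then have "p = q" using Ld[of p q] by blast
        then show False using pq \<open>s \<noteq> t\<close> by simp
      qed
    qed
    then show ?thesis by blast
  qed
  have P'U: "(\<Union>s\<in>{1..m}. P' s) = space M"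
  proof (intro equalityI subsetI)
    fix x assume "x \<in> (\<Union>s\<in>{1..m}. P' s)"
    then show "x \<in> space M" using P's sets.sets_into_space by blast
  next
    fix x assume x: "x \<in> space M"
    show "x \<in> (\<Union>s\<in>{1..m}. P' s)"
    proof (cases "x \<in> U")
      case True
      then obtain p where "p \<in> Z" "x \<in> L p" using LU by blast
      then have "x \<in> P' (assign p)" unfolding iff by blast
      then show ?thesis using assign_in by blast
    next
      case False
      then have "x \<in> P' 1" using x by (simp add: P'_def E_def)
      then show ?thesis using m by (intro UN_I[of 1]) auto
    qed
  qed
  have fp': "finite_partition M m P'"
    unfolding finite_partition_def disjoint_family_on_def using P's P'd P'U by auto
  have dist: "partition_distance M m P P' < \<epsilon>"
  proof -
    let ?B = "E \<union> (\<Union>j\<in>{1..m}. P j - K j)"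
    have Bs: "(\<Union>j\<in>{1..m}. P j - K j) \<in> sets M"
      using finite_partition_sets[OF fp] K(2) by (intro sets.finite_UN) auto
    have "measure M ?B \<le> measure M E + measure M (\<Union>j\<in>{1..m}. P j - K j)"
      using E Bs by (intro measure_Un_le)
    also have "measure M (\<Union>j\<in>{1..m}. P j - K j) \<le> (\<Sum>j\<in>{1..m}. measure M (P j - K j))"
      using finite_partition_sets[OF fp] K(2) by (intro finite_measure_subadditive_finite) auto
    also have "\<dots> \<le> (\<Sum>j\<in>{1..m}. e)" using K(3) by (intro sum_mono less_imp_le) auto
    finally have B: "measure M ?B \<le> e + m * e" using mE by simp
    have sub: "(P i - P' i) \<union> (P' i - P i) \<subseteq> ?B" if i: "i \<in> {1..m}" for i
    proof
      fix x assume x: "x \<in> (P i - P' i) \<union> (P' i - P i)"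
      show "x \<in> ?B"
      proof (rule ccontr)
        assume nB: "x \<notin> ?B"
        have xs: "x \<in> space M" using x P's[of i] finite_partition_sets[OF fp i] sets.sets_into_space by blast
        then obtain j where j: "j \<in> {1..m}" "x \<in> P j" using fp unfolding finite_partition_def by blast
        then have xK: "x \<in> K j" using nB by blast
        have "x \<in> U" using nB xs by (auto simp: E_def)
        then obtain p where p: "p \<in> Z" "x \<in> L p" using LU by blast
        have "assign p = j" using xK p j by (intro assign_eq) auto
        then have xP': "x \<in> P' j" using p unfolding iff by blast
        show False
        proof (cases "i = j")
          case True then show False using x j xP' by blast
        next
          case False
          then have "x \<notin> P' i" using P'd[of i j] xP' by blast
          moreover have "x \<notin> P i"
            using fp i j False unfolding finite_partition_def disjoint_family_on_def by blast
          ultimately show False using x by blast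
        qed
      qed
    qed
    have "partition_distance M m P P' \<le> (\<Sum>i=1..m. e + m * e)"
      unfolding partition_distance_def
    proof (rule sum_mono)
      fix i assume "i \<in> {1..m}"
      then have "measure M ((P i - P' i) \<union> (P' i - P i)) \<le> measure M ?B"
        using sub E Bs by (intro finite_measure_mono) auto
      then show "measure M ((P i - P' i) \<union> (P' i - P i)) \<le> e + m * e" using B by simp
    qed
    also have "\<dots> = e * q" by (simp add: q_def algebra_simps)
    also have "\<dots> = \<epsilon> / 2" using q by (simp add: e_def)
    also have "\<dots> < \<epsilon>" using \<epsilon> by simp
    finally show ?thesis .
  qed
  define Bb where "Bb i = level ?k i 0" for i
  have TL: "tower_levels 2 T Bb (height ?k) = L ` Z"
  proof -
    have eq: "(T ^^ j) ` Bb i = L (i, j)" if "j < height ?k i" for i j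
      using level_funpow[OF that] by (simp add: Bb_def L_def)
    show ?thesis
    proof (intro equalityI subsetI)
      fix A assume "A \<in> tower_levels 2 T Bb (height ?k)"
      then obtain i j where ij: "i \<in> {1..2}" "j < height ?k i" "A = (T ^^ j) ` Bb i"
        unfolding tower_levels_def by blast
      then show "A \<in> L ` Z" using eq[OF ij(2)] by (intro image_eqI[of _ _ "(i, j)"]) (auto simp: Z_def)
    next
      fix A assume "A \<in> L ` Z"
      then obtain i j where ij: "i \<in> {1..2}" "j < height ?k i" "A = L (i, j)" by (auto simp: Z_def)
      then show "A \<in> tower_levels 2 T Bb (height ?k)"
        using eq[OF ij(2)] unfolding tower_levels_def by blast
    qed
  qed
  have rest: "space M - \<Union>(L ` Z) = E" using LU by (simp add: E_def)
  have part: "partition_on (space M) (insert E (L ` Z) - {{}})"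
    unfolding partition_on_def
  proof (intro conjI)
    have "U \<subseteq> space M" using U sets.sets_into_space by blast
    moreover have "\<Union>(insert E (L ` Z) - {{}}) = E \<union> (\<Union>p\<in>Z. L p)" by blast
    ultimately show "\<Union>(insert E (L ` Z) - {{}}) = space M" unfolding LU E_def by blast
    show "disjoint (insert E (L ` Z) - {{}})"
      unfolding disjoint_def
    proof (intro ballI impI)
      fix A B assume AB: "A \<in> insert E (L ` Z) - {{}}" "B \<in> insert E (L ` Z) - {{}}" "A \<noteq> B"
      show "A \<inter> B = {}"
      proof (cases "A = E \<or> B = E")
        case True
        then show ?thesis using AB LX by auto
      next
        case False
        then obtain p q where "p \<in> Z" "A = L p" "q \<in> Z" "B = L q" using AB by blast
        then show ?thesis using Ld[of p q] AB(3) by blast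
      qed
    qed
  qed simp
  have ref: "refines (space M) (insert E (L ` Z) - {{}}) (P' ` {1..m} - {{}})"
    unfolding refines_def
  proof (intro conjI ballI)
    fix A assume A: "A \<in> insert E (L ` Z) - {{}}"
    then consider "A = E" | p where "p \<in> Z" "A = L p" by blast
    then obtain s where "s \<in> {1..m}" "A \<subseteq> P' s"
    proof cases
      case 1
      then have "A \<subseteq> P' 1" by (simp add: P'_def)
      then show ?thesis using m that[of 1] by simp
    next
      case 2
      then have "A \<subseteq> P' (assign p)" using iff by blast
      then show ?thesis using that assign_in by blast
    qed
    then show "\<exists>Y\<in>P' ` {1..m} - {{}}. A \<subseteq> Y" using A by blast
  qed (use part finite_partition_partition_on[OF fp'] in auto)
  have "disjoint_family_on (\<lambda>(i, j). (T ^^ j) ` Bb i) (SIGMA i:{1..2}. {..<height ?k i})"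
    unfolding disjoint_family_on_def
  proof (intro ballI impI)
    fix p q assume pq: "p \<in> (SIGMA i:{1..2}. {..<height ?k i})" "q \<in> (SIGMA i:{1..2}. {..<height ?k i})" "p \<noteq> q"
    have eq: "(case z of (i, j) \<Rightarrow> (T ^^ j) ` Bb i) = L z" if "z \<in> (SIGMA i:{1..2}. {..<height ?k i})" for z
      using that level_funpow[of "snd z" ?k "fst z"] by (cases z) (simp add: Bb_def L_def)
    show "(case p of (i, j) \<Rightarrow> (T ^^ j) ` Bb i) \<inter> (case q of (i, j) \<Rightarrow> (T ^^ j) ` Bb i) = {}"
      unfolding eq[OF pq(1)] eq[OF pq(2)] using pq by (intro Ld) (auto simp: Z_def)
  qed
  moreover have "\<forall>i\<in>{1..2}. Bb i \<in> sets M \<and> 0 < height ?k i"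
    using level_sets[OF height_pos] height_pos by (simp add: Bb_def)
  ultimately show "\<exists>B h P'. (\<forall>i\<in>{1..2}. B i \<in> sets M \<and> 0 < h i) \<and> finite_partition M m P' \<and>
      disjoint_family_on (\<lambda>(i, j). (T ^^ j) ` B i) (SIGMA i:{1..2}. {..<h i}) \<and>
      partition_distance M m P P' < \<epsilon> \<and>
      refines (space M) (insert (space M - \<Union>(tower_levels 2 T B h)) (tower_levels 2 T B h) - {{}})
        (P' ` {1..m} - {{}})"
    using fp' dist ref by (intro exI[of _ Bb] exI[of _ "height ?k"] exI[of _ P']) (simp add: TL rest)
qed

end

section \<open>Cover numbers and rank one\<close>

locale partitioned_system = prob_space M for M :: "'a measure" +
  fixes T :: "'a \<Rightarrow> 'a" and m :: nat and P :: "nat \<Rightarrow> 'a set"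
  assumes mpt: "invertible_mpt M T" and part: "finite_partition M m P"
begin

section \<open>Names, balls and optimal covers\<close>

lemma funpow_space: "x \<in> space M \<Longrightarrow> (T ^^ k) x \<in> space M"
  using mpt by (induction k) (auto simp: invertible_mpt_def bij_betw_def)

lemma funpow_measurable [measurable]: "(T ^^ k) \<in> measurable M M"
  using mpt by (intro measurable_compose_n) (simp add: invertible_mpt_def)

lemma funpow_measure:
  assumes "A \<in> sets M"
  shows "measure M ((T ^^ k) -` A \<inter> space M) = measure M A"
proof (induction k)
  case 0
  show ?case using sets.sets_into_space[OF assms] by (simp add: Int_absorb2)
next
  case (Suc k)
  have s: "(T ^^ k) -` A \<inter> space M \<in> sets M" using assms by measurable
  have "(T ^^ Suc k) -` A \<inter> space M = T -` ((T ^^ k) -` A \<inter> space M) \<inter> space M"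
    using funpow_space[of _ 1] by (auto simp: funpow_swap1)
  moreover have "measure M (T -` ((T ^^ k) -` A \<inter> space M) \<inter> space M) = measure M ((T ^^ k) -` A \<inter> space M)"
    using mpt s unfolding invertible_mpt_def by blast
  ultimately show ?case using Suc by (simp only:)
qed

lemma itinerary_unique:
  assumes "i \<in> {1..m}" "(T ^^ k) x \<in> P i"
  shows "itinerary m P T x k = i"
  unfolding itinerary_def
proof (rule the_equality)
  fix j assume j: "j \<in> {1..m} \<and> (T ^^ k) x \<in> P j"
  show "j = i"
  proof (rule ccontr)
    assume "j \<noteq> i"
    then have "P j \<inter> P i = {}"
      using part assms j unfolding finite_partition_def by (intro disjoint_family_onD[of P "{1..m}"]) auto
    then show False using assms j by blast
  qed
qed (use assms in simp)

lemma itinerary_in: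
  assumes "x \<in> space M"
  shows "itinerary m P T x k \<in> {1..m}" "(T ^^ k) x \<in> P (itinerary m P T x k)"
proof -
  obtain i where "i \<in> {1..m}" "(T ^^ k) x \<in> P i"
    using funpow_space[OF assms, of k] part unfolding finite_partition_def by blast
  then show "itinerary m P T x k \<in> {1..m}" "(T ^^ k) x \<in> P (itinerary m P T x k)"
    using itinerary_unique[of i k x] by simp_all
qed

lemma itinerary_measurable: "{x \<in> space M. itinerary m P T x k = c} \<in> sets M"
proof (cases "c \<in> {1..m}")
  case True
  then have "{x \<in> space M. itinerary m P T x k = c} = (T ^^ k) -` P c \<inter> space M"
    using itinerary_in(2)[of _ k] itinerary_unique[OF True, of k] by blast
  moreover have "P c \<in> sets M" using True part by (simp add: finite_partition_def)
  ultimately show ?thesis by simp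
next
  case False
  then have "{x \<in> space M. itinerary m P T x k = c} = {}" using itinerary_in(1) by blast
  then show ?thesis by (simp only: sets.empty_sets)
qed

lemma hamming_ball_sets: "hamming_ball M m P T n \<epsilon> x \<in> sets M"
proof -
  let ?w = "itinerary m P T x"
  have [measurable]: "Measurable.pred M (\<lambda>y. ?w k = itinerary m P T y k)" for k
    unfolding pred_def using itinerary_measurable[of k "?w k"] by (simp add: eq_commute)
  have card: "real (card {k. k < n \<and> Q k}) = (\<Sum>k<n. if Q k then 1 else 0)" for Q
    by (simp add: sum.If_cases Int_def)
  have "(\<lambda>y. hamming_dist n ?w (itinerary m P T y)) \<in> borel_measurable M"
    unfolding hamming_dist_def card by measurable
  then show ?thesis unfolding hamming_ball_def by measurable
qed

text \<open>A ball depends only on the first \<open>n\<close> symbols of its centre. Hence all balls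
  together form a finite cover, and the \<open>LEAST\<close> in the cover number is
  attained.\<close>

lemma finite_balls: "finite (hamming_ball M m P T n \<epsilon> ` space M)"
proof -
  let ?F = "\<lambda>w. {y \<in> space M. hamming_dist n w (itinerary m P T y) < \<epsilon>}"
  have "hamming_ball M m P T n \<epsilon> x = ?F (restrict (itinerary m P T x) {..<n})" for x
  proof -
    have "{k. k < n \<and> itinerary m P T x k \<noteq> w k} = {k. k < n \<and> restrict (itinerary m P T x) {..<n} k \<noteq> w k}" for w
      by auto
    then show ?thesis by (simp add: hamming_ball_def hamming_dist_def)
  qed
  then have "hamming_ball M m P T n \<epsilon> ` space M \<subseteq> ?F ` (PiE {..<n} (\<lambda>_. {1..m}))"
  proof (intro subsetI)
    fix B assume "B \<in> hamming_ball M m P T n \<epsilon> ` space M"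
    then obtain x where x: "x \<in> space M" "B = hamming_ball M m P T n \<epsilon> x" by blast
    have "restrict (itinerary m P T x) {..<n} \<in> PiE {..<n} (\<lambda>_. {1..m})"
      using itinerary_in(1)[OF x(1)] unfolding restrict_PiE_iff by blast
    then show "B \<in> ?F ` (PiE {..<n} (\<lambda>_. {1..m}))"
      using x(2) \<open>\<And>x. hamming_ball M m P T n \<epsilon> x = ?F (restrict (itinerary m P T x) {..<n})\<close> by blast
  qed
  then show ?thesis by (rule finite_subset) (intro finite_imageI finite_PiE; simp)
qed

lemma in_own_ball: "0 < \<epsilon> \<Longrightarrow> x \<in> space M \<Longrightarrow> x \<in> hamming_ball M m P T n \<epsilon> x"
  by (simp add: hamming_ball_def hamming_dist_def)

lemma optimal_cover:
  assumes "0 < \<epsilon>"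
  obtains F where "F \<subseteq> hamming_ball M m P T n \<epsilon> ` space M" "finite F"
    "card F = hamming_cover_number M m P T n \<epsilon>" "measure M (\<Union>F) > 1 - \<epsilon>"
proof -
  let ?B = "hamming_ball M m P T n \<epsilon> ` space M"
  have "\<Union>?B = space M"
    using in_own_ball[OF assms] by (auto simp: hamming_ball_def)
  then have "measure M (\<Union>?B) > 1 - \<epsilon>" using assms prob_space by simp
  then have "\<exists>c F. F \<subseteq> ?B \<and> finite F \<and> card F = c \<and> measure M (\<Union>F) > 1 - \<epsilon>"
    using finite_balls by blast
  then have "\<exists>F. F \<subseteq> ?B \<and> finite F \<and> card F = hamming_cover_number M m P T n \<epsilon> \<and> measure M (\<Union>F) > 1 - \<epsilon>"
    unfolding hamming_cover_number_def by (rule LeastI_ex)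
  then show ?thesis using that by blast
qed

lemma hamming_cover_number_le:
  assumes "F \<subseteq> hamming_ball M m P T n \<epsilon> ` space M" "finite F" "measure M (\<Union>F) > 1 - \<epsilon>"
  shows "hamming_cover_number M m P T n \<epsilon> \<le> card F"
  unfolding hamming_cover_number_def using assms by (intro Least_le) blast

text \<open>A cover misses at most \<epsilon> of \<open>Y\<close>, and each of its balls catches at
  most \<kappa> of it.\<close>

lemma hamming_cover_number_ge:
  fixes \<kappa> :: real
  assumes "0 < \<epsilon>" and Y: "Y \<in> sets M"
    and small: "\<And>x. x \<in> space M \<Longrightarrow> measure M (Y \<inter> hamming_ball M m P T n \<epsilon> x) \<le> \<kappa>"
  shows "measure M Y - \<epsilon> \<le> hamming_cover_number M m P T n \<epsilon> * \<kappa>"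
proof -
  obtain F where F: "F \<subseteq> hamming_ball M m P T n \<epsilon> ` space M" "finite F"
    "card F = hamming_cover_number M m P T n \<epsilon>" "measure M (\<Union>F) > 1 - \<epsilon>"
    using optimal_cover[OF assms(1)] by blast
  have Fs: "B \<in> sets M" if "B \<in> F" for B using F(1) that hamming_ball_sets by auto
  have UF: "\<Union>F \<in> sets M" using Fs F(2) by (intro sets.finite_Union) auto
  have YF: "(\<Union>B\<in>F. Y \<inter> B) \<in> sets M" using Y Fs F(2) by (intro sets.finite_UN) auto
  have "measure M Y \<le> measure M ((\<Union>B\<in>F. Y \<inter> B) \<union> (space M - \<Union>F))"
    using YF UF sets.sets_into_space[OF Y] by (intro finite_measure_mono) auto
  also have "\<dots> \<le> measure M (\<Union>B\<in>F. Y \<inter> B) + measure M (space M - \<Union>F)"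
    using YF UF by (intro measure_Un_le) auto
  also have "measure M (space M - \<Union>F) \<le> \<epsilon>" using prob_compl[OF UF] F(4) by simp
  also have "measure M (\<Union>B\<in>F. Y \<inter> B) \<le> (\<Sum>B\<in>F. measure M (Y \<inter> B))"
    using Y Fs F(2) by (intro finite_measure_subadditive_finite) auto
  also have "\<dots> \<le> (\<Sum>B\<in>F. \<kappa>)" using F(1) small by (intro sum_mono) auto
  finally show ?thesis using F(3) by simp
qed

end

text \<open>Atoms are numbered from 1, so quotient and remainder of \<open>s - 1\<close> recover the
  pair of atoms that \<open>s\<close> stands for.\<close>

lemma finite_partition_join:
  assumes P: "finite_partition M m P" and Q: "finite_partition M q Q"
  defines "R \<equiv> \<lambda>s. P (Suc ((s - 1) div q)) \<inter> Q (Suc ((s - 1) mod q))"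
  shows "finite_partition M (m * q) R"
    and "\<And>s. s \<in> {1..m * q} \<Longrightarrow> Suc ((s - 1) div q) \<in> {1..m} \<and> Suc ((s - 1) mod q) \<in> {1..q}"
proof -
  show in_range: "Suc ((s - 1) div q) \<in> {1..m} \<and> Suc ((s - 1) mod q) \<in> {1..q}" if "s \<in> {1..m * q}" for s
  proof -
    have lt: "s - 1 < m * q" using that by auto
    then have "0 < q" by (cases q) auto
    moreover have "(s - 1) div q < m" using lt by (simp add: less_mult_imp_div_less)
    ultimately show ?thesis by (simp add: Suc_le_eq)
  qed
  have "R s \<inter> R t = {}" if st: "s \<in> {1..m * q}" "t \<in> {1..m * q}" "s \<noteq> t" for s t
  proof (cases "(s - 1) div q = (t - 1) div q")
    case True
    have "s - 1 \<noteq> t - 1" using st by auto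
    then have "(s - 1) mod q \<noteq> (t - 1) mod q" using True by (metis div_mult_mod_eq)
    then have "Q (Suc ((s - 1) mod q)) \<inter> Q (Suc ((t - 1) mod q)) = {}"
      using in_range[OF st(1)] in_range[OF st(2)] Q unfolding finite_partition_def
      by (intro disjoint_family_onD[of Q "{1..q}"]) auto
    then show ?thesis by (auto simp: R_def)
  next
    case False
    then have "P (Suc ((s - 1) div q)) \<inter> P (Suc ((t - 1) div q)) = {}"
      using in_range[OF st(1)] in_range[OF st(2)] P unfolding finite_partition_def
      by (intro disjoint_family_onD[of P "{1..m}"]) auto
    then show ?thesis by (auto simp: R_def)
  qed
  moreover have "R s \<in> sets M" if "s \<in> {1..m * q}" for s
    using in_range[OF that] P Q by (auto simp: R_def finite_partition_def)
  moreover have "(\<Union>s\<in>{1..m * q}. R s) = space M"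
  proof (intro equalityI subsetI)
    fix x assume "x \<in> (\<Union>s\<in>{1..m * q}. R s)"
    then show "x \<in> space M" using calculation(2) sets.sets_into_space by blast
  next
    fix x assume "x \<in> space M"
    then have "x \<in> (\<Union>i\<in>{1..m}. P i)" "x \<in> (\<Union>j\<in>{1..q}. Q j)"
      using P Q by (simp_all add: finite_partition_def)
    then obtain i j where "i \<in> {1..m}" "x \<in> P i" "j \<in> {1..q}" "x \<in> Q j" by blast
    then obtain i' j' where ij: "x \<in> P (Suc i')" "x \<in> Q (Suc j')" "i' < m" "j' < q"
      by (cases i; cases j) auto
    have "i' * q + j' < Suc i' * q" using ij by simp
    also have "\<dots> \<le> m * q" using ij by (intro mult_le_mono1) simp
    finally have "Suc (i' * q + j') \<in> {1..m * q}" by simp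
    moreover have "x \<in> R (Suc (i' * q + j'))" using ij by (simp add: R_def)
    ultimately show "x \<in> (\<Union>s\<in>{1..m * q}. R s)" by blast
  qed
  ultimately show "finite_partition M (m * q) R"
    by (simp add: finite_partition_def disjoint_family_on_def)
qed

text \<open>For a tower of height \<open>h\<close> filling most of the space, names of length \<open>n = h div K\<close> are
  determined, up to small Hamming distance, by the level at which they start.\<close>

theorem (in partitioned_system) rank_one_cover_number:
  assumes rank: "rank_at_most 1 M T" and \<epsilon>: "0 < \<epsilon>" "\<epsilon> \<le> 1"
    and fine: "\<And>\<eta>. 0 < \<eta> \<Longrightarrow> \<exists>q Q. finite_partition M q Q \<and> (\<forall>i\<in>{1..q}. measure M (Q i) \<le> \<eta>)"
  obtains C :: nat where "\<And>H. \<exists>n>H. hamming_cover_number M m P T n \<epsilon> \<le> C * n"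
proof -
  \<comment> \<open>Names that start in the top \<open>n\<close> levels leave the tower and are
    given up. With \<open>n = h div K\<close> these levels have measure at most
    \<open>1 / K \<le> \<epsilon> / 4\<close>.\<close>
  define K where "K = nat \<lceil>4 / \<epsilon>\<rceil>"
  have K: "4 / \<epsilon> \<le> K" unfolding K_def by (rule real_nat_ceiling_ge)
  moreover have "4 \<le> 4 / \<epsilon>" using \<epsilon> by (simp add: pos_le_divide_eq)
  ultimately have "0 < real K" by linarith
  then have K0: "0 < K" by simp
  have "\<exists>n>H. hamming_cover_number M m P T n \<epsilon> \<le> 2 * K * n" for H
  proof -
    \<comment> \<open>The first bound leaves measure at most \<open>\<epsilon> / 16\<close> to
      points with bad names. The second makes single levels so small that the tower has height at
      least \<open>K * (H + 1)\<close>, whence \<open>n > H\<close>.\<close>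
    define \<eta> where "\<eta> = min (\<epsilon> * \<epsilon> / 32) (1 / (8 * K * (H + 1)))"
    have \<eta>: "0 < \<eta>" "\<eta> \<le> \<epsilon> * \<epsilon> / 32" "\<eta> \<le> 1 / (8 * K * (H + 1))"
      using \<epsilon> K0 by (auto simp: \<eta>_def intro: add_pos_nonneg)
    have "\<epsilon> * \<epsilon> \<le> \<epsilon> * 1" using \<epsilon> by (intro mult_left_mono) auto
    then have \<eta>\<epsilon>: "\<eta> \<le> \<epsilon> / 32" using \<eta>(2) by simp
    \<comment> \<open>Joining \<open>P\<close> with a fine partition forces the tower to be tall;
      \<open>P\<close> alone might be approximated by a low tower with large levels.\<close>
    obtain q Q where Q: "finite_partition M q Q" "\<And>i. i \<in> {1..q} \<Longrightarrow> measure M (Q i) \<le> \<eta>"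
      using fine[OF \<eta>(1)] by blast
    define N where "N = m * q"
    define R where "R = (\<lambda>s. P (Suc ((s - 1) div q)) \<inter> Q (Suc ((s - 1) mod q)))"
    have R: "finite_partition M N R" unfolding R_def N_def by (rule finite_partition_join[OF part Q(1)])
    have Ridx: "Suc ((s - 1) div q) \<in> {1..m} \<and> Suc ((s - 1) mod q) \<in> {1..q}" if "s \<in> {1..N}" for s
      using finite_partition_join(2)[OF part Q(1)] that by (simp add: N_def)
    have Rs: "R s \<in> sets M" if "s \<in> {1..N}" for s using R that by (simp add: finite_partition_def)
    have Rsmall: "measure M (R s) \<le> \<eta>" if s: "s \<in> {1..N}" for s
    proof -
      have "measure M (R s) \<le> measure M (Q (Suc ((s - 1) mod q)))"
        using Ridx[OF s] Q(1) by (intro finite_measure_mono) (auto simp: R_def finite_partition_def)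
      then show ?thesis using Q(2) Ridx[OF s] by fastforce
    qed
    obtain B0 h0 R' where T1: "\<forall>i\<in>{1..1}. B0 i \<in> sets M \<and> 0 < (h0 i :: nat)" "finite_partition M N R'"
      "disjoint_family_on (\<lambda>(i, j). (T ^^ j) ` B0 i) (SIGMA i:{1..1}. {..<h0 i})"
      "partition_distance M N R R' < \<eta>"
      "refines (space M) (insert (space M - \<Union>(tower_levels 1 T B0 h0)) (tower_levels 1 T B0 h0) - {{}})
        (R' ` {1..N} - {{}})"
      using rank[unfolded rank_at_most_def, rule_format, OF R \<eta>(1)] by blast
    define B h where "B = B0 1" and "h = h0 1"
    have Bs: "B \<in> sets M" and h0: "0 < h" using T1(1) by (auto simp: B_def h_def)
    define V where "V j = (T ^^ j) ` B" for j
    have Vs: "V j \<in> sets M" and VB: "measure M (V j) = measure M B" for j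
      using invertible_mpt_image_funpow[OF mpt Bs] by (auto simp: V_def)
    have TL: "tower_levels 1 T B0 h0 = V ` {..<h}"
      by (auto simp: tower_levels_def V_def B_def h_def)
    have Vd: "disjoint_family_on V {..<h}"
      unfolding disjoint_family_on_def
    proof (intro ballI impI)
      fix i j assume "i \<in> {..<h}" "j \<in> {..<h}" "i \<noteq> j"
      then show "V i \<inter> V j = {}"
        using disjoint_family_onD[OF T1(3), of "(1, i)" "(1, j)"] by (auto simp: V_def B_def h_def)
    qed
    have VU: "(\<Union>j<h'. V j) \<in> sets M" "measure M (\<Union>j<h'. V j) = h' * measure M B" if "h' \<le> h" for h'
    proof -
      show "(\<Union>j<h'. V j) \<in> sets M" using Vs by auto
      have "disjoint_family_on V {..<h'}" by (rule disjoint_family_on_mono[OF _ Vd]) (use that in auto)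
      then have "measure M (\<Union>j<h'. V j) = (\<Sum>j<h'. measure M (V j))"
        using Vs by (intro finite_measure_finite_Union) auto
      then show "measure M (\<Union>j<h'. V j) = h' * measure M B" by (simp add: VB)
    qed
    define E where "E = space M - (\<Union>j<h. V j)"
    have ref: "\<exists>s\<in>{1..N}. A \<subseteq> R' s" if "A \<in> insert E (V ` {..<h})" "A \<noteq> {}" for A
      using T1(5) that unfolding refines_def TL E_def by blast
    have R's: "R' s \<in> sets M" if "s \<in> {1..N}" for s using T1(2) that by (simp add: finite_partition_def)
    have diff: "measure M ((R s - R' s) \<union> (R' s - R s)) \<le> \<eta>" if s: "s \<in> {1..N}" for s
    proof -
      have "measure M ((R s - R' s) \<union> (R' s - R s)) \<le> partition_distance M N R R'"
        unfolding partition_distance_def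
        using member_le_sum[OF s, of "\<lambda>s. measure M ((R s - R' s) \<union> (R' s - R s))"] by simp
      then show ?thesis using T1(4) by simp
    qed
    have R'small: "measure M (R' s) \<le> 2 * \<eta>" if s: "s \<in> {1..N}" for s
    proof -
      have "measure M (R' s) \<le> measure M (R s \<union> ((R s - R' s) \<union> (R' s - R s)))"
        using Rs[OF s] R's[OF s] by (intro finite_measure_mono) auto
      also have "\<dots> \<le> measure M (R s) + measure M ((R s - R' s) \<union> (R' s - R s))"
        using Rs[OF s] R's[OF s] by (intro measure_Un_le) auto
      finally show ?thesis using Rsmall[OF s] diff[OF s] by simp
    qed
    have small: "measure M A \<le> 2 * \<eta>" if A: "A \<in> insert E (V ` {..<h})" for A
    proof (cases "A = {}")
      case True then show ?thesis using \<eta> by simp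
    next
      case False
      then obtain s where "s \<in> {1..N}" "A \<subseteq> R' s" using ref A by blast
      then show ?thesis using R'small[of s] R's[of s] finite_measure_mono[of A "R' s"] by simp
    qed
    have mE: "measure M E \<le> 2 * \<eta>" and mB: "measure M B \<le> 2 * \<eta>"
      using small[of E] small[of "V 0"] h0 VB[of 0] by auto
    have hB: "h * measure M B = 1 - measure M E"
      using VU[of h] by (simp add: E_def prob_compl)
    define n where "n = h div K"
    have hbig: "K * (H + 1) \<le> h"
    proof -
      define c where "c = real K * (real H + 1)"
      have c: "0 < c" using K0 by (simp add: c_def)
      have \<eta>c: "\<eta> \<le> 1 / (8 * c)" using \<eta>(3) by (simp add: c_def algebra_simps)
      have "1 / 2 \<le> 1 - 2 * \<eta>" using \<eta>\<epsilon> \<epsilon> by simp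
      also have "\<dots> \<le> h * measure M B" using mE hB by simp
      also have "\<dots> \<le> h * (2 * \<eta>)" using mB by (intro mult_left_mono) auto
      also have "\<dots> \<le> h * (2 * (1 / (8 * c)))" using \<eta>c by (intro mult_left_mono) auto
      also have "\<dots> = h / (4 * c)" by simp
      finally have "2 * c \<le> h" using c by (simp add: pos_le_divide_eq)
      then have "real K * (real H + 1) \<le> h" using c by (simp add: c_def)
      then have "real (K * (H + 1)) \<le> real h" by (simp add: distrib_left)
      then show ?thesis by (simp only: of_nat_le_iff)
    qed
    have nH: "H < n"
    proof -
      have "H + 1 = K * (H + 1) div K" using K0 by simp
      also have "\<dots> \<le> n" unfolding n_def by (rule div_le_mono[OF hbig])
      finally show ?thesis by simp
    qed
    have nh: "n \<le> h" "h \<le> 2 * K * n"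
    proof -
      show "n \<le> h" by (simp add: n_def)
      have "h < K + K * n" unfolding n_def by (rule dividend_less_times_div[OF K0])
      also have "\<dots> \<le> K * n + K * n" using nH by simp
      finally show "h \<le> 2 * K * n" by simp
    qed
    have nB: "n * measure M B \<le> \<epsilon> / 4"
    proof -
      have "real K * n \<le> h" unfolding n_def by (metis of_nat_le_iff of_nat_mult times_div_less_eq_dividend)
      then have "real K * n * measure M B \<le> h * measure M B" by (intro mult_right_mono) auto
      also have "\<dots> \<le> 1" using hB by simp
      finally have "n * measure M B \<le> 1 / K" using K0 by (simp add: field_simps)
      also have "\<dots> \<le> \<epsilon> / 4" using K K0 \<epsilon> by (simp add: field_simps)
      finally show ?thesis .
    qed
    \<comment> \<open>Outside \<open>Bad\<close> a point has the same index in \<open>R\<close> and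
      in \<open>R'\<close>, and the index in \<open>R'\<close> is determined by the level.\<close>
    define Bad where "Bad = (\<Union>s\<in>{1..N}. R s - R' s)"
    have Bad: "Bad \<in> sets M" unfolding Bad_def using Rs R's by (intro sets.finite_UN) auto
    have mBad: "measure M Bad \<le> \<eta>"
    proof -
      have "measure M Bad \<le> (\<Sum>s=1..N. measure M (R s - R' s))"
        unfolding Bad_def using Rs R's by (intro finite_measure_subadditive_finite) auto
      also have "\<dots> \<le> partition_distance M N R R'"
        unfolding partition_distance_def using Rs R's by (intro sum_mono finite_measure_mono) auto
      finally show ?thesis using T1(4) by simp
    qed
    define cnt where "cnt x = (\<Sum>i<n. indicator ((T ^^ i) -` Bad \<inter> space M) x :: real)" for x
    have pre[measurable]: "(T ^^ i) -` Bad \<inter> space M \<in> sets M" for i using Bad by measurable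
    have ind_int: "integrable M (indicat_real ((T ^^ i) -` Bad \<inter> space M))" for i
      by (intro integrable_real_indicator) (auto simp: less_top[symmetric])
    then have cnt_int: "integrable M cnt" unfolding cnt_def
      by (intro Bochner_Integration.integrable_sum)
    have cnt_nonneg: "0 \<le> cnt x" for x unfolding cnt_def by (intro sum_nonneg) simp
    \<comment> \<open>Half of the allowed proportion \<epsilon>, since two names with their own bad
      times are compared; Markov's inequality bounds the measure.\<close>
    define BadN where "BadN = {x \<in> space M. \<epsilon> * n / 2 \<le> cnt x}"
    have BadN: "BadN \<in> sets M" unfolding BadN_def using cnt_int by measurable
    have n0: "0 < n" using nH by simp
    have mBadN: "measure M BadN \<le> \<epsilon> / 16"
    proof -
      have "integral\<^sup>L M cnt = (\<Sum>i<n. measure M ((T ^^ i) -` Bad \<inter> space M))"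
        unfolding cnt_def by (subst Bochner_Integration.integral_sum) (auto intro: ind_int)
      also have "\<dots> = n * measure M Bad" using funpow_measure[OF Bad] by simp
      finally have int: "integral\<^sup>L M cnt = n * measure M Bad" .
      have "measure M BadN \<le> integral\<^sup>L M cnt / (\<epsilon> * n / 2)"
        unfolding BadN_def using cnt_int \<epsilon> n0
        by (intro integral_Markov_inequality_measure[where A = "{}"]) (auto simp: cnt_nonneg)
      also have "\<dots> = 2 * measure M Bad / \<epsilon>" unfolding int using n0 \<epsilon> by (simp add: field_simps)
      also have "\<dots> \<le> 2 * (\<epsilon> * \<epsilon> / 32) / \<epsilon>"
        using mBad \<eta>(2) \<epsilon> by (intro divide_right_mono) auto
      also have "\<dots> = \<epsilon> / 16" using \<epsilon> by simp
      finally show ?thesis .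
    qed
    define D where "D = (\<Union>j<h - n. V j)"
    have D: "D \<in> sets M" using VU(1)[of "h - n"] by (simp add: D_def)
    have mD: "measure M D = h * measure M B - n * measure M B"
      using VU(2)[of "h - n"] nh by (simp add: D_def of_nat_diff algebra_simps)
    define G where "G = D - BadN"
    have "measure M D \<le> measure M G + measure M BadN"
    proof -
      have "measure M D \<le> measure M (G \<union> BadN)" using D BadN by (intro finite_measure_mono) (auto simp: G_def)
      also have "\<dots> \<le> measure M G + measure M BadN" using D BadN by (intro measure_Un_le) (auto simp: G_def)
      finally show ?thesis .
    qed
    then have mG: "1 - \<epsilon> < measure M G"
      using mD hB mE nB mBadN \<eta>\<epsilon> \<epsilon> by simp
    have Gspace: "x \<in> space M" if "x \<in> G" for x
      using that D sets.sets_into_space by (auto simp: G_def)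
    have count: "card {i. i < n \<and> (T ^^ i) x \<in> Bad} < \<epsilon> * n / 2" if "x \<in> G" for x
    proof -
      have "cnt x = real (card {i. i < n \<and> (T ^^ i) x \<in> Bad})"
        using Gspace[OF that] by (simp add: cnt_def indicator_def sum.If_cases Int_def)
      then show ?thesis using that Gspace[OF that] by (auto simp: G_def BadN_def)
    qed
    have close: "hamming_dist n (itinerary m P T x) (itinerary m P T y) < \<epsilon>"
      if xy: "x \<in> G" "y \<in> G" "x \<in> V j" "y \<in> V j" and j: "j < h - n" for x y j
    proof -
      have same: "itinerary m P T x i = itinerary m P T y i"
        if i: "i < n" and good: "(T ^^ i) x \<notin> Bad" "(T ^^ i) y \<notin> Bad" for i
      proof -
        have inV: "(T ^^ i) z \<in> V (i + j)" if "z \<in> V j" for z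
          using that by (auto simp: V_def funpow_add)
        have "V (i + j) \<noteq> {}" using inV xy by blast
        then obtain s where s: "s \<in> {1..N}" "V (i + j) \<subseteq> R' s"
        proof -
          have "i + j < h" using i j by simp
          then have "V (i + j) \<in> insert E (V ` {..<h})" by blast
          from ref[OF this \<open>V (i + j) \<noteq> {}\<close>] show ?thesis using that by blast
        qed
        have inR: "(T ^^ i) z \<in> R s" if z: "z \<in> G" "z \<in> V j" "(T ^^ i) z \<notin> Bad" for z
        proof -
          obtain t where t: "t \<in> {1..N}" "(T ^^ i) z \<in> R t"
            using funpow_space[OF Gspace[OF z(1)], of i] R unfolding finite_partition_def by blast
          then have "(T ^^ i) z \<in> R' t" using z(3) unfolding Bad_def by blast
          moreover have "(T ^^ i) z \<in> R' s" using inV[OF z(2)] s by blast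
          ultimately have "t = s" using T1(2) s t unfolding finite_partition_def disjoint_family_on_def by blast
          then show ?thesis using t by simp
        qed
        have "itinerary m P T z i = Suc ((s - 1) div q)" if "z \<in> G" "z \<in> V j" "(T ^^ i) z \<notin> Bad" for z
          using inR[OF that] Ridx[OF s(1)] by (intro itinerary_unique) (auto simp: R_def)
        then show ?thesis using xy good by simp
      qed
      have "{k. k < n \<and> itinerary m P T x k \<noteq> itinerary m P T y k}
          \<subseteq> {i. i < n \<and> (T ^^ i) x \<in> Bad} \<union> {i. i < n \<and> (T ^^ i) y \<in> Bad}" using same by blast
      then have "card {k. k < n \<and> itinerary m P T x k \<noteq> itinerary m P T y k}
          \<le> card ({i. i < n \<and> (T ^^ i) x \<in> Bad} \<union> {i. i < n \<and> (T ^^ i) y \<in> Bad})" by (intro card_mono) auto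
      also have "\<dots> \<le> card {i. i < n \<and> (T ^^ i) x \<in> Bad} + card {i. i < n \<and> (T ^^ i) y \<in> Bad}" by (rule card_Un_le)
      finally have "real (card {k. k < n \<and> itinerary m P T x k \<noteq> itinerary m P T y k}) < \<epsilon> * n"
        using count[OF xy(1)] count[OF xy(2)] by linarith
      then show ?thesis using n0 by (simp add: hamming_dist_def pos_divide_less_eq)
    qed
    define rep where "rep j = (SOME x. x \<in> V j \<inter> G)" for j
    define I where "I = {j. j < h - n \<and> V j \<inter> G \<noteq> {}}"
    have rep: "rep j \<in> V j" "rep j \<in> G" if "j \<in> I" for j
      using that some_in_eq[of "V j \<inter> G"] by (auto simp: I_def rep_def)
    define F where "F = (\<lambda>j. hamming_ball M m P T n \<epsilon> (rep j)) ` I"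
    have finI: "finite I" by (simp add: I_def)
    have sub: "F \<subseteq> hamming_ball M m P T n \<epsilon> ` space M" using rep Gspace by (auto simp: F_def)
    have "G \<subseteq> \<Union>F"
    proof
      fix y assume y: "y \<in> G"
      then obtain j where j: "j < h - n" "y \<in> V j" by (auto simp: G_def D_def)
      then have jI: "j \<in> I" using y by (auto simp: I_def)
      have "y \<in> hamming_ball M m P T n \<epsilon> (rep j)"
        using close[OF rep(2)[OF jI] y rep(1)[OF jI] j(2,1)] Gspace[OF y] by (simp add: hamming_ball_def)
      then show "y \<in> \<Union>F" using jI by (auto simp: F_def)
    qed
    moreover have "\<Union>F \<in> sets M" using finI hamming_ball_sets by (auto simp: F_def)
    ultimately have "measure M G \<le> measure M (\<Union>F)" by (intro finite_measure_mono)
    then have "hamming_cover_number M m P T n \<epsilon> \<le> card F"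
      using mG finI sub by (intro hamming_cover_number_le) (auto simp: F_def)
    also have "card F \<le> card I" unfolding F_def by (rule card_image_le[OF finI])
    also have "\<dots> \<le> card {..<h}" by (intro card_mono) (auto simp: I_def)
    also have "\<dots> \<le> 2 * K * n" using nh(2) by simp
    finally show ?thesis using nH by blast
  qed
  then show ?thesis using that[of "2 * K"] by blast
qed

section \<open>The code\<close>

text \<open>The digits of a uniformly chosen number below \<open>A ^ m\<close> are independent and
  uniform; this is the product rule for expectations, not normalised.\<close>

lemma sum_prod_digits:
  fixes g :: "nat \<Rightarrow> nat \<Rightarrow> real"
  assumes "0 < A"
  shows "(\<Sum>v<A ^ m. \<Prod>j<m. g j (v div A ^ j mod A)) = (\<Prod>j<m. \<Sum>d<A. g j d)"
proof (induction m)
  case 0 show ?case by simp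
next
  case (Suc m)
  let ?f = "\<lambda>v. \<Prod>j<Suc m. g j (v div A ^ j mod A)"
  have split: "?f (d * A ^ m + u) = (\<Prod>j<m. g j (u div A ^ j mod A)) * g m d" if d: "d < A" and u: "u < A ^ m" for d u
  proof -
    have "(d * A ^ m + u) div A ^ j mod A = u div A ^ j mod A" if j: "j < m" for j
    proof -
      have "A ^ m = A ^ j * (A * A ^ (m - Suc j))"
        using j by (metis Suc_diff_Suc power_Suc power_add le_add_diff_inverse less_imp_le)
      then have eq: "d * A ^ m + u = u + A ^ j * (A * (d * A ^ (m - Suc j)))" by simp
      have "(d * A ^ m + u) div A ^ j = A * (d * A ^ (m - Suc j)) + u div A ^ j"
        unfolding eq using assms by (subst div_mult_self2) auto
      then show ?thesis by simp
    qed
    then have "(\<Prod>j<m. g j ((d * A ^ m + u) div A ^ j mod A)) = (\<Prod>j<m. g j (u div A ^ j mod A))"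
      by (intro prod.cong) auto
    moreover have "(d * A ^ m + u) div A ^ m mod A = d" using d u assms by simp
    ultimately show ?thesis by simp
  qed
  have "sum ?f {..<A ^ Suc m} = (\<Sum>d<A. sum ?f {d * A ^ m..<d * A ^ m + A ^ m})"
    using sum.nat_group[of ?f "A ^ m" A] by simp
  also have "\<dots> = (\<Sum>d<A. \<Sum>u<A ^ m. ?f (d * A ^ m + u))"
  proof (rule sum.cong[OF refl])
    fix d
    show "sum ?f {d * A ^ m..<d * A ^ m + A ^ m} = (\<Sum>u<A ^ m. ?f (d * A ^ m + u))"
      by (rule sum.reindex_bij_witness[of _ "\<lambda>u. d * A ^ m + u" "\<lambda>v. v - d * A ^ m"]) auto
  qed
  also have "\<dots> = (\<Sum>d<A. \<Sum>u<A ^ m. (\<Prod>j<m. g j (u div A ^ j mod A)) * g m d)"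
    using split by (intro sum.cong refl) auto
  also have "\<dots> = (\<Prod>j<m. \<Sum>d<A. g j d) * (\<Sum>d<A. g m d)"
    using Suc by (simp flip: sum_distrib_right sum_distrib_left)
  finally show ?case by simp
qed

lemma exp_minus_le_half:
  fixes u :: real
  assumes "0 \<le> u" "u \<le> 1"
  shows "exp (- u) \<le> 1 - u / 2"
proof -
  have "u * u \<le> u * 1" using assms by (intro mult_left_mono)
  then have "1 \<le> (1 - u / 2) * (1 + u)" by (simp add: algebra_simps)
  also have "\<dots> \<le> (1 - u / 2) * exp u" using assms by (intro mult_left_mono) auto
  finally show ?thesis by (simp add: exp_minus field_simps)
qed

lemma card_bij_filter:
  assumes "bij_betw f A B"
  shows "card {x \<in> A. Q (f x)} = card {y \<in> B. Q y}"
  by (rule bij_betw_same_card[of f]) (use assms in \<open>auto simp: bij_betw_def inj_on_def\<close>)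

text \<open>Used for the place of the short word that is read at time \<open>t\<close>: as the shift
  \<open>d\<close> varies, every place occurs once.\<close>

lemma reflect_mod_bij:
  fixes A :: nat
  assumes "A \<le> t"
  shows "bij_betw (\<lambda>d. (t - d) mod A) {..<A} {..<A}"
proof -
  have inj: "inj_on (\<lambda>d. (t - d) mod A) {..<A}"
  proof (rule linorder_inj_onI')
    fix d d' assume "d \<in> {..<A}" "d' \<in> {..<A}" "d < d'"
    show "(t - d) mod A \<noteq> (t - d') mod A"
    proof
      assume "(t - d) mod A = (t - d') mod A"
      then have "A dvd (t - d) - (t - d')" by (rule mod_eq_dvd_iff_nat[THEN iffD1, rotated]) (use \<open>d < d'\<close> in simp)
      moreover have "(t - d) - (t - d') = d' - d" using \<open>d' \<in> _\<close> \<open>d < d'\<close> assms by simp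
      ultimately have "A \<le> d' - d" using \<open>d < d'\<close> by (auto dest: dvd_imp_le)
      then show False using \<open>d' \<in> _\<close> by auto
    qed
  qed
  moreover have "(\<lambda>d. (t - d) mod A) ` {..<A} \<subseteq> {..<A}"
    by (cases "A = 0") auto
  ultimately show ?thesis
    by (simp add: bij_betw_def endo_inj_surj)
qed

section \<open>Letters, words and their distances\<close>

context two_towers
begin

text \<open>The symbols are taken from the first column; by \<open>sym_column\<close> all
  \<open>r k\<close> columns carry the same word. Spacers read \<open>False\<close>, as in
  \<open>sym\<close>.\<close>

definition letter :: "nat \<Rightarrow> nat \<Rightarrow> nat \<Rightarrow> bool" where
  "letter k d t \<longleftrightarrow> d \<le> t \<and> t < d + reps k * a k \<and> sym k ((t - d) mod a k)"

definition letter_dist :: "nat \<Rightarrow> nat \<Rightarrow> nat \<Rightarrow> nat" where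
  "letter_dist k d d' = card {t. t < l k \<and> letter k d t \<noteq> letter k d' t}"

lemma sym_column: "c < r k \<Longrightarrow> u < a k \<Longrightarrow> sym k (c * a k + u) = sym k u"
proof (cases k)
  case 0
  moreover assume "c < r k"
  ultimately show ?thesis using init by simp
next
  case (Suc k')
  assume c: "c < r k" and u: "u < a k"
  show ?thesis using orig_A(2)[of u k' c] orig_A(2)[of u k' 0] c u r_pos[of "Suc k'"] by (simp add: Suc)
qed

lemma sym_prefix: "u < a (Suc k) \<Longrightarrow> sym (Suc k) u = sym k u"
  using orig_A(2)[of u k 0] r_pos[of "Suc k"] by simp

text \<open>The run number contributes a multiple of \<open>a k ^ m k\<close>, which the
  \<open>m k\<close> lowest digits do not see.\<close>

lemma digit_word:
  assumes "j < m k"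
  shows "digit k ((c * a k ^ m k + v) * m k + j) = v div a k ^ j mod a k"
proof -
  have "a k ^ m k = a k ^ j * (a k * a k ^ (m k - Suc j))"
    using assms by (metis Suc_diff_Suc power_Suc power_add le_add_diff_inverse less_imp_le)
  then have eq: "c * a k ^ m k + v = v + a k ^ j * (a k * (c * a k ^ (m k - Suc j)))" by simp
  have "(c * a k ^ m k + v) div a k ^ j = a k * (c * a k ^ (m k - Suc j)) + v div a k ^ j"
    unfolding eq using a_pos[of k] by (subst div_mult_self2) auto
  then show ?thesis using assms by (simp add: digit_def)
qed

text \<open>Mixed radix numeral: the offset in the long tower of place \<open>t\<close> in letter
  \<open>j\<close> of word \<open>v\<close> in run \<open>c\<close>.\<close>

definition code_pos :: "nat \<Rightarrow> nat \<Rightarrow> nat \<Rightarrow> nat \<Rightarrow> nat \<Rightarrow> nat" where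
  "code_pos k c v j t = ((c * a k ^ m k + v) * m k + j) * l k + t"

lemma code_index_less:
  assumes "c < r k" "v < a k ^ m k" "j < m k"
  shows "(c * a k ^ m k + v) * m k + j < r k * W k"
proof -
  have "c * a k ^ m k + v < Suc c * a k ^ m k" using assms by simp
  also have "\<dots> \<le> r k * a k ^ m k" using assms by (intro mult_le_mono1) simp
  finally have "Suc (c * a k ^ m k + v) * m k \<le> r k * a k ^ m k * m k" by (intro mult_le_mono1) simp
  moreover have "(c * a k ^ m k + v) * m k + j < Suc (c * a k ^ m k + v) * m k" using assms by simp
  ultimately have "(c * a k ^ m k + v) * m k + j < r k * a k ^ m k * m k" by (rule order.strict_trans2[rotated])
  then show ?thesis by (simp add: W_def mult_ac)
qed

lemma code_pos_less:
  assumes "c < r k" "v < a k ^ m k" "j < m k" "t < l k"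
  shows "code_pos k c v j t < b (Suc k)"
  using orig_code(1)[OF code_index_less[OF assms(1-3)] assms(4)] b_Suc_parts[of k]
  by (simp add: code_pos_def)

lemma code_pos_inj:
  assumes "code_pos k c v j t = code_pos k c' v' j' t'"
    and "v < a k ^ m k" "v' < a k ^ m k" "j < m k" "j' < m k" "t < l k" "t' < l k"
  shows "c = c' \<and> v = v' \<and> j = j' \<and> t = t'"
proof -
  have un: "x = x' \<and> y = y'" if "x * q + y = x' * q + y'" "y < q" "y' < q" for x y x' y' q :: nat
  proof -
    have "x = (x * q + y) div q" "x' = (x' * q + y') div q" using that(2,3) by simp_all
    then show ?thesis using that by simp
  qed
  show ?thesis
    using un[OF assms(1)[unfolded code_pos_def] assms(6,7)] un[of _ "m k" j _ j'] un[of _ "a k ^ m k" v _ v'] assms(2-5)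
    by blast
qed

lemma sym_code:
  assumes "c < r k" "v < a k ^ m k" "j < m k" "t < l k"
  shows "sym (Suc k) (r (Suc k) * a (Suc k) + code_pos k c v j t) = letter k (v div a k ^ j mod a k) t"
proof -
  let ?i = "(c * a k ^ m k + v) * m k + j"
  let ?d = "digit k ?i"
  have orig: "orig k (r (Suc k) * a (Suc k) + code_pos k c v j t) = cell k ?i t"
    unfolding code_pos_def by (rule orig_code(2)[OF code_index_less[OF assms(1-3)] assms(4)])
  have col: "?i div W k < r k"
    using code_index_less[OF assms(1-3)] by (simp add: less_mult_imp_div_less)
  have "sym (Suc k) (r (Suc k) * a (Suc k) + code_pos k c v j t) = letter k ?d t"
    using sym_column[OF col, of "(t - ?d) mod a k"] a_pos[of k]
    by (auto simp: orig cell_def letter_def Let_def)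
  then show ?thesis using digit_word[OF assms(3)] by simp
qed

text \<open>Copies inherit their symbol and spacers carry \<open>False\<close>, so the intervals
  with symbol \<open>True\<close> have length 2 altogether at every stage.\<close>

lemma card_sym: "card {x. x < a (Suc k) \<and> sym k x} = 2 * scale k"
proof (induction k)
  case 0
  have "{x. x < a (Suc 0) \<and> sym 0 x} = {x \<in> {0, 1, 2, 3}. odd x}"
    using init by (auto simp: a_Suc[of 0])
  also have "\<dots> = {1, 3}" by auto
  finally have "{x. x < a (Suc 0) \<and> sym 0 x} = {1, 3}" .
  then show ?case by simp
next
  case (Suc k)
  let ?S = "{x. x < a (Suc (Suc k)) \<and> sym (Suc k) x}"
  let ?S' = "{x. x < a (Suc k) \<and> sym k x}"
  have "orig k ` ?S = Inl ` (?S' \<times> {..<2 * r (Suc k)})"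
  proof (intro equalityI subsetI)
    fix y assume "y \<in> orig k ` ?S"
    then obtain x where x: "x < a (Suc (Suc k))" "sym (Suc k) x" "y = orig k x" by auto
    then obtain i c where ic: "orig k x = Inl (i, c)" "sym k i" by (auto split: sum.splits)
    then show "y \<in> Inl ` (?S' \<times> {..<2 * r (Suc k)})"
      using x orig_Inl_bounds[OF x(1) ic(1)] by auto
  next
    fix y :: "nat \<times> nat + nat" assume "y \<in> Inl ` (?S' \<times> {..<2 * r (Suc k)})"
    then obtain i c where ic: "y = Inl (i, c)" "i < a (Suc k)" "sym k i" "c < 2 * r (Suc k)" by auto
    then obtain x where "x < a (Suc (Suc k))" "orig k x = Inl (i, c)" using orig_exists by blast
    then show "y \<in> orig k ` ?S" using ic by (intro image_eqI[of _ _ x]) auto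
  qed
  moreover have "card (orig k ` ?S) = card ?S"
    by (intro card_image inj_on_subset[OF orig_inj]) auto
  ultimately have "card ?S = card (Inl ` (?S' \<times> {..<2 * r (Suc k)}) :: (nat \<times> nat + nat) set)" by simp
  also have "\<dots> = card ?S' * (2 * r (Suc k))"
    by (subst card_image) (auto simp: inj_on_def card_cartesian_product)
  finally show ?case using Suc by simp
qed

text \<open>The ones have length 2 in a line of length between 4 and 6.\<close>

lemma sym_balanced:
  "real (a (Suc k)) / 3 \<le> card {u \<in> {..<a (Suc k)}. sym (Suc k) u \<noteq> e}"
proof -
  let ?S = "{x. x < a (Suc k) \<and> sym k x}"
  have bounds: "4 * real (scale k) \<le> a (Suc k)" "real (a (Suc k)) \<le> 6 * scale k"
    using size_ge4[of k] size_le6[of k] scale_pos[of k] by (auto simp: size_def field_simps)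
  show ?thesis
  proof (cases e)
    case False
    have "{u \<in> {..<a (Suc k)}. sym (Suc k) u \<noteq> e} = ?S" using sym_prefix False by auto
    then show ?thesis using bounds card_sym[of k] by simp
  next
    case True
    have eq: "{u \<in> {..<a (Suc k)}. sym (Suc k) u \<noteq> e} = {..<a (Suc k)} - ?S" using sym_prefix True by auto
    have "card ({..<a (Suc k)} - ?S) = a (Suc k) - 2 * scale k"
      using card_sym[of k] by (subst card_Diff_subset) auto
    then show ?thesis using bounds unfolding eq by (simp add: of_nat_diff)
  qed
qed

lemma letter_dist_le: "letter_dist k d d' \<le> l k"
proof -
  have "letter_dist k d d' \<le> card {..<l k}" unfolding letter_dist_def by (intro card_mono) auto
  then show ?thesis by simp
qed

text \<open>At each time in the part of a letter that all shifts of \<open>A\<^sub>k\<close> cover, the symbol runs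
  through the whole word \<open>A\<^sub>k\<close> as the shift varies, so it disagrees with any fixed symbol for at
  least a third of the shifts.\<close>

lemma sum_letter_dist:
  assumes "0 < k"
  shows "real (a k) * l k / 6 \<le> (\<Sum>d<a k. letter_dist k d d')"
proof -
  obtain k' where k': "k = Suc k'" using assms by (cases k) auto
  let ?p = "reps k"
  let ?D = "\<lambda>d t. of_bool (letter k d t \<noteq> letter k d' t) :: real"
  have third: "real (a k) / 3 \<le> (\<Sum>d<a k. ?D d t)" if t: "t \<in> {a k..<?p * a k}" for t
  proof -
    have "letter k d t = sym k ((t - d) mod a k)" if "d < a k" for d
      using that t by (auto simp: letter_def)
    then have "(\<Sum>d<a k. ?D d t) = (\<Sum>d<a k. of_bool (sym k ((t - d) mod a k) \<noteq> letter k d' t))"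
      by (intro sum.cong) auto
    also have "\<dots> = real (card {d \<in> {..<a k}. sym k ((t - d) mod a k) \<noteq> letter k d' t})"
      by (simp add: of_bool_def sum.If_cases Int_def)
    also have "card {d \<in> {..<a k}. sym k ((t - d) mod a k) \<noteq> letter k d' t} = card {u \<in> {..<a k}. sym k u \<noteq> letter k d' t}"
      using t by (intro card_bij_filter[OF reflect_mod_bij]) auto
    also have "real \<dots> \<ge> real (a k) / 3" using sym_balanced[of k' "letter k d' t"] k' by simp
    finally show ?thesis .
  qed
  have "real (?p * a k - a k) * (real (a k) / 3) = (\<Sum>t\<in>{a k..<?p * a k}. real (a k) / 3)" by simp
  also have "\<dots> \<le> (\<Sum>t\<in>{a k..<?p * a k}. \<Sum>d<a k. ?D d t)" using third by (intro sum_mono)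
  also have "\<dots> \<le> (\<Sum>t<l k. \<Sum>d<a k. ?D d t)"
    by (intro sum_mono2) (auto simp: l_def intro!: sum_nonneg)
  also have "\<dots> = (\<Sum>d<a k. \<Sum>t<l k. ?D d t)" by (rule sum.swap)
  also have "\<dots> = (\<Sum>d<a k. real (letter_dist k d d'))"
    by (intro sum.cong refl) (simp add: letter_dist_def of_bool_def sum.If_cases Int_def)
  finally have *: "real (?p * a k - a k) * (real (a k) / 3) \<le> (\<Sum>d<a k. letter_dist k d d')" by simp
  \<comment> \<open>For \<open>p \<ge> 4\<close> the commonly covered part,
    \<open>(p - 1) * a k\<close> of the \<open>(p + 1) * a k\<close> places, is more than half of
    the letter; with a third of the shifts disagreeing there this gives 1/6.\<close>
  have p: "4 \<le> real ?p" using reps_ge[of k] by linarith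
  have eq: "real (?p * a k - a k) = (real ?p - 1) * a k"
    using reps_ge[of k] by (simp add: of_nat_diff algebra_simps)
  have "real (a k) * l k / 6 = (real ?p + 1) / 6 * (real (a k) * real (a k))" by (simp add: l_def algebra_simps)
  also have "\<dots> \<le> (real ?p - 1) / 3 * (real (a k) * real (a k))"
    using p by (intro mult_right_mono) auto
  also have "\<dots> = real (?p * a k - a k) * (real (a k) / 3)" unfolding eq by simp
  also note *
  finally show ?thesis .
qed

text \<open>The normalised distance lies between 0 and 1 and has mean at least 1/6, so
  \<open>exp (- u) \<le> 1 - u / 2\<close> gives a mean of at most
  \<open>1 - 1 / 12\<close>.\<close>

lemma sum_exp_letter_dist:
  assumes "0 < k"
  shows "(\<Sum>d<a k. exp (- (real (letter_dist k d d') / l k))) \<le> a k * exp (- (1 / 12))"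
proof -
  have l: "0 < real (l k)" using l_pos by simp
  have "(\<Sum>d<a k. exp (- (real (letter_dist k d d') / l k))) \<le> (\<Sum>d<a k. 1 - real (letter_dist k d d') / l k / 2)"
    using letter_dist_le l by (intro sum_mono exp_minus_le_half) (auto simp: divide_le_eq)
  also have "\<dots> = a k - (\<Sum>d<a k. letter_dist k d d') / (2 * l k)"
    by (simp add: sum_subtractf flip: sum_divide_distrib)
  also have "\<dots> \<le> a k - (real (a k) * l k / 6) / (2 * l k)"
    using sum_letter_dist[OF assms, of d'] l by (intro diff_left_mono divide_right_mono) auto
  also have "\<dots> = a k * (1 + - (1 / 12))" using l by (simp add: field_simps)
  also have "\<dots> \<le> a k * exp (- (1 / 12))" by (intro mult_left_mono exp_ge_add_one_self) simp
  finally show ?thesis .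
qed

text \<open>A Chernoff bound. Fix one word of \<open>V\<close> and weight every word by
  \<open>exp (- distance / l k)\<close>. The weights factorise over the letters, with total at most
  \<open>a k ^ m k * exp (- N / 12)\<close>, whereas each word of \<open>V\<close> weighs at least
  \<open>exp (- N / 24)\<close>.\<close>

lemma card_close_words:
  assumes k: "0 < k" and win: "j + N < m k"
    and close: "\<And>v. v \<in> V \<Longrightarrow> v < a k ^ m k"
      "\<And>v v'. v \<in> V \<Longrightarrow> v' \<in> V \<Longrightarrow>
        (\<Sum>s\<in>{j<..j + N}. letter_dist k (v div a k ^ s mod a k) (v' div a k ^ s mod a k)) \<le> N * real (l k) / 24"
  shows "real (card V) \<le> a k ^ m k * exp (- (real N / 24))"
proof (cases "V = {}")
  case True then show ?thesis by simp
next
  case False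
  then obtain v' where v': "v' \<in> V" by blast
  have l: "0 < real (l k)" using l_pos by simp
  \<comment> \<open>Weight 1 outside the window turns the product over the window into one over the
    whole word, to which \<open>sum_prod_digits\<close> applies.\<close>
  define g where "g s d = (if s \<in> {j<..j + N} then exp (- (real (letter_dist k d (v' div a k ^ s mod a k)) / l k)) else 1)" for s d
  let ?D = "\<lambda>v s. v div a k ^ s mod a k"
  have sub: "{j<..j + N} \<subseteq> {..<m k}" using win by auto
  have prod_g: "(\<Prod>s<m k. g s (?D v s)) = exp (- (\<Sum>s\<in>{j<..j + N}. real (letter_dist k (?D v s) (?D v' s)) / l k))" for v
  proof -
    have "(\<Prod>s<m k. g s (?D v s)) = (\<Prod>s\<in>{j<..j + N}. g s (?D v s))"
      using sub by (intro prod.mono_neutral_right) (auto simp: g_def)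
    also have "\<dots> = (\<Prod>s\<in>{j<..j + N}. exp (- (real (letter_dist k (?D v s) (?D v' s)) / l k)))"
      by (intro prod.cong) (auto simp: g_def)
    finally show ?thesis by (simp add: exp_sum flip: sum_negf)
  qed
  have low: "exp (- (real N / 24)) \<le> (\<Prod>s<m k. g s (?D v s))" if v: "v \<in> V" for v
  proof -
    have "(\<Sum>s\<in>{j<..j + N}. real (letter_dist k (?D v s) (?D v' s)) / l k) \<le> (N * real (l k) / 24) / l k"
      using close(2)[OF v v'] l by (simp only: sum_divide_distrib[symmetric] of_nat_sum) (intro divide_right_mono; simp)
    then show ?thesis using l by (simp add: prod_g)
  qed
  have finV: "finite V" using close(1) by (intro finite_subset[of V "{..<a k ^ m k}"]) auto
  have "card V * exp (- (real N / 24)) = (\<Sum>v\<in>V. exp (- (real N / 24)))" by simp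
  also have "\<dots> \<le> (\<Sum>v\<in>V. \<Prod>s<m k. g s (?D v s))" using low by (intro sum_mono)
  also have "\<dots> \<le> (\<Sum>v<a k ^ m k. \<Prod>s<m k. g s (?D v s))"
    using close(1) by (intro sum_mono2) (auto simp: g_def intro!: prod_nonneg)
  also have "\<dots> = (\<Prod>s<m k. \<Sum>d<a k. g s d)" by (rule sum_prod_digits[OF a_pos])
  also have "\<dots> \<le> (\<Prod>s<m k. a k * (if s \<in> {j<..j + N} then exp (- (1 / 12)) else 1))"
    using sum_exp_letter_dist[OF k] by (intro prod_mono) (auto simp: g_def intro!: sum_nonneg)
  also have "\<dots> = a k ^ m k * (\<Prod>s<m k. if s \<in> {j<..j + N} then exp (- (1 / 12)) else 1)"
    by (simp add: prod.distrib)
  also have "(\<Prod>s<m k. if s \<in> {j<..j + N} then exp (- (1 / 12)) else 1 :: real) = (\<Prod>s\<in>{j<..j + N}. exp (- (1 / 12)))"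
    using sub by (intro prod.mono_neutral_cong_right) auto
  also have "\<dots> = exp (- (real N / 12))" by (simp flip: exp_of_nat_mult)
  also have "exp (- (real N / 12)) = exp (- (real N / 24)) * exp (- (real N / 24))" by (simp flip: exp_add)
  finally have "card V * exp (- (real N / 24)) \<le> (a k ^ m k * exp (- (real N / 24))) * exp (- (real N / 24))"
    by (simp only: mult.assoc)
  then show ?thesis by (rule mult_right_le_imp_le) simp
qed

end

section \<open>Cover numbers of the two tower system\<close>

context two_tower_system
begin

section \<open>The partition into two symbols and its names\<close>

definition ones :: "real set" where
  "ones = (\<Union>i\<in>{i. i < a (Suc 0) \<and> sym 0 i}. J 0 i)"

definition colour :: "nat \<Rightarrow> real set" where
  "colour s = (if s = 2 then ones else space M - ones)"

lemma ones_sets: "ones \<in> sets M"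
  unfolding ones_def using J_sets by (intro sets.finite_UN) auto

lemma colour_partition: "finite_partition M 2 colour"
proof -
  have two: "{1..2::nat} = {1, 2}" by auto
  show ?thesis
    unfolding finite_partition_def two disjoint_family_on_def
    using ones_sets sets.sets_into_space[OF ones_sets] by (auto simp: colour_def)
qed

sublocale P: partitioned_system M T 2 colour
  by unfold_locales (use mpt colour_partition in \<open>auto simp: M_def\<close>)

lemma in_ones_forward: "\<lbrakk>i < a (Suc 0); sym 0 i; y \<in> J 0 i\<rbrakk> \<Longrightarrow> \<exists>x < a (Suc k). sym k x \<and> y \<in> J k x"
proof (induction k)
  case 0 then show ?case by blast
next
  case (Suc k)
  then obtain x where x: "x < a (Suc k)" "sym k x" "y \<in> J k x" by blast
  then obtain z c where z: "z < a (Suc (Suc k))" "orig k z = Inl (x, c)" "y \<in> J (Suc k) z"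
    using J_cover by blast
  moreover have "sym (Suc k) z" using x(2) z(2) by simp
  ultimately show ?case by blast
qed

lemma sym_imp_ones: "\<lbrakk>x < a (Suc k); sym k x; y \<in> J k x\<rbrakk> \<Longrightarrow> y \<in> ones"
proof (induction k arbitrary: x)
  case 0 then show ?case unfolding ones_def by blast
next
  case (Suc k)
  obtain i c where ic: "orig k x = Inl (i, c)" "sym k i" using Suc.prems(2) by (auto split: sum.splits)
  then show ?case using Suc.IH[of i] orig_Inl_bounds(1)[OF Suc.prems(1) ic(1)] J_Suc[OF Suc.prems(1) ic(1)] Suc.prems(3)
    by blast
qed

lemma in_ones_iff:
  assumes "x < a (Suc k)" "y \<in> J k x"
  shows "y \<in> ones \<longleftrightarrow> sym k x"
proof
  assume "y \<in> ones"
  then obtain i where "i < a (Suc 0)" "sym 0 i" "y \<in> J 0 i" unfolding ones_def by blast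
  then obtain x' where x': "x' < a (Suc k)" "sym k x'" "y \<in> J k x'" using in_ones_forward by blast
  then have "x' = x" using J_disjoint[OF x'(1) assms(1)] assms(2) by blast
  then show "sym k x" using x' by simp
qed (use sym_imp_ones assms in blast)

lemma orbit_B: "\<lbrakk>y \<in> J k (r k * a k + j); j + \<tau> < b k\<rbrakk> \<Longrightarrow> (T ^^ \<tau>) y \<in> J k (r k * a k + (j + \<tau>))"
proof (induction \<tau>)
  case (Suc \<tau>)
  then have "T ((T ^^ \<tau>) y) \<in> T ` J k (r k * a k + (j + \<tau>))" by (intro imageI) simp
  also have "\<dots> = J k (Suc (r k * a k + (j + \<tau>)))" using Suc.prems by (intro J_step below_top_B) simp
  finally show ?case by simp
qed simp

text \<open>Within the long tower the orbit meets no top, so it climbs level by level and reads the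
  code as written.\<close>

lemma code_itinerary:
  assumes y: "y \<in> J (Suc k) (r (Suc k) * a (Suc k) + code_pos k c v j t)"
    and idx: "c < r k" "v < a k ^ m k" "s < m k" "t' < l k"
    and pos: "code_pos k c v j t + \<tau> = code_pos k c v s t'"
  shows "itinerary 2 colour T y \<tau> = (if letter k (v div a k ^ s mod a k) t' then 2 else 1)"
proof -
  let ?x = "r (Suc k) * a (Suc k) + code_pos k c v s t'"
  have lt: "code_pos k c v s t' < b (Suc k)" by (rule code_pos_less[OF idx])
  have mem: "(T ^^ \<tau>) y \<in> J (Suc k) ?x" using orbit_B[OF y, of \<tau>] lt pos by simp
  have x: "?x < a (Suc (Suc k))" using lt by (simp add: a_Suc[of "Suc k"])
  have "(T ^^ \<tau>) y \<in> ones \<longleftrightarrow> letter k (v div a k ^ s mod a k) t'"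
    using in_ones_iff[OF x mem] sym_code[OF idx] by simp
  moreover have "(T ^^ \<tau>) y \<in> space M" using mem J_subset[OF x] by blast
  ultimately show ?thesis
    by (intro P.itinerary_unique) (auto simp: colour_def)
qed

text \<open>Letter \<open>j\<close> may be entered in its middle, and
  \<open>n \<ge> (N + 1) * l k\<close> guarantees only that letter \<open>j + N\<close> is
  completed. Both points read the letters with \<open>j < s \<le> j + N\<close> in full and at the
  same times, and \<open>?f\<close> gives these times.\<close>

lemma letter_dist_names:
  assumes y: "y \<in> J (Suc k) (r (Suc k) * a (Suc k) + code_pos k c v j t)"
      "y' \<in> J (Suc k) (r (Suc k) * a (Suc k) + code_pos k c v' j t)"
    and idx: "c < r k" "v < a k ^ m k" "v' < a k ^ m k" "t < l k" "j + N < m k"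
    and n: "(N + 1) * l k \<le> n"
  shows "(\<Sum>s\<in>{j<..j + N}. letter_dist k (v div a k ^ s mod a k) (v' div a k ^ s mod a k))
    \<le> card {\<tau>. \<tau> < n \<and> itinerary 2 colour T y \<tau> \<noteq> itinerary 2 colour T y' \<tau>}"
proof -
  let ?L = "\<lambda>s. {t'. t' < l k \<and> letter k (v div a k ^ s mod a k) t' \<noteq> letter k (v' div a k ^ s mod a k) t'}"
  let ?S = "SIGMA s:{j<..j + N}. ?L s"
  let ?f = "\<lambda>(s, t'). (s - j) * l k + t' - t"
  have pos: "code_pos k c u j t + ((s - j) * l k + t' - t) = code_pos k c u s t'" if js: "j < s" for u s t'
  proof -
    obtain d where d: "s = Suc (j + d)" using less_imp_Suc_add[OF js] by blast
    show ?thesis using idx(4) by (simp add: code_pos_def d algebra_simps)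
  qed
  have inj: "inj_on ?f ?S"
  proof (rule inj_onI)
    fix p q assume pq: "p \<in> ?S" "q \<in> ?S" "?f p = ?f q"
    obtain s t' s' t'' where st: "p = (s, t')" "q = (s', t'')" by (metis surj_pair)
    have "code_pos k c v s t' = code_pos k c v s' t''"
      using pos[of s v t'] pos[of s' v t''] pq st by auto
    then show "p = q" using code_pos_inj[of k c v s t' c v s' t''] pq st idx by auto
  qed
  have img: "?f ` ?S \<subseteq> {\<tau>. \<tau> < n \<and> itinerary 2 colour T y \<tau> \<noteq> itinerary 2 colour T y' \<tau>}"
  proof
    fix \<tau> assume "\<tau> \<in> ?f ` ?S"
    then obtain p where p: "p \<in> ?S" "\<tau> = ?f p" by blast
    obtain s t' where "p = (s, t')" by (metis surj_pair)
    then have st: "j < s" "s \<le> j + N" "t' \<in> ?L s" "\<tau> = (s - j) * l k + t' - t" using p by simp_all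
    have s: "s < m k" using st idx by simp
    have t': "t' < l k" using st by simp
    have "\<tau> < Suc (s - j) * l k" using st(4) t' by simp
    also have "\<dots> \<le> (N + 1) * l k" using st by (intro mult_le_mono1) simp
    finally have "\<tau> < n" using n by simp
    moreover have "itinerary 2 colour T y \<tau> \<noteq> itinerary 2 colour T y' \<tau>"
      using code_itinerary[OF y(1) idx(1,2) s t', of \<tau>] code_itinerary[OF y(2) idx(1,3) s t', of \<tau>]
        pos[OF st(1)] st(3,4) by auto
    ultimately show "\<tau> \<in> {\<tau>. \<tau> < n \<and> itinerary 2 colour T y \<tau> \<noteq> itinerary 2 colour T y' \<tau>}" by blast
  qed
  have "(\<Sum>s\<in>{j<..j + N}. letter_dist k (v div a k ^ s mod a k) (v' div a k ^ s mod a k)) = card ?S"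
    by (simp add: letter_dist_def)
  also have "\<dots> = card (?f ` ?S)" by (rule card_image[OF inj, symmetric])
  also have "\<dots> \<le> card {\<tau>. \<tau> < n \<and> itinerary 2 colour T y \<tau> \<noteq> itinerary 2 colour T y' \<tau>}"
    using img by (intro card_mono) auto
  finally show ?thesis .
qed

text \<open>Starting points in the first half of a word: as \<open>m k = 2 * \<nu> k\<close>, the
  \<open>\<nu> k\<close> letters from there on belong to the same word.\<close>

definition code_region :: "nat \<Rightarrow> nat set" where
  "code_region k = (\<lambda>(c, v, j, t). r (Suc k) * a (Suc k) + code_pos k c v j t) `
     ({..<r k} \<times> {..<a k ^ m k} \<times> {..<\<nu> k} \<times> {..<l k})"

lemma \<nu>_less_m: "j < \<nu> k \<Longrightarrow> j < m k"
  by (simp add: m_def)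

lemma code_region_subset: "code_region k \<subseteq> {..<a (Suc (Suc k))}"
  using code_pos_less \<nu>_less_m by (auto simp: code_region_def a_Suc[of "Suc k"])

lemma card_code_region: "card (code_region k) = r k * a k ^ m k * \<nu> k * l k"
proof -
  have "inj_on (\<lambda>(c, v, j, t). r (Suc k) * a (Suc k) + code_pos k c v j t)
     ({..<r k} \<times> {..<a k ^ m k} \<times> {..<\<nu> k} \<times> {..<l k})"
  proof (rule inj_onI, clarsimp)
    fix c v j t c' v' j' t'
    assume "code_pos k c v j t = code_pos k c' v' j' t'"
      "v < a k ^ m k" "v' < a k ^ m k" "j < \<nu> k" "j' < \<nu> k" "t < l k" "t' < l k"
    then show "c = c' \<and> v = v' \<and> j = j' \<and> t = t'"
      using code_pos_inj[of k c v j t c' v' j' t'] \<nu>_less_m by blast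
  qed
  then show ?thesis unfolding code_region_def
    by (simp add: card_image card_cartesian_product)
qed

text \<open>The short tower fills at least 1/3 of line \<open>k\<close>, because spacers are few and
  so \<open>b k \<le> 2 * (r k * a k)\<close>. Half of it goes into the code, half of the words is
  used, and line \<open>k\<close> has length at least 4 in a space of length at most 6:
  \<open>1/3 * 1/2 * 1/2 * 4/6 = 1/18\<close>.\<close>

lemma code_region_measure:
  assumes "0 < k"
  shows "1 / 18 \<le> measure M (\<Union>x\<in>code_region k. J (Suc k) x)"
proof -
  obtain k' where k': "k = Suc k'" using assms by (cases k) auto
  have "1 * (r k' * W k' * a k') \<le> reps k' * (r k' * W k' * a k')"
    using reps_ge[of k'] by (intro mult_le_mono1) simp
  then have "b k \<le> 2 * (r k * a k)" using spacers_le[of k'] unfolding k' b_Suc_W by linarith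
  then have "a (Suc k) \<le> 3 * (r k * a k)" unfolding a_Suc by linarith
  then have "real (a (Suc k)) \<le> real (3 * (r k * a k))" by (rule of_nat_mono)
  moreover have "4 * real (scale k) \<le> a (Suc k)"
    using size_ge4[of k] scale_pos[of k] by (simp add: size_def field_simps)
  ultimately have ra: "4 * real (scale k) \<le> 3 * (real (r k) * a k)" by simp
  have "real (scale (Suc k)) * total \<le> real (scale (Suc k)) * 6"
    using total_bounds by (intro mult_left_mono) auto
  also have "\<dots> = 3 * (4 * real (scale k)) * r (Suc k)" by simp
  also have "\<dots> \<le> 3 * (3 * (real (r k) * a k)) * r (Suc k)"
    using ra by (intro mult_right_mono mult_left_mono) auto
  also have "\<dots> = 18 * (real (r k) * a k ^ m k * \<nu> k * (reps k * a k))"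
    by (simp add: r_Suc m_def)
  also have "\<dots> \<le> 18 * real (card (code_region k))"
    unfolding card_code_region of_nat_mult l_def by (intro mult_left_mono) (auto simp: algebra_simps)
  finally have "real (scale (Suc k)) * total \<le> 18 * real (card (code_region k))" .
  moreover have "0 < real (scale (Suc k)) * total"
    using scale_pos[of "Suc k"] total_bounds by (intro mult_pos_pos) auto
  ultimately show ?thesis
    unfolding measure_J_Union[OF code_region_subset, of k] by (simp only: pos_le_divide_eq)
qed

text \<open>Points of the code region that start at the same place of a letter and lie in one Hamming
  ball carry words that are close letter by letter.\<close>

lemma ball_measure:
  assumes k: "0 < k" and N: "n div l k = Suc N" "2 \<le> N" and n: "n \<le> \<nu> k * l k"
    and \<epsilon>: "0 < \<epsilon>" "\<epsilon> \<le> 1 / 96"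
  shows "measure M ((\<Union>x\<in>code_region k. J (Suc k) x) \<inter> hamming_ball M 2 colour T n \<epsilon> x0)
    \<le> exp (- (real N / 24))"
proof -
  define base where "base = r (Suc k) * a (Suc k)"
  define ball where "ball = hamming_ball M 2 colour T n \<epsilon> x0"
  define V where "V c j t = {v. v < a k ^ m k \<and> J (Suc k) (base + code_pos k c v j t) \<inter> ball \<noteq> {}}" for c j t
  have l: "0 < l k" by (rule l_pos)
  have Nl: "(N + 1) * l k \<le> n" using N(1) by (metis Suc_eq_plus1 div_times_less_eq_dividend)
  have n2: "n < (N + 2) * l k"
  proof -
    have "n < l k + l k * (n div l k)" by (rule dividend_less_times_div[OF l])
    then show ?thesis using N(1) by (simp add: algebra_simps)
  qed
  have N\<nu>: "Suc N \<le> \<nu> k"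
  proof -
    have "(N + 1) * l k \<le> \<nu> k * l k" using Nl n by (rule order_trans)
    then show ?thesis using l unfolding mult_le_cancel2 by simp
  qed
  have Vcard: "real (card (V c j t)) \<le> a k ^ m k * exp (- (real N / 24))"
    if c: "c < r k" and j: "j < \<nu> k" and t: "t < l k" for c j t
  proof (rule card_close_words[OF k, where j = j])
    show win: "j + N < m k" using j N\<nu> by (simp add: m_def)
    show "v < a k ^ m k" if "v \<in> V c j t" for v using that by (simp add: V_def)
    fix v v' assume v: "v \<in> V c j t" and v': "v' \<in> V c j t"
    obtain y y' where y: "y \<in> J (Suc k) (base + code_pos k c v j t)" "y \<in> ball"
      and y': "y' \<in> J (Suc k) (base + code_pos k c v' j t)" "y' \<in> ball"
      using v v' by (auto simp: V_def)
    let ?w = "itinerary 2 colour T"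
    let ?diff = "\<lambda>x y. card {\<tau>. \<tau> < n \<and> ?w x \<tau> \<noteq> ?w y \<tau>}"
    have n0: "0 < real n" using Nl l by (cases n) auto
    have "real (?diff x0 y) < \<epsilon> * n" "real (?diff x0 y') < \<epsilon> * n"
      using y(2) y'(2) n0 by (auto simp: ball_def hamming_ball_def hamming_dist_def pos_divide_less_eq)
    moreover have "?diff y y' \<le> ?diff x0 y + ?diff x0 y'"
    proof -
      have "{\<tau>. \<tau> < n \<and> ?w y \<tau> \<noteq> ?w y' \<tau>} \<subseteq> {\<tau>. \<tau> < n \<and> ?w x0 \<tau> \<noteq> ?w y \<tau>} \<union> {\<tau>. \<tau> < n \<and> ?w x0 \<tau> \<noteq> ?w y' \<tau>}"
        by auto
      then have "?diff y y' \<le> card ({\<tau>. \<tau> < n \<and> ?w x0 \<tau> \<noteq> ?w y \<tau>} \<union> {\<tau>. \<tau> < n \<and> ?w x0 \<tau> \<noteq> ?w y' \<tau>})"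
        by (intro card_mono) auto
      also have "\<dots> \<le> ?diff x0 y + ?diff x0 y'" by (rule card_Un_le)
      finally show ?thesis .
    qed
    ultimately have "real (?diff y y') \<le> 2 * (\<epsilon> * n)" by linarith
    \<comment> \<open>The origin of 1/96: \<open>n < (N + 2) * l k \<le> 2 * N * l k\<close> for
      \<open>N \<ge> 2\<close>, so the bound becomes the \<open>N * l k / 24\<close> of
      \<open>card_close_words\<close>.\<close>
    also have "\<dots> \<le> 2 * (1 / 96 * n)" using \<epsilon> by (intro mult_left_mono mult_right_mono) auto
    also have "\<dots> \<le> 2 * (1 / 96 * (2 * N * l k))"
    proof -
      have "(N + 2) * l k \<le> 2 * N * l k" using N(2) by (intro mult_le_mono1) simp
      then have "real n \<le> real (2 * N * l k)" using n2 by (intro of_nat_mono) linarith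
      then show ?thesis by simp
    qed
    also have "\<dots> = N * real (l k) / 24" by simp
    finally have "real (?diff y y') \<le> N * real (l k) / 24" .
    moreover have "(\<Sum>s\<in>{j<..j + N}. letter_dist k (v div a k ^ s mod a k) (v' div a k ^ s mod a k)) \<le> ?diff y y'"
      using y y' v v' by (intro letter_dist_names[OF _ _ c _ _ t win Nl]) (auto simp: V_def base_def)
    ultimately show "(\<Sum>s\<in>{j<..j + N}. letter_dist k (v div a k ^ s mod a k) (v' div a k ^ s mod a k)) \<le> N * real (l k) / 24"
      by linarith
  qed
  \<comment> \<open>For a fixed run, letter position and place in the letter only the words in
    \<open>V\<close> can occur; \<open>H\<close> gathers all intervals that the ball meets.\<close>
  define C where "C = {..<r k} \<times> {..<\<nu> k} \<times> {..<l k}"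
  define H where "H = (\<Union>(c, j, t)\<in>C. (\<lambda>v. base + code_pos k c v j t) ` V c j t)"
  have finV: "finite (V c j t)" for c j t by (rule finite_subset[of _ "{..<a k ^ m k}"]) (auto simp: V_def)
  have HR: "H \<subseteq> code_region k"
  proof
    fix x assume "x \<in> H"
    then obtain c j t v where "(c, j, t) \<in> C" "v \<in> V c j t" "x = base + code_pos k c v j t"
      unfolding H_def by blast
    then show "x \<in> code_region k" unfolding code_region_def base_def
      by (intro image_eqI[of _ _ "(c, v, j, t)"]) (auto simp: C_def V_def)
  qed
  have "card H \<le> (\<Sum>p\<in>C. card ((\<lambda>v. base + code_pos k (fst p) v (fst (snd p)) (snd (snd p))) ` V (fst p) (fst (snd p)) (snd (snd p))))"
    unfolding H_def split_beta by (rule card_UN_le) (simp add: C_def)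
  also have "\<dots> \<le> (\<Sum>p\<in>C. card (V (fst p) (fst (snd p)) (snd (snd p))))"
    by (intro sum_mono card_image_le finV)
  finally have "real (card H) \<le> real (\<Sum>p\<in>C. card (V (fst p) (fst (snd p)) (snd (snd p))))"
    by (rule of_nat_mono)
  also have "\<dots> = (\<Sum>p\<in>C. real (card (V (fst p) (fst (snd p)) (snd (snd p)))))" by (rule of_nat_sum)
  also have "\<dots> \<le> (\<Sum>p\<in>C. a k ^ m k * exp (- (real N / 24)))"
    using Vcard by (intro sum_mono) (auto simp: C_def)
  also have "\<dots> = real (card (code_region k)) * exp (- (real N / 24))"
    by (simp add: C_def card_cartesian_product card_code_region)
  finally have cardH: "real (card H) \<le> real (card (code_region k)) * exp (- (real N / 24))" .
  have pos: "0 < real (scale (Suc k)) * total"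
    using scale_pos[of "Suc k"] total_bounds by (intro mult_pos_pos) auto
  have sub: "(\<Union>x\<in>code_region k. J (Suc k) x) \<inter> ball \<subseteq> (\<Union>x\<in>H. J (Suc k) x)"
  proof
    fix y assume y: "y \<in> (\<Union>x\<in>code_region k. J (Suc k) x) \<inter> ball"
    then obtain c v j t where i: "c < r k" "v < a k ^ m k" "j < \<nu> k" "t < l k"
      and yJ: "y \<in> J (Suc k) (base + code_pos k c v j t)"
      by (auto simp: code_region_def base_def)
    then have "v \<in> V c j t" using y by (auto simp: V_def)
    then have "base + code_pos k c v j t \<in> H"
      unfolding H_def using i by (intro UN_I[of "(c, j, t)"]) (auto simp: C_def)
    then show "y \<in> (\<Union>x\<in>H. J (Suc k) x)" using yJ by blast
  qed
  have HS: "H \<subseteq> {..<a (Suc (Suc k))}" using HR code_region_subset by blast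
  have "measure M ((\<Union>x\<in>code_region k. J (Suc k) x) \<inter> ball) \<le> measure M (\<Union>x\<in>H. J (Suc k) x)"
    using HS J_sets by (intro finite_measure_mono[OF sub] sets.finite_UN) (auto intro: finite_subset)
  also have "\<dots> = card H / (scale (Suc k) * total)" by (rule measure_J_Union[OF HS])
  also have "\<dots> \<le> (real (card (code_region k)) * exp (- (real N / 24))) / (scale (Suc k) * total)"
    using cardH pos by (intro divide_right_mono) auto
  also have "\<dots> = measure M (\<Union>x\<in>code_region k. J (Suc k) x) * exp (- (real N / 24))"
    using measure_J_Union[OF code_region_subset, of k] by simp
  also have "\<dots> \<le> 1 * exp (- (real N / 24))" by (intro mult_right_mono prob_le_1) simp
  finally show ?thesis by (simp add: ball_def)
qed

theorem cover_number_lower: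
  assumes k: "0 < k" and N: "n div l k = Suc N" "2 \<le> N" and n: "n \<le> \<nu> k * l k"
    and \<epsilon>: "0 < \<epsilon>" "\<epsilon> \<le> 1 / 96"
  shows "exp (real N / 24) / 36 \<le> hamming_cover_number M 2 colour T n \<epsilon>"
proof -
  let ?Y = "\<Union>x\<in>code_region k. J (Suc k) x"
  have Y: "?Y \<in> sets M"
    using code_region_subset[of k] J_sets by (intro sets.finite_UN) (auto intro: finite_subset)
  have "measure M ?Y - \<epsilon> \<le> hamming_cover_number M 2 colour T n \<epsilon> * exp (- (real N / 24))"
    using ball_measure[OF assms] by (intro P.hamming_cover_number_ge[OF \<epsilon>(1) Y])
  then have "1 / 36 \<le> hamming_cover_number M 2 colour T n \<epsilon> * exp (- (real N / 24))"
    using code_region_measure[OF k] \<epsilon>(2) by linarith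
  then show ?thesis by (simp add: exp_minus field_simps)
qed

text \<open>The intervals of a late stage and the remainder; this is the absence of atoms that
  \<open>rank_one_cover_number\<close> asks for.\<close>

lemma fine_partition:
  assumes "0 < \<eta>"
  shows "\<exists>q Q. finite_partition M q Q \<and> (\<forall>i\<in>{1..q}. measure M (Q i) \<le> \<eta>)"
proof -
  obtain k where k: "1 / scale k \<le> \<eta>" "1 - size k / total < \<eta>"
    using fine_stage[OF assms assms] by blast
  define U where "U = (\<Union>x<a (Suc k). J k x)"
  define Q where "Q i = (if i \<le> a (Suc k) then J k (i - 1) else space M - U)" for i
  have U: "U \<in> sets M" using J_sets by (auto simp: U_def)
  let ?q = "Suc (a (Suc k))"
  have QJ: "Q i = J k (i - 1)" "i - 1 < a (Suc k)" if "i \<in> {1..?q}" "i \<noteq> ?q" for i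
    using that by (auto simp: Q_def)
  have Qq: "Q ?q = space M - U" by (simp add: Q_def)
  have "Q i \<in> sets M" if "i \<in> {1..?q}" for i
    using QJ[OF that] J_sets Qq U by (cases "i = ?q") auto
  moreover have "Q i \<inter> Q j = {}" if "i \<in> {1..?q}" "j \<in> {1..?q}" "i \<noteq> j" for i j
  proof -
    have JU: "J k x \<subseteq> U" if "x < a (Suc k)" for x using that by (auto simp: U_def)
    show ?thesis
    proof (cases "i = ?q \<or> j = ?q")
      case True
      then show ?thesis using QJ[of i] QJ[of j] JU[of "i - 1"] JU[of "j - 1"] that Qq by auto
    next
      case False
      then have "i - 1 \<noteq> j - 1" using that by auto
      then show ?thesis using QJ[of i] QJ[of j] that False J_disjoint[of "i - 1" k "j - 1"] by simp
    qed
  qed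
  moreover have "(\<Union>i\<in>{1..?q}. Q i) = space M"
  proof -
    have "(\<Union>i\<in>{1..?q}. Q i) = (\<Union>x<?q. Q (Suc x))"
      by (simp only: image_Suc_lessThan[symmetric] image_image)
    also have "\<dots> = U \<union> (space M - U)" by (auto simp: lessThan_Suc Q_def U_def)
    also have "\<dots> = space M" using sets.sets_into_space[OF U] by blast
    finally show ?thesis .
  qed
  ultimately have "finite_partition M ?q Q" by (simp add: finite_partition_def disjoint_family_on_def)
  moreover have "measure M (Q i) \<le> \<eta>" if i: "i \<in> {1..?q}" for i
  proof (cases "i = ?q")
    case True
    then show ?thesis using measure_rest[of k] k(2) by (simp add: Q_def U_def)
  next
    case False
    have "1 / (scale k * total) \<le> 1 / scale k"
      using scale_pos[of k] total_bounds by (simp add: field_simps)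
    then show ?thesis using QJ[OF i False] J_measure k(1) by simp
  qed
  ultimately show ?thesis by blast
qed

end

section \<open>Subexponential scales\<close>

text \<open>The exponent is about \<open>n / (24 * L)\<close>. One half of it already exceeds
  \<open>ln (u n)\<close>, and the other half absorbs the rounding and the constant 36.\<close>

lemma subexponential_threshold:
  fixes u :: "nat \<Rightarrow> real"
  assumes L: "0 < L" and pos: "eventually (\<lambda>n. 0 < u n) sequentially"
    and sub: "(\<lambda>n. ln (u n) / n) \<longlonglongrightarrow> 0"
  shows "eventually (\<lambda>n. u n \<le> exp ((real (n div L) - 1) / 24) / 36) sequentially"
proof -
  have "eventually (\<lambda>n. ln (u n) / n < 1 / (48 * L)) sequentially"
    using sub by (rule order_tendstoD(2)) (use L in simp)
  moreover have "eventually (\<lambda>n. nat \<lceil>48 * L * (1 / 12 + ln 36)\<rceil> \<le> n \<and> 0 < n) sequentially"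
    by (intro eventually_conj eventually_ge_at_top eventually_gt_at_top)
  ultimately show ?thesis using pos
  proof eventually_elim
    case (elim n)
    then have n: "0 < real n" and large: "48 * L * (1 / 12 + ln 36) \<le> real n" by linarith+
    have "n \<le> L * (n div L + 1)" using dividend_less_times_div[OF L, of n] by simp
    then have "real n \<le> real (L * (n div L + 1))" by (rule of_nat_mono)
    then have div: "real n / L - 1 \<le> real (n div L)" using L by (simp add: field_simps)
    define x where "x = real n / (48 * L)"
    have "48 * x - 1 \<le> real (n div L)" using div by (simp add: x_def)
    moreover have "ln (u n) < x"
      using elim(1) n by (simp add: x_def pos_divide_less_eq)
    moreover have "1 / 12 + ln 36 \<le> x"
      using large L by (simp add: x_def pos_le_divide_eq mult.commute)
    ultimately have "ln (u n) \<le> (real (n div L) - 1) / 24 - ln 36" by (simp add: field_simps)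
    then have "exp (ln (u n)) \<le> exp ((real (n div L) - 1) / 24 - ln 36)" by simp
    then show ?case using elim(3) by (simp add: exp_diff)
  qed
qed

text \<open>The recursion finds \<open>a (Suc k)\<close> from stage \<open>k\<close> alone, so
  \<open>\<nu> k\<close> may be prescribed as any positive function of it.\<close>

lemma two_towers_exist:
  assumes F: "\<And>k A. 0 < F k A"
  obtains a b r \<nu> where "two_towers a b r \<nu>" "\<And>k. \<nu> k = F k (a (Suc k))"
proof -
  define st where "st = rec_nat (2, 1, 2) (\<lambda>k (a, r, b).
    let a' = r * a + b; W = 2 * F k a' * a ^ (2 * F k a'); r' = reps k * W
    in (a', r', r' * a' + r * W * a))"
  define a r b where "a k = fst (st k)" and "r k = fst (snd (st k))" and "b k = snd (snd (st k))" for k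
  have st: "st k = (a k, r k, b k)" for k by (simp add: a_def r_def b_def)
  have st_Suc: "st (Suc k) = (let a' = r k * a k + b k; W = 2 * F k a' * a k ^ (2 * F k a'); r' = reps k * W
    in (a', r', r' * a' + r k * W * a k))" for k
    using st[of k] by (simp add: st_def)
  have "a 0 = 2" "r 0 = 1" "b 0 = 2" by (simp_all add: a_def r_def b_def st_def)
  moreover have aS: "a (Suc k) = r k * a k + b k" for k
    using st[of "Suc k"] st_Suc[of k] by (simp add: Let_def)
  moreover have "r (Suc k) = reps k * (2 * F k (a (Suc k)) * a k ^ (2 * F k (a (Suc k))))" for k
    using st[of "Suc k"] st_Suc[of k] aS[of k] by (simp add: Let_def)
  moreover have "b (Suc k) = r (Suc k) * a (Suc k) + r k * (2 * F k (a (Suc k)) * a k ^ (2 * F k (a (Suc k)))) * a k" for k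
    unfolding b_def[of "Suc k"] r_def[of "Suc k"] aS st_Suc Let_def by simp
  ultimately have "two_towers a b r (\<lambda>k. F k (a (Suc k)))"
    using F by (simp add: two_towers_def)
  then show ?thesis using that by simp
qed

context two_tower_system
begin

text \<open>The first \<open>k\<close> with \<open>n \<le> \<nu> k * l k\<close> puts
  \<open>n\<close> beyond the range of the stage before. Consecutive ranges leave no gap, so every
  large \<open>n\<close> is served by a code.\<close>

lemma eventually_stage:
  "eventually (\<lambda>n. \<exists>k. \<nu> k * l k < n \<and> n \<le> \<nu> (Suc k) * l (Suc k) \<and> K \<le> k) sequentially"
proof -
  have "eventually (\<lambda>n. (\<Sum>j\<le>K. \<nu> j * l j) < n) sequentially" by (rule eventually_gt_at_top)
  then show ?thesis
  proof eventually_elim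
    case (elim n)
    have "n \<le> \<nu> n * l n"
    proof -
      have "1 * (1 * n) \<le> \<nu> n * ((reps n + 1) * a n)"
        using a_ge[of n] \<nu>_pos[of n] by (intro mult_le_mono) auto
      then show ?thesis by (simp add: l_def)
    qed
    then have ex: "n \<le> \<nu> (LEAST k. n \<le> \<nu> k * l k) * l (LEAST k. n \<le> \<nu> k * l k)" by (rule LeastI)
    define k where "k = (LEAST k. n \<le> \<nu> k * l k)"
    have k: "n \<le> \<nu> k * l k" using ex by (simp add: k_def)
    have Kk: "K < k"
    proof (rule ccontr)
      assume "\<not> K < k"
      then have "\<nu> k * l k \<le> (\<Sum>j\<le>K. \<nu> j * l j)" by (intro member_le_sum) auto
      then show False using k elim by simp
    qed
    then obtain k' where k': "k = Suc k'" by (cases k) auto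
    then have "\<not> n \<le> \<nu> k' * l k'" using not_less_Least[of k' "\<lambda>k. n \<le> \<nu> k * l k"] by (simp add: k_def[symmetric])
    then show ?case using k Kk k' by (intro exI[of _ k']) auto
  qed
qed

text \<open>Rank one would give cover numbers at most \<open>C * n\<close> for arbitrarily large
  \<open>n\<close>; the square is a convenient superlinear bound.\<close>

lemma not_rank_at_most_1:
  assumes grow: "eventually (\<lambda>n. real n ^ 2 \<le> hamming_cover_number M 2 colour T n (1 / 96)) sequentially"
  shows "\<not> rank_at_most 1 M T"
proof
  assume "rank_at_most 1 M T"
  then obtain C :: nat where C: "\<And>H. \<exists>n>H. hamming_cover_number M 2 colour T n (1 / 96) \<le> C * n"
    using P.rank_one_cover_number[of "1 / 96"] fine_partition by auto
  obtain N where N: "\<And>n. n \<ge> N \<Longrightarrow> real n ^ 2 \<le> hamming_cover_number M 2 colour T n (1 / 96)"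
    using grow by (auto simp: eventually_sequentially)
  obtain n where n: "n > max N C" "hamming_cover_number M 2 colour T n (1 / 96) \<le> C * n"
    using C by blast
  then have "real n ^ 2 \<le> real (C * n)" using N[of n] by (meson less_imp_le max_less_iff_conj of_nat_le_iff order_trans)
  then have "real n * real n \<le> real C * real n" by (simp add: power2_eq_square)
  then have "real n \<le> real C" using n(1) by (simp add: mult_le_cancel_right)
  then show False using n(1) by simp
qed

lemma lower_slow_entropy_infinite:
  fixes \<alpha> :: "nat \<Rightarrow> real \<Rightarrow> real"
  assumes pos: "\<And>t n. 0 < t \<Longrightarrow> 0 < \<alpha> n t"
    and grow: "\<And>t \<epsilon>. \<lbrakk>0 < t; 0 < \<epsilon>; \<epsilon> \<le> 1 / 96\<rbrakk> \<Longrightarrow>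
      eventually (\<lambda>n. \<alpha> n t \<le> hamming_cover_number M 2 colour T n \<epsilon>) sequentially"
  shows "lower_slow_entropy \<alpha> M T = \<infinity>"
proof -
  have rate: "slow_growth_rate \<alpha> M 2 colour T \<epsilon> = \<infinity>" if \<epsilon>: "0 < \<epsilon>" "\<epsilon> \<le> 1 / 96" for \<epsilon>
  proof -
    have set: "slow_growth_set \<alpha> M 2 colour T \<epsilon> = {0<..}"
    proof -
      have "0 < Liminf sequentially (\<lambda>n. ereal (real (hamming_cover_number M 2 colour T n \<epsilon>) / \<alpha> n t))"
        if t: "0 < t" for t
      proof -
        have "eventually (\<lambda>n. 1 \<le> ereal (real (hamming_cover_number M 2 colour T n \<epsilon>) / \<alpha> n t)) sequentially"
          using grow[OF t \<epsilon>] by eventually_elim (use pos[OF t] in \<open>simp add: pos_le_divide_eq\<close>)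
        then have "1 \<le> Liminf sequentially (\<lambda>n. ereal (real (hamming_cover_number M 2 colour T n \<epsilon>) / \<alpha> n t))"
          by (rule Liminf_bounded)
        then show ?thesis by (rule less_le_trans[rotated]) simp
      qed
      then show ?thesis by (auto simp: slow_growth_set_def)
    qed
    have "Sup (ereal ` {0<..}) = \<infinity>"
    proof (rule ereal_top)
      fix B :: real
      have "ereal B \<le> ereal (max B 1)" by simp
      also have "\<dots> \<le> Sup (ereal ` {0<..})" by (intro Sup_upper imageI) simp
      finally show "ereal B \<le> Sup (ereal ` {0<..})" .
    qed
    moreover have "{0::real<..} \<noteq> {}" by (simp add: greaterThan_non_empty)
    ultimately show ?thesis by (simp add: slow_growth_rate_def set Let_def)
  qed
  have "eventually (\<lambda>\<epsilon>. \<epsilon> \<in> {0<..<1 / 96 :: real}) (at_right 0)"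
    by (rule eventually_at_right_real) simp
  then have "eventually (\<lambda>\<epsilon>. slow_growth_rate \<alpha> M 2 colour T \<epsilon> = \<infinity>) (at_right 0)"
    by eventually_elim (use rate in auto)
  then have "lower_slow_entropy_partition \<alpha> M 2 colour T = \<infinity>"
    unfolding lower_slow_entropy_partition_def
    by (intro tendsto_Lim tendsto_eventually) (auto simp: trivial_limit_at_right_real)
  then have "\<infinity> \<in> {lower_slow_entropy_partition \<alpha> M m P T | m P. finite_partition M m P}"
    using colour_partition by force
  then have "\<infinity> \<le> lower_slow_entropy \<alpha> M T"
    unfolding lower_slow_entropy_def by (rule Sup_upper)
  then show ?thesis by simp
qed

end

theorem theorem1p1:
  fixes a :: "nat \<Rightarrow> real \<Rightarrow> real"
  assumes "scaling_function a"
    and "\<forall>t>0. (\<lambda>n. ln (a n t) / real n) \<longlonglongrightarrow> 0"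
  shows "\<exists>(X :: real set) (T :: real \<Rightarrow> real).
           is_interval X \<and> bounded X \<and> X \<subseteq> {0..} \<and> 0 < measure lborel X \<and>
           invertible_mpt (normalized_lborel X) T \<and>
           ergodic (normalized_lborel X) T \<and>
           has_rank 2 (normalized_lborel X) T \<and>
           lower_slow_entropy a (normalized_lborel X) T = \<infinity>"
proof -
  have pos: "0 < a n t" if "0 < t" for n t
    using assms(1) that by (simp add: scaling_function_def)
  \<comment> \<open>The parameter \<open>t = k\<close> grows with the stage, and monotonicity in
    \<open>t\<close> lets one system serve all \<open>t\<close>. The square is included to exclude
    rank one, and \<open>3 \<le> n div L\<close> provides the two full letters of
    \<open>cover_number_lower\<close>.\<close>
  define good where "good k L n \<longleftrightarrow> 3 \<le> n div L \<and>
    max (a n (real k)) (real n ^ 2) \<le> exp ((real (n div L) - 1) / 24) / 36" for k L n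
  have "\<exists>N. \<forall>n\<ge>N. good k L n" if k: "0 < k" and L: "0 < L" for k L
  proof -
    have sq: "(\<lambda>n. ln (real n ^ 2) / n) \<longlonglongrightarrow> 0"
      using tendsto_mult_right_zero[OF lim_ln_over_n, of 2]
      by (rule Lim_transform_eventually) (auto intro!: eventually_sequentiallyI[of 1] simp: ln_realpow)
    have sqpos: "eventually (\<lambda>n. 0 < real n ^ 2) sequentially"
      using eventually_gt_at_top[of 0] by eventually_elim simp
    have "eventually (\<lambda>n. 3 * L \<le> n) sequentially" by (rule eventually_ge_at_top)
    moreover have "eventually (\<lambda>n. a n (real k) \<le> exp ((real (n div L) - 1) / 24) / 36) sequentially"
      using k pos assms(2) by (intro subexponential_threshold[OF L]) auto
    moreover have "eventually (\<lambda>n. real n ^ 2 \<le> exp ((real (n div L) - 1) / 24) / 36) sequentially"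
      by (rule subexponential_threshold[OF L sqpos sq])
    ultimately have "eventually (good k L) sequentially"
    proof eventually_elim
      case (elim n)
      have "3 * L div L \<le> n div L" using elim(1) by (rule div_le_mono)
      then show ?case using elim L by (simp add: good_def)
    qed
    then show ?thesis by (simp add: eventually_sequentially)
  qed
  then have "\<forall>k L. \<exists>N. 0 < k \<longrightarrow> 0 < L \<longrightarrow> (\<forall>n\<ge>N. good k L n)" by blast
  then obtain thr where thr: "\<And>k L n. \<lbrakk>0 < k; 0 < L; thr k L \<le> n\<rbrakk> \<Longrightarrow> good k L n" by metis
  \<comment> \<open>\<open>\<nu> k\<close> exceeds the threshold for the letter length of the next
    stage, so every \<open>n > \<nu> k * l k \<ge> \<nu> k\<close> has passed it when the code of
    stage \<open>Suc k\<close> takes over.\<close>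
  obtain A B r \<nu> where tt: "two_towers A B r \<nu>"
    and \<nu>: "\<And>k. \<nu> k = Suc (thr (Suc k) ((reps (Suc k) + 1) * A (Suc k)))"
    using two_towers_exist[of "\<lambda>k x. Suc (thr (Suc k) ((reps (Suc k) + 1) * x))"] by blast
  interpret two_towers A B r \<nu> by fact
  obtain T J where tts: "two_tower_system A B r \<nu> T J" using system_exists by blast
  let ?M = "normalized_lborel {0..<total}"
  interpret S: two_tower_system A B r \<nu> T J ?M by fact
  have grow: "eventually (\<lambda>n. \<exists>k>K. max (a n (real k)) (real n ^ 2) \<le> hamming_cover_number ?M 2 S.colour T n \<epsilon>) sequentially"
    if \<epsilon>: "0 < \<epsilon>" "\<epsilon> \<le> 1 / 96" for K \<epsilon>
    using S.eventually_stage[of K]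
  proof eventually_elim
    case (elim n)
    then obtain k where k: "\<nu> k * l k < n" "n \<le> \<nu> (Suc k) * l (Suc k)" "K \<le> k" by blast
    have "\<nu> k * 1 \<le> \<nu> k * l k" using l_pos[of k] by (intro mult_le_mono2) simp
    then have "thr (Suc k) (l (Suc k)) \<le> n" using k(1) \<nu>[of k] by (simp add: l_def)
    then have "good (Suc k) (l (Suc k)) n" using l_pos by (intro thr) auto
    then have g: "3 \<le> n div l (Suc k)"
      "max (a n (real (Suc k))) (real n ^ 2) \<le> exp ((real (n div l (Suc k)) - 1) / 24) / 36"
      by (auto simp: good_def)
    obtain N where N: "n div l (Suc k) = Suc N" using g(1) by (cases "n div l (Suc k)") auto
    have "exp (real N / 24) / 36 \<le> hamming_cover_number ?M 2 S.colour T n \<epsilon>"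
      using N g(1) k(2) \<epsilon> by (intro S.cover_number_lower[of "Suc k"]) auto
    moreover have "max (a n (real (Suc k))) (real n ^ 2) \<le> exp (real N / 24) / 36"
      using g(2) unfolding N by (simp only: of_nat_Suc add_diff_cancel_left')
    ultimately have "max (a n (real (Suc k))) (real n ^ 2) \<le> hamming_cover_number ?M 2 S.colour T n \<epsilon>"
      by linarith
    then show ?case using k(3) by (intro exI[of _ "Suc k"]) auto
  qed
  have growa: "eventually (\<lambda>n. a n t \<le> hamming_cover_number ?M 2 S.colour T n \<epsilon>) sequentially"
    if t: "0 < t" and \<epsilon>: "0 < \<epsilon>" "\<epsilon> \<le> 1 / 96" for t \<epsilon>
    using grow[OF \<epsilon>, of "nat \<lceil>t\<rceil>"]
  proof eventually_elim
    case (elim n)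
    then obtain k where k: "nat \<lceil>t\<rceil> < k" "max (a n (real k)) (real n ^ 2) \<le> hamming_cover_number ?M 2 S.colour T n \<epsilon>"
      by blast
    have "t < real k" using k(1) t by linarith
    then have "a n t \<le> a n (real k)" using assms(1) t by (simp add: scaling_function_def)
    then show ?case using k(2) by simp
  qed
  have grow2: "eventually (\<lambda>n. real n ^ 2 \<le> hamming_cover_number ?M 2 S.colour T n (1 / 96)) sequentially"
    using grow[of "1 / 96" 0] by (auto elim: eventually_mono)
  have "has_rank 2 ?M T"
    using S.rank_at_most_2 S.not_rank_at_most_1[OF grow2] by (simp add: has_rank_def)
  moreover have "lower_slow_entropy a ?M T = \<infinity>"
    by (rule S.lower_slow_entropy_infinite[OF pos growa])
  moreover have "is_interval {0..<total}" "0 < measure lborel {0..<total}"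
    using total_bounds by auto
  ultimately show ?thesis
    using S.mpt S.ergodic by (intro exI[of _ "{0..<total}"] exI[of _ T]) auto
qed

end
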